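(* Consider the following problem $(P_1)$. There are $n$ items $1,\dots,n$ to be partitioned into $p$ clusters. Each item $j$ has a utility matrix $C^j\in\mathbb{R}^{d\times p}$ with columns $C^j_1,\dots,C^j_p$ and a weight vector $w^j=(w^j_1,\dots,w^j_p)\in\mathbb{Z}^p$; each cluster $i\in[p]$ has a prescribed total weight $b_i\in\mathbb{Z}$; and $f:\mathbb{R}^{d\times p}\to\mathbb{R}$ is a convex function. The task is $$(P_1)\qquad \max_{\pi\in\Pi}\ f\Bigl(\sum_{j\in\pi_1}C^j_1,\dots,\sum_{j\in\pi_p}C^j_p\Bigr)\quad\text{subject to}\quad \sum_{j\in\pi_i}w^j_i=b_i\quad (i\in[p]),$$ where $\Pi$ is the set of all partitions $\pi=(\pi_1,\dots,\pi_p)$ of $\{1,\dots,n\}$ into $p$ clusters. Suppose $d$ and $p$ are fixed and suppose there is a fixed, finite set $\Omega\subset\mathbb{Z}^p$ such that all $w^j\in\Omega$. Then for every convex $f$ presented by a comparison oracle, problem $(P_1)$ can be solved in polynomial time.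
   Context: Notation: $[p]=\{1,\dots,p\}$. A partition of $\{1,\dots,n\}$ into $p$ clusters is an ordered tuple $\pi=(\pi_1,\dots,\pi_p)$ of pairwise disjoint (possibly empty) subsets whose union is $\{1,\dots,n\}$. The column $C^j_i\in\mathbb{R}^d$ is the vector of utility values gained if item $j$ is assigned to cluster $\pi_i$, and $w^j_i$ is the weight item $j$ contributes to $\pi_i$ if assigned to it. The tuple $(\sum_{j\in\pi_1}C^j_1,\dots,\sum_{j\in\pi_p}C^j_p)$ is viewed as the $d\times p$ matrix with these columns. A comparison oracle for $f$ is a routine that, when queried on two arguments $y,z$, returns whether $f(y)\le f(z)$ or not. Polynomial time means polynomial in the size of the input, in particular in the number $n$ of items; $d$, $p$ and $\Omega$ are constants. *)

theory Defs
  imports "HOL-Analysis.Analysis" "HOL-Computational_Algebra.Polynomial"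
begin

section \<open>The partition problem\<close>

text \<open>
  The numbers $d$ and $p$ are the cardinalities of the index types \<open>'d\<close> and \<open>'p\<close>; the items are
  $1,\dots,n$, and \<open>C\<close> and \<open>w\<close> are only ever evaluated at these.
\<close>

definition partitions :: "nat \<Rightarrow> ('p::finite \<Rightarrow> nat set) set" where
  "partitions n = {\<pi>. disjoint_family \<pi> \<and> (\<Union>i. \<pi> i) = {1..n}}"

text \<open>The transpose turns the given family of vectors into the columns of a matrix.\<close>

definition utility_matrix :: "(nat \<Rightarrow> real ^ 'p ^ 'd) \<Rightarrow> ('p \<Rightarrow> nat set) \<Rightarrow> real ^ 'p ^ 'd" where
  "utility_matrix C \<pi> = transpose (\<chi> i. \<Sum>j\<in>\<pi> i. column i (C j))"

definition feasible :: "nat \<Rightarrow> (nat \<Rightarrow> int ^ 'p) \<Rightarrow> int ^ 'p \<Rightarrow> ('p::finite \<Rightarrow> nat set) set" where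
  "feasible n w b = {\<pi> \<in> partitions n. \<forall>i. (\<Sum>j\<in>\<pi> i. w j $ i) = b $ i}"

definition optimal ::
  "nat \<Rightarrow> (nat \<Rightarrow> real ^ 'p ^ 'd) \<Rightarrow> (nat \<Rightarrow> int ^ 'p) \<Rightarrow> int ^ 'p \<Rightarrow> (real ^ 'p ^ 'd \<Rightarrow> real)
    \<Rightarrow> ('p::finite \<Rightarrow> nat set) \<Rightarrow> bool" where
  "optimal n C w b f \<pi> \<longleftrightarrow>
     is_arg_max (\<lambda>\<pi>. f (utility_matrix C \<pi>)) (\<lambda>\<pi>. \<pi> \<in> feasible n w b) \<pi>"


section \<open>Oracle programs over the integers and the reals\<close>

text \<open>
  An algorithm is a finite while program working on a random access memory that consists of
  integer cells and real cells, both addressed by integers; addresses may be computed.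

  Every executed assignment and every evaluated test (oracle queries included) costs one time unit.
  Expressions are part of the program text, so each of them performs a number of operations that
  is bounded by a constant of the program. Products of reals may occur in tests but may not be
  stored, integers cannot be multiplied, and the only constants are integers. Hence unit cost
  cannot be abused: in $t$ steps the integers grow by $O(t)$ bits, and for rational input so do
  the numerators of the stored reals over the common denominator of the input. A polynomial number
  of steps is thus polynomial time both in the real number model and, for rational data, in the
  bit model.
\<close>

datatype iexp =
    IConst int
  | IMem iexp
  | IAdd iexp iexp
  | ISub iexp iexp

datatype lexp =
    LInt iexp
  | LMem iexp
  | LAdd lexp lexp
  | LSub lexp lexp

datatype rexp =
    RLin lexp
  | RAdd rexp rexp
  | RSub rexp rexp
  | RMul rexp rexp

datatype bexp =
    ILe iexp iexp
  | RLe rexp rexp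
  | OracleLe iexp iexp
  | BNot bexp
  | BAnd bexp bexp

datatype com =
    Skip
  | IStore iexp iexp
  | RStore iexp lexp
  | Seq com com
  | Cond bexp com com
  | While bexp com

type_synonym state = "(int \<Rightarrow> int) \<times> (int \<Rightarrow> real)"

primrec ival :: "iexp \<Rightarrow> state \<Rightarrow> int" where
  "ival (IConst c) s = c"
| "ival (IMem a) s = fst s (ival a s)"
| "ival (IAdd a b) s = ival a s + ival b s"
| "ival (ISub a b) s = ival a s - ival b s"

primrec lval :: "lexp \<Rightarrow> state \<Rightarrow> real" where
  "lval (LInt a) s = of_int (ival a s)"
| "lval (LMem a) s = snd s (ival a s)"
| "lval (LAdd x y) s = lval x s + lval y s"
| "lval (LSub x y) s = lval x s - lval y s"

primrec rval :: "rexp \<Rightarrow> state \<Rightarrow> real" where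
  "rval (RLin x) s = lval x s"
| "rval (RAdd x y) s = rval x s + rval y s"
| "rval (RSub x y) s = rval x s - rval y s"
| "rval (RMul x y) s = rval x s * rval y s"

definition block :: "nat \<Rightarrow> (int \<Rightarrow> real) \<Rightarrow> int \<Rightarrow> real list" where
  "block k R a = map (\<lambda>m. R (a + int m)) [0..<k]"

text \<open>
  The oracle \<open>orc\<close> takes two arguments consisting of \<open>k\<close> reals each; a query passes the addresses
  at which the arguments are stored.
\<close>

primrec bval :: "nat \<Rightarrow> (real list \<Rightarrow> real list \<Rightarrow> bool) \<Rightarrow> bexp \<Rightarrow> state \<Rightarrow> bool" where
  "bval k orc (ILe a b) s \<longleftrightarrow> ival a s \<le> ival b s"
| "bval k orc (RLe x y) s \<longleftrightarrow> rval x s \<le> rval y s"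
| "bval k orc (OracleLe a b) s \<longleftrightarrow> orc (block k (snd s) (ival a s)) (block k (snd s) (ival b s))"
| "bval k orc (BNot b) s \<longleftrightarrow> \<not> bval k orc b s"
| "bval k orc (BAnd b c) s \<longleftrightarrow> bval k orc b s \<and> bval k orc c s"

text \<open>\<open>exec k orc c s t s'\<close>: started in \<open>s\<close>, the program \<open>c\<close> halts in \<open>s'\<close> after \<open>t\<close> time units.\<close>

inductive exec ::
  "nat \<Rightarrow> (real list \<Rightarrow> real list \<Rightarrow> bool) \<Rightarrow> com \<Rightarrow> state \<Rightarrow> nat \<Rightarrow> state \<Rightarrow> bool"
  for k orc where
  Skip: "exec k orc Skip s 1 s"
| IStore: "exec k orc (IStore a e) s 1 ((fst s)(ival a s := ival e s), snd s)"
| RStore: "exec k orc (RStore a e) s 1 (fst s, (snd s)(ival a s := lval e s))"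
| Seq: "exec k orc c1 s t1 s1 \<Longrightarrow> exec k orc c2 s1 t2 s2 \<Longrightarrow> exec k orc (Seq c1 c2) s (t1 + t2) s2"
| CondTrue: "bval k orc b s \<Longrightarrow> exec k orc c1 s t s1 \<Longrightarrow> exec k orc (Cond b c1 c2) s (1 + t) s1"
| CondFalse: "\<not> bval k orc b s \<Longrightarrow> exec k orc c2 s t s1 \<Longrightarrow> exec k orc (Cond b c1 c2) s (1 + t) s1"
| WhileFalse: "\<not> bval k orc b s \<Longrightarrow> exec k orc (While b c) s 1 s"
| WhileTrue: "bval k orc b s \<Longrightarrow> exec k orc c s t1 s1 \<Longrightarrow> exec k orc (While b c) s1 t2 s2
    \<Longrightarrow> exec k orc (While b c) s (1 + t1 + t2) s2"

inductive_cases exec_elims: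
  "exec k orc Skip s t s'"
  "exec k orc (IStore a e) s t s'"
  "exec k orc (RStore a x) s t s'"
  "exec k orc (Seq c1 c2) s t s'"
  "exec k orc (Cond b c1 c2) s t s'"
  "exec k orc (While b c) s t s'"

lemma exec_deterministic:
  "exec k orc c s t s1 \<Longrightarrow> exec k orc c s t' s2 \<Longrightarrow> t = t' \<and> s1 = s2"
proof (induction arbitrary: t' s2 rule: exec.induct)
  case (Seq c1 s t1 s1 c2 t2 s2')
  from Seq.prems obtain u1 r1 u2 where
    "exec k orc c1 s u1 r1" "exec k orc c2 r1 u2 s2" "t' = u1 + u2"
    by (rule exec_elims(4)) simp
  with Seq.IH show ?case by metis
next
  case (CondTrue b s c1 t s1 c2)
  from CondTrue.prems obtain u where "exec k orc c1 s u s2" "t' = 1 + u"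
    by (rule exec_elims(5)) (use CondTrue.hyps in auto)
  with CondTrue.IH show ?case by metis
next
  case (CondFalse b s c2 t s1 c1)
  from CondFalse.prems obtain u where "exec k orc c2 s u s2" "t' = 1 + u"
    by (rule exec_elims(5)) (use CondFalse.hyps in auto)
  with CondFalse.IH show ?case by metis
next
  case (WhileTrue b s c t1 s1 t2 s2')
  from WhileTrue.prems obtain u1 r1 u2 where
    "exec k orc c s u1 r1" "exec k orc (While b c) r1 u2 s2" "t' = 1 + u1 + u2"
    by (rule exec_elims(6)) (use WhileTrue.hyps in auto)
  with WhileTrue.IH show ?case by metis
qed (auto elim: exec_elims)


section \<open>Input and output\<close>

text \<open>An arbitrary but fixed numbering of a finite index type.\<close>

definition index_list :: "'a::finite list" where
  "index_list = (SOME xs. distinct xs \<and> set xs = UNIV)"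

lemma distinct_index_list: "distinct (index_list :: 'a::finite list)"
  and set_index_list: "set (index_list :: 'a::finite list) = UNIV"
proof -
  have "\<exists>xs :: 'a list. distinct xs \<and> set xs = UNIV"
    using finite_distinct_list[of "UNIV :: 'a set"] by auto
  from someI_ex[OF this]
  show "distinct (index_list :: 'a list)" and "set (index_list :: 'a list) = UNIV"
    by (simp_all add: index_list_def)
qed

definition vec_list :: "'a ^ 'p::finite \<Rightarrow> 'a list" where
  "vec_list v = map (\<lambda>i. v $ i) index_list"

definition matrix_list :: "real ^ 'p::finite ^ 'd::finite \<Rightarrow> real list" where
  "matrix_list M = concat (map vec_list (vec_list M))"

lemma inj_vec_list: "inj (vec_list :: 'a ^ 'p::finite \<Rightarrow> 'a list)"
  by (auto simp: inj_def vec_list_def vec_eq_iff set_index_list)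

lemma inj_matrix_list: "inj (matrix_list :: real ^ 'p::finite ^ 'd::finite \<Rightarrow> real list)"
proof (rule injI)
  fix M N :: "real ^ 'p ^ 'd"
  assume "matrix_list M = matrix_list N"
  then have "map vec_list (vec_list M) = map vec_list (vec_list N)"
    unfolding matrix_list_def
    by (rule concat_injective) (auto simp: vec_list_def set_zip)
  then show "M = N"
    using inj_vec_list by (metis inj_map_eq_map injD)
qed

definition comparison_oracle ::
  "(real ^ 'p::finite ^ 'd::finite \<Rightarrow> real) \<Rightarrow> real list \<Rightarrow> real list \<Rightarrow> bool" where
  "comparison_oracle f ys zs \<longleftrightarrow> f (inv matrix_list ys) \<le> f (inv matrix_list zs)"

definition int_input :: "nat \<Rightarrow> (nat \<Rightarrow> int ^ 'p::finite) \<Rightarrow> int ^ 'p \<Rightarrow> int list" where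
  "int_input n w b = int n # vec_list b @ concat (map (\<lambda>j. vec_list (w j)) [1..<Suc n])"

definition real_input :: "nat \<Rightarrow> (nat \<Rightarrow> real ^ 'p::finite ^ 'd::finite) \<Rightarrow> real list" where
  "real_input n C = concat (map (\<lambda>j. matrix_list (C j)) [1..<Suc n])"

definition load :: "'a::zero list \<Rightarrow> int \<Rightarrow> 'a" where
  "load xs a = (if 0 \<le> a \<and> a < int (length xs) then xs ! nat a else 0)"

definition input_state ::
  "nat \<Rightarrow> (nat \<Rightarrow> real ^ 'p::finite ^ 'd::finite) \<Rightarrow> (nat \<Rightarrow> int ^ 'p) \<Rightarrow> int ^ 'p \<Rightarrow> state" where
  "input_state n C w b = (load (int_input n w b), load (real_input n C))"

text \<open>Every number in the input counts as one, regardless of its magnitude.\<close>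

definition input_size ::
  "nat \<Rightarrow> (nat \<Rightarrow> real ^ 'p::finite ^ 'd::finite) \<Rightarrow> (nat \<Rightarrow> int ^ 'p) \<Rightarrow> int ^ 'p \<Rightarrow> nat" where
  "input_size n C w b = length (int_input n w b) + length (real_input n C)"

text \<open>
  On halting, integer cell 0 tells whether the instance is feasible, and if it is, cell \<open>j\<close> contains
  the number (counted from 0) of the cluster of item \<open>j\<close>.
\<close>

definition output_partition :: "nat \<Rightarrow> state \<Rightarrow> 'p::finite \<Rightarrow> nat set" where
  "output_partition n s i =
     {j \<in> {1..n}. \<exists>m < CARD('p). fst s (int j) = int m \<and> index_list ! m = i}"

definition correct_output ::
  "nat \<Rightarrow> (nat \<Rightarrow> real ^ 'p::finite ^ 'd::finite) \<Rightarrow> (nat \<Rightarrow> int ^ 'p) \<Rightarrow> int ^ 'p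
    \<Rightarrow> (real ^ 'p ^ 'd \<Rightarrow> real) \<Rightarrow> state \<Rightarrow> bool" where
  "correct_output n C w b f s \<longleftrightarrow>
     (if feasible n w b = {} then fst s 0 = 0
      else fst s 0 = 1 \<and> optimal n C w b f (output_partition n s))"

end

theory Submission
  imports Defs
begin

text \<open>
  The program processes the items one by one. For every vector of weight sums it keeps assignments of
  the first \<open>k\<close> items whose utility matrices span the convex hull of the utilities of all assignments
  with these sums, and it discards an assignment whose utility lies in the convex hull of the others.
  As \<open>f\<close> is convex, a maximum is attained among the assignments that remain after the last item.

  The number of survivors is polynomial. Each of them is the unique maximum of a linear functional
  \<open>c\<close>, and it is determined by two data: how many items of each weight vector go to each cluster,
  and the signs of \<open>c\<close> on the vectors by which the utility changes when items of equal weight vector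
  move cyclically between clusters, at most one leaving each cluster. Indeed, two assignments with
  equal counts differ by such exchanges, and an exchange towards the other assignment gains for neither
  functional. There are polynomially many exchange vectors, and, halfspaces in dimension \<open>d p\<close> having
  VC dimension at most \<open>d p\<close>, polynomially many sign patterns on them.

  Since products of reals cannot be stored, membership in a convex hull is decided by a
  single test for each choice of \<open>d p + 1\<close> points (enough by Caratheodory's theorem): the program text
  contains a Fourier--Motzkin elimination of the \<open>d p\<close> coefficients of a separating functional.
\<close>

section \<open>Sign patterns of linear functionals\<close>

text \<open>Discarding is compatible with later items because placing an item in a fixed cluster
  translates utilities and weight sums alike: the hull over one class of weight sums is carried into
  the hull over another class. Hulls are formed separately for each vector of weight sums, since the
  maximum is wanted over a single class.

  The data behind the count are never computed. Functionals, exchange vectors and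
  \<open>\<Omega>\<close> occur in the analysis only; the program text depends on \<open>p\<close>
  and \<open>D\<close> alone. The count applies to the irredundant survivors of every prefix, so
  each stage starts with at most \<open>p\<close> times a polynomial number of records.

  The machine shapes the pruning. Normals of separating hyperplanes involve products of stored reals
  and cannot be kept, whereas their existence is a Boolean combination, of constant size, of sign
  conditions on polynomials and thus fits into one test.

  Ties need no perturbation: when the maximum is unique, an exchange of zero gain leaves the utility
  unchanged.\<close>

lemma card_le_card_shattered:
  fixes F :: "'a set set"
  assumes "finite X" "F \<subseteq> Pow X"
  shows "card F \<le> card {S. S \<subseteq> X \<and> (\<forall>T\<subseteq>S. \<exists>A\<in>F. A \<inter> S = T)}"
  using assms
proof (induction X arbitrary: F rule: finite_induct)
  case empty
  show ?case
  proof (cases "F = {}")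
    case False
    then have F: "F = {{}}" using empty by auto
    have "{S. S \<subseteq> {} \<and> (\<forall>T\<subseteq>S. \<exists>A\<in>F. A \<inter> S = T)} = {{}}" unfolding F by auto
    then show ?thesis by (simp add: F)
  qed simp
next
  case (insert x X)
  define sh where "sh = (\<lambda>(F::'a set set) X. {S. S \<subseteq> X \<and> (\<forall>T\<subseteq>S. \<exists>A\<in>F. A \<inter> S = T)})"
  \<comment> \<open>Pajor's argument for the Sauer--Shelah bound. Off \<open>x\<close>, the family
    yields its distinct traces \<open>F0\<close> and the traces \<open>F1\<close> that occur both
    with and without \<open>x\<close>. A set shattered by \<open>F1\<close> is still shattered by
    \<open>F\<close> once \<open>x\<close> is added, so the sets counted for \<open>F0\<close> and
    for \<open>F1\<close> are different.\<close>
  define H where "H = {A\<in>F. x \<in> A \<and> A - {x} \<in> F}"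
  define F0 where "F0 = (\<lambda>A. A - {x}) ` (F - H)"
  define F1 where "F1 = (\<lambda>A. A - {x}) ` H"
  have sub: "S \<subseteq> Z" if "S \<in> sh G Z" for S G Z using that by (simp add: sh_def)
  have shD: "\<exists>A\<in>G. A \<inter> S = T" if "S \<in> sh G Z" "T \<subseteq> S" for S G Z T
    using that(1)[unfolded sh_def, THEN CollectD, THEN conjunct2, rule_format, OF that(2)] .
  have shI: "S \<in> sh G Z" if "S \<subseteq> Z" "\<And>T. T \<subseteq> S \<Longrightarrow> \<exists>A\<in>G. A \<inter> S = T" for S G Z
    unfolding sh_def using that by (intro CollectI conjI allI impI)
  have finF: "finite F" using insert.prems insert.hyps(1) finite_subset[of F "Pow (insert x X)"] by auto
  have "inj_on (\<lambda>A. A - {x}) (F - H)"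
  proof (rule inj_onI)
    fix A B assume A: "A \<in> F - H" and B: "B \<in> F - H" and eq: "A - {x} = B - {x}"
    show "A = B"
    proof (cases "x \<in> A \<longleftrightarrow> x \<in> B")
      case True then show ?thesis using eq by auto
    next
      case False
      then consider "x \<in> A" "A - {x} = B" | "x \<in> B" "B - {x} = A" using eq by auto
      then show ?thesis using A B by cases (auto simp: H_def)
    qed
  qed
  then have c0: "card F0 = card (F - H)" by (simp add: F0_def card_image)
  have "inj_on (\<lambda>A. A - {x}) H"
    by (rule inj_onI) (auto simp: H_def)
  then have c1: "card F1 = card H" by (simp add: F1_def card_image)
  have cF: "card F = card F0 + card F1"
    using c0 c1 finF card_Diff_subset[of H F] card_mono[of F H] by (auto simp: H_def)
  have F0: "F0 \<subseteq> Pow X" and F1: "F1 \<subseteq> Pow X" using insert.prems by (auto simp: F0_def F1_def H_def)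
  have fsh: "finite (sh G (insert x X))" "finite (sh G X)" for G
    using insert.hyps(1) by (simp_all add: sh_def)
  have disj: "sh F0 X \<inter> insert x ` sh F1 X = {}" using insert.hyps(2) sub by blast
  have inj: "inj_on (insert x) (sh F1 X)"
  proof (rule inj_onI)
    fix S T assume "S \<in> sh F1 X" "T \<in> sh F1 X" "insert x S = insert x T"
    then show "S = T" using insert.hyps(2) insert_ident[of x S T] sub by blast
  qed
  have s0: "sh F0 X \<subseteq> sh F (insert x X)"
  proof
    fix S assume S: "S \<in> sh F0 X"
    have xS: "x \<notin> S" "S \<subseteq> insert x X" using insert.hyps(2) sub[OF S] by auto
    have "\<exists>A\<in>F. A \<inter> S = T" if T: "T \<subseteq> S" for T
    proof -
      obtain A where "A \<in> F0" "A \<inter> S = T" using shD[OF S T] by (elim bexE)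
      then obtain A' where A': "A' \<in> F" "(A' - {x}) \<inter> S = T" unfolding F0_def by blast
      have "A' \<inter> S = T" using A' xS by auto
      with A' show ?thesis by (intro bexI)
    qed
    with xS show "S \<in> sh F (insert x X)" by (intro shI)
  qed
  have s1: "insert x ` sh F1 X \<subseteq> sh F (insert x X)"
  proof
    fix S' assume "S' \<in> insert x ` sh F1 X"
    then obtain S where S: "S \<in> sh F1 X" and S': "S' = insert x S" by auto
    have xS: "x \<notin> S" "S \<subseteq> X" using insert.hyps(2) sub[OF S] by auto
    have "\<exists>A\<in>F. A \<inter> S' = T" if T: "T \<subseteq> S'" for T
    proof -
      have "T - {x} \<subseteq> S" using T S' by auto
      then obtain A where "A \<in> F1" "A \<inter> S = T - {x}" using shD[OF S, of "T - {x}"] by blast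
      then obtain B where B: "B \<in> H" "(B - {x}) \<inter> S = T - {x}" unfolding F1_def by blast
      show ?thesis
      proof (cases "x \<in> T")
        case True
        then have "B \<inter> S' = T" using B S' xS by (auto simp: H_def)
        then show ?thesis using B(1) by (intro bexI[of _ B]) (simp_all add: H_def)
      next
        case False
        then have "(B - {x}) \<inter> S' = T" using B S' xS by auto
        then show ?thesis using B(1) by (intro bexI[of _ "B - {x}"]) (simp_all add: H_def)
      qed
    qed
    moreover have "S' \<subseteq> insert x X" using S' xS by blast
    ultimately show "S' \<in> sh F (insert x X)" by (intro shI)
  qed
  have "card F \<le> card (sh F0 X) + card (sh F1 X)"
    using insert.IH[OF F0] insert.IH[OF F1] cF by (simp add: sh_def)
  also have "\<dots> = card (sh F0 X \<union> insert x ` sh F1 X)"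
    using disj fsh inj by (subst card_Un_disjoint) (auto simp: card_image)
  also have "\<dots> \<le> card (sh F (insert x X))"
    using s0 s1 fsh by (intro card_mono) auto
  finally show ?case by (simp add: sh_def)
qed

text \<open>Bounding a binomial coefficient by \<open>(m choose i) * card X ^ i\<close> is generous,
  but it turns the sum into the expansion of \<open>(card X + 1) ^ m\<close>.\<close>

lemma card_small_subsets:
  assumes "finite X"
  shows "card {S. S \<subseteq> X \<and> card S \<le> m} \<le> (card X + 1) ^ m"
proof -
  have "{S. S \<subseteq> X \<and> card S \<le> m} = (\<Union>i\<le>m. {S. S \<subseteq> X \<and> card S = i})" by auto
  also have "card \<dots> \<le> (\<Sum>i\<le>m. card {S. S \<subseteq> X \<and> card S = i})"
    by (rule card_UN_le) simp
  also have "\<dots> = (\<Sum>i\<le>m. card X choose i)" using n_subsets[OF assms] by simp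
  also have "\<dots> \<le> (\<Sum>i\<le>m. (m choose i) * card X ^ i)"
  proof (rule sum_mono)
    fix i assume i: "i \<in> {..m}"
    have "card X choose i \<le> card X ^ i"
      by (cases "i \<le> card X") (auto simp: binomial_le_pow binomial_eq_0)
    also have "\<dots> \<le> (m choose i) * card X ^ i" using i by (simp add: Suc_le_eq)
    finally show "card X choose i \<le> (m choose i) * card X ^ i" .
  qed
  also have "\<dots> = (card X + 1) ^ m" by (subst binomial) simp
  finally show ?thesis .
qed

text \<open>More than \<open>DIM('a)\<close> points are linearly dependent. If they were shattered,
  some \<open>c\<close> would be positive exactly at the points with positive coefficient, and
  pairing \<open>c\<close> with the vanishing combination would give a positive number. The
  halfspaces are homogeneous, so a linear dependence takes the place of a Radon partition and the
  exponent is the dimension itself.\<close>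

lemma card_halfspace_patterns:
  fixes X :: "'a::euclidean_space set"
  assumes fin: "finite X"
  shows "card (range (\<lambda>c. {x\<in>X. 0 < c \<bullet> x})) \<le> (card X + 1) ^ DIM('a)"
proof -
  let ?F = "range (\<lambda>c. {x\<in>X. 0 < c \<bullet> x})"
  have "card ?F \<le> card {S. S \<subseteq> X \<and> (\<forall>T\<subseteq>S. \<exists>A\<in>?F. A \<inter> S = T)}"
    by (rule card_le_card_shattered[OF fin]) auto
  also have "\<dots> \<le> card {S. S \<subseteq> X \<and> card S \<le> DIM('a)}"
  proof (rule card_mono)
    show "finite {S. S \<subseteq> X \<and> card S \<le> DIM('a)}" using fin by simp
    show "{S. S \<subseteq> X \<and> (\<forall>T\<subseteq>S. \<exists>A\<in>?F. A \<inter> S = T)} \<subseteq> {S. S \<subseteq> X \<and> card S \<le> DIM('a)}"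
    proof safe
      fix S assume S: "S \<subseteq> X" and sh: "\<forall>T\<subseteq>S. \<exists>A\<in>?F. A \<inter> S = T"
      show "card S \<le> DIM('a)"
      proof (rule ccontr)
        assume "\<not> card S \<le> DIM('a)"
        then have dep: "dependent S" using dependent_biggerset[of S] S fin finite_subset by auto
        have finS: "finite S" using S fin finite_subset by auto
        obtain u v where v: "v \<in> S" "u v \<noteq> 0" and s0: "(\<Sum>x\<in>S. u x *\<^sub>R x) = 0"
          using dep dependent_finite[OF finS] by auto
        \<comment> \<open>Passing to the negative if necessary makes some coefficient positive; this
          provides the one strictly positive term in the sum below.\<close>
        obtain u where v: "0 < u v" and s0: "(\<Sum>x\<in>S. u x *\<^sub>R x) = 0"
        proof (cases "0 < u v")
          case True then show ?thesis using that s0 by auto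
        next
          case False
          then show ?thesis using that[of "\<lambda>x. - u x"] s0 v by (simp add: sum_negf)
        qed
        have "{x\<in>S. 0 < u x} \<subseteq> S" by auto
        with sh obtain c where c: "{x\<in>X. 0 < c \<bullet> x} \<inter> S = {x\<in>S. 0 < u x}" by (smt (verit) image_iff)
        have nn: "0 \<le> u x * (c \<bullet> x)" if "x \<in> S" for x
        proof (cases "0 < u x")
          case True
          then have "0 < c \<bullet> x" using c that S by auto
          then show ?thesis using True by simp
        next
          case False
          then have "\<not> 0 < c \<bullet> x" using c that S by auto
          then show ?thesis using False by (simp add: mult_nonpos_nonpos)
        qed
        have "0 < c \<bullet> v" using c v \<open>v \<in> S\<close> S by auto
        then have "0 < u v * (c \<bullet> v)" using v by simp
        also have "\<dots> \<le> (\<Sum>x\<in>S. u x * (c \<bullet> x))"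
          using nn \<open>v \<in> S\<close> finS by (intro member_le_sum) auto
        also have "\<dots> = c \<bullet> (\<Sum>x\<in>S. u x *\<^sub>R x)" by (simp add: inner_sum_right)
        finally show False using s0 by simp
      qed
    qed
  qed
  also have "\<dots> \<le> (card X + 1) ^ DIM('a)" by (rule card_small_subsets[OF fin])
  finally show ?thesis .
qed

section \<open>Assignments with an extreme utility\<close>

text \<open>A matrix that can be nonzero only in column \<open>i\<close>, so that utilities of
  assignments add up item by item.\<close>

definition placed :: "(nat \<Rightarrow> real ^ 'p ^ 'd) \<Rightarrow> nat \<Rightarrow> 'p::finite \<Rightarrow> real ^ 'p ^ 'd" where
  "placed C j i = (\<chi> a c. if c = i then C j $ a $ c else 0)"

definition total_utility :: "(nat \<Rightarrow> real ^ 'p ^ 'd) \<Rightarrow> nat \<Rightarrow> (nat \<Rightarrow> 'p::finite) \<Rightarrow> real ^ 'p ^ 'd" where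
  "total_utility C k a = (\<Sum>j\<in>{1..k}. placed C j (a j))"

definition total_weight :: "(nat \<Rightarrow> int ^ 'p) \<Rightarrow> nat \<Rightarrow> (nat \<Rightarrow> 'p::finite) \<Rightarrow> int ^ 'p" where
  "total_weight w k a = (\<Sum>j\<in>{1..k}. axis (a j) (w j $ a j))"

definition exchange_vector :: "(nat \<Rightarrow> real ^ 'p ^ 'd) \<Rightarrow> ('p::finite \<Rightarrow> nat \<times> 'p) \<Rightarrow> real ^ 'p ^ 'd" where
  "exchange_vector C e =
     (\<Sum>i | fst (e i) \<noteq> 0. placed C (fst (e i)) (snd (e i)) - placed C (fst (e i)) i)"

text \<open>A minimal set of clusters closed under following a misplaced item is permuted by doing so.\<close>

lemma exchange_exists:
  fixes x y :: "nat \<Rightarrow> 'p::finite" and w :: "nat \<Rightarrow> 't"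
  assumes counts: "\<And>\<omega> i. card {j\<in>{1..k}. w j = \<omega> \<and> x j = i} = card {j\<in>{1..k}. w j = \<omega> \<and> y j = i}"
    and j0: "j0 \<in> {1..k}" "x j0 \<noteq> y j0"
  obtains A g jj \<omega> where "A \<noteq> {}" "bij_betw g A A"
    "\<And>i. i \<in> A \<Longrightarrow> jj i \<in> {1..k} \<and> w (jj i) = \<omega> \<and> x (jj i) = i \<and> y (jj i) = g i \<and> g i \<noteq> i"
proof -
  define \<omega> where "\<omega> = w j0"
  define M where "M = {i. \<exists>j\<in>{1..k}. w j = \<omega> \<and> x j = i \<and> y j \<noteq> i}"
  define jj where "jj = (\<lambda>i. SOME j. j \<in> {1..k} \<and> w j = \<omega> \<and> x j = i \<and> y j \<noteq> i)"
  define g where "g = (\<lambda>i. y (jj i))"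
  have jj: "jj i \<in> {1..k} \<and> w (jj i) = \<omega> \<and> x (jj i) = i \<and> y (jj i) \<noteq> i" if "i \<in> M" for i
    unfolding jj_def by (rule someI_ex) (use that in \<open>auto simp: M_def\<close>)
  \<comment> \<open>Otherwise all items of this weight vector that \<open>x\<close> puts into
    \<open>g i\<close> stay there under \<open>y\<close>. As the counts agree, no further one can
    arrive, yet \<open>jj i\<close> does.\<close>
  have gM: "g i \<in> M" if i: "i \<in> M" for i
  proof (rule ccontr)
    assume n: "g i \<notin> M"
    let ?X = "{j\<in>{1..k}. w j = \<omega> \<and> x j = g i}" and ?Y = "{j\<in>{1..k}. w j = \<omega> \<and> y j = g i}"
    have "?X \<subseteq> ?Y" using n by (auto simp: M_def)
    then have "?X = ?Y" using counts[of \<omega> "g i"] by (intro card_subset_eq) auto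
    moreover have "jj i \<in> ?Y" using jj[OF i] by (auto simp: g_def)
    ultimately have "jj i \<in> ?X" by (rule ssubst)
    then show False using jj[OF i] by (auto simp: g_def)
  qed
  have "\<exists>A. (A \<noteq> {} \<and> A \<subseteq> M \<and> g ` A \<subseteq> A) \<and> (\<forall>B. B \<noteq> {} \<and> B \<subseteq> M \<and> g ` B \<subseteq> B \<longrightarrow> card A \<le> card B)"
  proof (rule ex_has_least_nat[where P = "\<lambda>A. A \<noteq> {} \<and> A \<subseteq> M \<and> g ` A \<subseteq> A" and k = M])
    have "x j0 \<in> M" unfolding M_def \<omega>_def using j0 by auto
    then show "M \<noteq> {} \<and> M \<subseteq> M \<and> g ` M \<subseteq> M" using gM by blast
  qed
  then obtain A where A0: "A \<noteq> {} \<and> A \<subseteq> M \<and> g ` A \<subseteq> A"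
      "\<forall>B. B \<noteq> {} \<and> B \<subseteq> M \<and> g ` B \<subseteq> B \<longrightarrow> card A \<le> card B"
    by (elim exE conjE[where P = "_ \<and> _"])
  then have A: "A \<noteq> {}" "A \<subseteq> M" "g ` A \<subseteq> A" by simp_all
  have min: "card A \<le> card B" if "B \<noteq> {}" "B \<subseteq> M" "g ` B \<subseteq> B" for B
    using A0(2) that by simp
  \<comment> \<open>The image is itself closed under \<open>g\<close>, so minimality forbids it to
    be smaller; on a finite set \<open>g\<close> is then a bijection.\<close>
  have "card A \<le> card (g ` A)" using A by (intro min) auto
  then have "g ` A = A" using A(3) by (intro card_seteq) auto
  then have "bij_betw g A A" by (simp add: bij_betw_def eq_card_imp_inj_on)
  moreover have "jj i \<in> {1..k} \<and> w (jj i) = \<omega> \<and> x (jj i) = i \<and> y (jj i) = g i \<and> g i \<noteq> i" if "i \<in> A" for i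
    using jj[of i] that A(2) by (auto simp: g_def)
  ultimately show ?thesis using that A(1) by blast
qed

text \<open>The moved items are distinct because \<open>jj i\<close> lies in cluster
  \<open>i\<close> under \<open>x\<close>. The group-valued \<open>G\<close> is arbitrary so that
  utilities, weight sums and counts are all covered.\<close>

lemma sum_exchange:
  fixes G :: "nat \<Rightarrow> 'p::finite \<Rightarrow> 'b::ab_group_add" and x y :: "nat \<Rightarrow> 'p"
  assumes "\<And>i. i \<in> A \<Longrightarrow> jj i \<in> {1..k} \<and> x (jj i) = i \<and> y (jj i) = g i"
  shows "(\<Sum>j\<in>{1..k}. G j (if j \<in> jj ` A then y j else x j))
    = (\<Sum>j\<in>{1..k}. G j (x j)) + (\<Sum>i\<in>A. G (jj i) (g i) - G (jj i) i)"
    and "(\<Sum>j\<in>{1..k}. G j (if j \<in> jj ` A then x j else y j))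
    = (\<Sum>j\<in>{1..k}. G j (y j)) - (\<Sum>i\<in>A. G (jj i) (g i) - G (jj i) i)"
proof -
  have inj: "inj_on jj A" using assms by (metis inj_onI)
  have sub: "jj ` A \<subseteq> {1..k}" using assms by auto
  have split: "sum h {1..k} = sum h ({1..k} - jj ` A) + sum h (jj ` A)" for h :: "nat \<Rightarrow> 'b"
    using sub by (intro sum.subset_diff) auto
  have img: "sum h (jj ` A) = (\<Sum>i\<in>A. h (jj i))" for h :: "nat \<Rightarrow> 'b"
    using inj by (simp add: sum.reindex)
  show "(\<Sum>j\<in>{1..k}. G j (if j \<in> jj ` A then y j else x j))
    = (\<Sum>j\<in>{1..k}. G j (x j)) + (\<Sum>i\<in>A. G (jj i) (g i) - G (jj i) i)"
    unfolding split img using assms by (simp add: sum_subtractf)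
  show "(\<Sum>j\<in>{1..k}. G j (if j \<in> jj ` A then x j else y j))
    = (\<Sum>j\<in>{1..k}. G j (y j)) - (\<Sum>i\<in>A. G (jj i) (g i) - G (jj i) i)"
    unfolding split img using assms by (simp add: sum_subtractf)
qed

text \<open>All moved items have the same weight vector and \<open>g\<close> permutes the clusters
  involved, so the changes cancel. With \<open>H\<close> giving a column of weights this preserves
  weight sums; with \<open>H\<close> an indicator it preserves counts.\<close>

lemma sum_exchange_invariant:
  fixes H :: "'t \<Rightarrow> 'p::finite \<Rightarrow> 'b::ab_group_add" and x y :: "nat \<Rightarrow> 'p"
  assumes A: "\<And>i. i \<in> A \<Longrightarrow> jj i \<in> {1..k} \<and> w (jj i) = \<omega> \<and> x (jj i) = i \<and> y (jj i) = g i \<and> g i \<noteq> i"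
    and bij: "bij_betw g A A"
  shows "(\<Sum>j\<in>{1..k}. H (w j) (if j \<in> jj ` A then y j else x j)) = (\<Sum>j\<in>{1..k}. H (w j) (x j))"
    and "(\<Sum>j\<in>{1..k}. H (w j) (if j \<in> jj ` A then x j else y j)) = (\<Sum>j\<in>{1..k}. H (w j) (y j))"
proof -
  have "(\<Sum>i\<in>A. H (w (jj i)) (g i) - H (w (jj i)) i) = (\<Sum>i\<in>A. H \<omega> (g i)) - (\<Sum>i\<in>A. H \<omega> i)"
    using A by (simp add: sum_subtractf)
  also have "\<dots> = 0" using sum.reindex_bij_betw[OF bij, of "H \<omega>"] by simp
  finally have 0: "(\<Sum>i\<in>A. H (w (jj i)) (g i) - H (w (jj i)) i) = 0" .
  have A': "jj i \<in> {1..k} \<and> x (jj i) = i \<and> y (jj i) = g i" if "i \<in> A" for i using A that by blast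
  show "(\<Sum>j\<in>{1..k}. H (w j) (if j \<in> jj ` A then y j else x j)) = (\<Sum>j\<in>{1..k}. H (w j) (x j))"
    using sum_exchange(1)[where G = "\<lambda>j. H (w j)", OF A'] 0 by simp
  show "(\<Sum>j\<in>{1..k}. H (w j) (if j \<in> jj ` A then x j else y j)) = (\<Sum>j\<in>{1..k}. H (w j) (y j))"
    using sum_exchange(2)[where G = "\<lambda>j. H (w j)", OF A'] 0 by simp
qed

text \<open>Only \<open>y\<close> is moved towards \<open>x\<close>, and the number of items on
  which they differ decreases. The assumption on signs is one implication; the opposite inequality
  comes from the optimality of \<open>y\<close>.\<close>

lemma same_pattern_imp_same_utility:
  fixes w :: "nat \<Rightarrow> int ^ 'p::finite" and C :: "nat \<Rightarrow> real ^ 'p ^ 'd::finite"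
  assumes cx: "\<And>z. total_weight w k z = total_weight w k x \<Longrightarrow> c \<bullet> total_utility C k z \<le> c \<bullet> total_utility C k x"
    and cy: "\<And>z. total_weight w k z = total_weight w k y \<Longrightarrow> c' \<bullet> total_utility C k z \<le> c' \<bullet> total_utility C k y"
    and cy': "\<And>z. total_weight w k z = total_weight w k y \<Longrightarrow> c' \<bullet> total_utility C k z = c' \<bullet> total_utility C k y
      \<Longrightarrow> total_utility C k z = total_utility C k y"
    and counts: "\<And>\<omega> i. card {j\<in>{1..k}. w j = \<omega> \<and> x j = i} = card {j\<in>{1..k}. w j = \<omega> \<and> y j = i}"
    and sgn: "\<And>e. (\<forall>i. fst (e i) \<le> k) \<Longrightarrow> 0 < c' \<bullet> exchange_vector C e \<Longrightarrow> 0 < c \<bullet> exchange_vector C e"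
  shows "total_utility C k x = total_utility C k y"
  using cy cy' counts
proof (induction "card {j\<in>{1..k}. x j \<noteq> y j}" arbitrary: y rule: less_induct)
  case less
  show ?case
  proof (cases "\<forall>j\<in>{1..k}. x j = y j")
    case True
    then show ?thesis by (simp add: total_utility_def)
  next
    case False
    then obtain j0 where j0: "j0 \<in> {1..k}" "x j0 \<noteq> y j0" by auto
    obtain A g jj \<omega> where A: "A \<noteq> {}" and bij: "bij_betw g A A" and
      jj: "\<And>i. i \<in> A \<Longrightarrow> jj i \<in> {1..k} \<and> w (jj i) = \<omega> \<and> x (jj i) = i \<and> y (jj i) = g i \<and> g i \<noteq> i"
      using exchange_exists[of k w x y, OF less.prems(3) j0] by metis
    have jj': "jj i \<in> {1..k} \<and> x (jj i) = i \<and> y (jj i) = g i" if "i \<in> A" for i using jj that by blast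
    define x' where "x' = (\<lambda>j. if j \<in> jj ` A then y j else x j)"
    define y' where "y' = (\<lambda>j. if j \<in> jj ` A then x j else y j)"
    define e where "e = (\<lambda>i. if i \<in> A then (jj i, g i) else (0, i))"
    define v where "v = (\<Sum>i\<in>A. placed C (jj i) (g i) - placed C (jj i) i)"
    have "jj i \<noteq> 0" if "i \<in> A" for i using jj[OF that] by auto
    then have "{i. fst (e i) \<noteq> 0} = A" by (auto simp: e_def)
    then have ev: "exchange_vector C e = v" by (simp add: exchange_vector_def v_def e_def)
    have ek: "\<forall>i. fst (e i) \<le> k" using jj by (auto simp: e_def)
    have px: "total_utility C k x' = total_utility C k x + v"
      unfolding total_utility_def x'_def v_def using sum_exchange(1)[of A jj k x y g "placed C", OF jj'] .
    have py: "total_utility C k y' = total_utility C k y - v"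
      unfolding total_utility_def y'_def v_def using sum_exchange(2)[of A jj k x y g "placed C", OF jj'] .
    have wx: "total_weight w k x' = total_weight w k x"
      unfolding total_weight_def x'_def
      by (rule sum_exchange_invariant(1)[where H = "\<lambda>v i. axis i (v $ i)", OF jj bij])
    have wy: "total_weight w k y' = total_weight w k y"
      unfolding total_weight_def y'_def
      by (rule sum_exchange_invariant(2)[where H = "\<lambda>v i. axis i (v $ i)", OF jj bij])
    have cnt: "card {j\<in>{1..k}. w j = \<nu> \<and> y' j = i} = card {j\<in>{1..k}. w j = \<nu> \<and> y j = i}" for \<nu> i
    proof -
      have card: "int (card {j\<in>{1..k}. w j = \<nu> \<and> z j = i}) = (\<Sum>j\<in>{1..k}. if w j = \<nu> \<and> z j = i then 1 else 0)" for z
        by (subst sum.inter_filter[symmetric]) auto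
      have "int (card {j\<in>{1..k}. w j = \<nu> \<and> y' j = i}) = int (card {j\<in>{1..k}. w j = \<nu> \<and> y j = i})"
        unfolding card y'_def
        by (rule sum_exchange_invariant(2)[where H = "\<lambda>v l. if v = \<nu> \<and> l = i then 1 else 0", OF jj bij])
      then show ?thesis by simp
    qed
    \<comment> \<open>Adding \<open>v\<close> is an exchange available to \<open>x\<close>,
      subtracting it one available to \<open>y\<close>. Optimality of \<open>x\<close> and the sign
      pattern give \<open>c' \<bullet> v \<le> 0\<close>, optimality of \<open>y\<close> gives the
      reverse, and a zero gain leaves the utility of \<open>y\<close> unchanged by
      uniqueness.\<close>
    have "c \<bullet> v \<le> 0" using cx[OF wx] by (simp add: px inner_add_right)
    then have le: "c' \<bullet> v \<le> 0" using sgn[OF ek] ev by force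
    have "c' \<bullet> total_utility C k y' \<le> c' \<bullet> total_utility C k y" using less.prems(1)[OF wy] .
    then have "c' \<bullet> v = 0" using le by (simp add: py inner_diff_right)
    then have eq: "total_utility C k y' = total_utility C k y"
      by (intro less.prems(2)[OF wy]) (simp add: py inner_diff_right)
    have "{j\<in>{1..k}. x j \<noteq> y' j} \<subset> {j\<in>{1..k}. x j \<noteq> y j}"
    proof
      show "{j\<in>{1..k}. x j \<noteq> y' j} \<subseteq> {j\<in>{1..k}. x j \<noteq> y j}" by (auto simp: y'_def)
      obtain i where i: "i \<in> A" using A by auto
      then have "jj i \<in> {j\<in>{1..k}. x j \<noteq> y j}" "jj i \<notin> {j\<in>{1..k}. x j \<noteq> y' j}"
        using jj[OF i] by (auto simp: y'_def)
      then show "{j\<in>{1..k}. x j \<noteq> y' j} \<noteq> {j\<in>{1..k}. x j \<noteq> y j}" by blast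
    qed
    then have "card {j\<in>{1..k}. x j \<noteq> y' j} < card {j\<in>{1..k}. x j \<noteq> y j}"
      by (intro psubset_card_mono) auto
    then have "total_utility C k x = total_utility C k y'"
    proof (rule less.hyps)
      show "card {j\<in>{1..k}. w j = \<nu> \<and> x j = i} = card {j\<in>{1..k}. w j = \<nu> \<and> y' j = i}" for \<nu> i
        using less.prems(3) cnt by metis
    qed (use less.prems(1,2) in \<open>simp_all add: eq wy\<close>)
    then show ?thesis using eq by simp
  qed
qed

section \<open>Separating functionals and the number of survivors\<close>

text \<open>Written with the differences \<open>y - x\<close>, separation is a homogeneous system of
  strict inequalities in \<open>c\<close>, the form to which elimination applies. An empty
  \<open>Y\<close> is included: its hull is empty and every \<open>c\<close> separates.\<close>

lemma not_in_hull_iff_separable: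
  fixes x :: "'a::euclidean_space"
  assumes "finite Y"
  shows "x \<notin> convex hull Y \<longleftrightarrow> (\<exists>c. \<forall>y\<in>Y. 0 < c \<bullet> (y - x))"
proof
  assume "x \<notin> convex hull Y"
  moreover have "closed (convex hull Y)" using assms by (simp add: compact_imp_closed finite_imp_compact_convex_hull)
  ultimately obtain c b where "c \<bullet> x < b" "\<forall>y\<in>convex hull Y. b < c \<bullet> y"
    using separating_hyperplane_closed_point[of "convex hull Y" x] by auto
  then have "\<forall>y\<in>Y. 0 < c \<bullet> (y - x)" using hull_subset[of Y convex] by (force simp: inner_diff_right)
  then show "\<exists>c. \<forall>y\<in>Y. 0 < c \<bullet> (y - x)" ..
next
  assume "\<exists>c. \<forall>y\<in>Y. 0 < c \<bullet> (y - x)"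
  then obtain c where "\<forall>y\<in>Y. 0 < c \<bullet> (y - x)" ..
  then have "Y \<subseteq> {y. c \<bullet> x < c \<bullet> y}" by (auto simp: inner_diff_right)
  moreover have "convex {y. c \<bullet> x < c \<bullet> y}" using convex_halfspace_gt[of "c \<bullet> x" c] by simp
  ultimately have "convex hull Y \<subseteq> {y. c \<bullet> x < c \<bullet> y}" by (rule hull_minimal)
  then show "x \<notin> convex hull Y" by auto
qed

text \<open>A separating \<open>c\<close> grows from \<open>x\<close> towards \<open>Y\<close>,
  hence \<open>- c\<close> is the functional wanted. A point of the enlarged hull is
  \<open>u *\<^sub>R x + v *\<^sub>R b\<close> with \<open>b\<close> in the hull of
  \<open>Y\<close>; its excess over \<open>x\<close> is \<open>v\<close> times a positive number and
  vanishes only for \<open>v = 0\<close>.\<close>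

lemma extreme_imp_unique_max:
  fixes x :: "'a::euclidean_space"
  assumes "finite Y" "x \<notin> convex hull Y"
  obtains c where "\<And>z. z \<in> convex hull (insert x Y) \<Longrightarrow> c \<bullet> z \<le> c \<bullet> x"
    "\<And>z. z \<in> convex hull (insert x Y) \<Longrightarrow> c \<bullet> z = c \<bullet> x \<Longrightarrow> z = x"
proof -
  obtain c where c: "\<And>y. y \<in> Y \<Longrightarrow> 0 < c \<bullet> (y - x)" using assms not_in_hull_iff_separable by metis
  have *: "c \<bullet> x \<le> c \<bullet> z \<and> (c \<bullet> z = c \<bullet> x \<longrightarrow> z = x)" if z: "z \<in> convex hull (insert x Y)" for z
  proof (cases "Y = {}")
    case True then show ?thesis using z by simp
  next
    case False
    then obtain u v b where uv: "0 \<le> u" "0 \<le> v" "u + v = 1" and b: "b \<in> convex hull Y" and zz: "z = u *\<^sub>R x + v *\<^sub>R b"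
      using z convex_hull_insert[of Y x] by auto
    have "Y \<subseteq> {y. c \<bullet> x < c \<bullet> y}" using c by (auto simp: inner_diff_right)
    moreover have "convex {y. c \<bullet> x < c \<bullet> y}" using convex_halfspace_gt[of "c \<bullet> x" c] by simp
    ultimately have "convex hull Y \<subseteq> {y. c \<bullet> x < c \<bullet> y}" by (rule hull_minimal)
    then have pos: "0 < c \<bullet> b - c \<bullet> x" using b by auto
    have u: "u = 1 - v" using uv by simp
    have eq: "c \<bullet> z - c \<bullet> x = v * (c \<bullet> b - c \<bullet> x)" by (simp add: zz u algebra_simps inner_add_right)
    have "0 \<le> v * (c \<bullet> b - c \<bullet> x)" using pos uv by simp
    moreover have "z = x" if "c \<bullet> z = c \<bullet> x"
    proof -
      have "v = 0" using eq that pos by simp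
      then show ?thesis using zz u by simp
    qed
    ultimately show ?thesis using eq by linarith
  qed
  show ?thesis
    by (rule that[of "- c"]) (use * in auto)
qed

text \<open>Counts and sign pattern determine a survivor. The first factor bounds the tables of
  counts; in the second, \<open>((k + 1) * CARD('p)) ^ CARD('p)\<close> is the number of encodings
  \<open>e\<close>, and the exponent \<open>CARD('d) * CARD('p)\<close> is the dimension of the
  utility space.\<close>

lemma card_extreme_assignments_le:
  fixes a :: "'r \<Rightarrow> nat \<Rightarrow> 'p::finite" and w :: "nat \<Rightarrow> int ^ 'p" and C :: "nat \<Rightarrow> real ^ 'p ^ 'd::finite"
  assumes "finite \<Omega>" "\<And>j. j \<in> {1..k} \<Longrightarrow> w j \<in> \<Omega>" "finite R"
    and cover: "\<And>z. total_utility C k z \<in>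
      convex hull {total_utility C k (a r) | r. r \<in> R \<and> total_weight w k (a r) = total_weight w k z}"
    and ext: "\<And>r. r \<in> R \<Longrightarrow> total_utility C k (a r) \<notin>
      convex hull {total_utility C k (a s) | s. s \<in> R \<and> s \<noteq> r \<and> total_weight w k (a s) = total_weight w k (a r)}"
  shows "card R \<le> (k + 1) ^ (card \<Omega> * CARD('p)) *
    (((k + 1) * CARD('p)) ^ CARD('p) + 1) ^ (CARD('d) * CARD('p))"
proof -
  define E where "E = {e :: 'p \<Rightarrow> nat \<times> 'p. \<forall>i. fst (e i) \<le> k}"
  define X where "X = exchange_vector C ` E"
  define cnt where "cnt = (\<lambda>r. \<lambda>(\<omega>, i) \<in> \<Omega> \<times> UNIV. card {j\<in>{1..k}. w j = \<omega> \<and> a r j = i})"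
  define opt where "opt = (\<lambda>r c. (\<forall>z. total_weight w k z = total_weight w k (a r) \<longrightarrow>
      c \<bullet> total_utility C k z \<le> c \<bullet> total_utility C k (a r) \<and>
      (c \<bullet> total_utility C k z = c \<bullet> total_utility C k (a r) \<longrightarrow> total_utility C k z = total_utility C k (a r))))"
  define c where "c = (\<lambda>r. SOME c. opt r c)"
  have c: "opt r (c r)" if r: "r \<in> R" for r
  proof -
    let ?Y = "{total_utility C k (a s) | s. s \<in> R \<and> s \<noteq> r \<and> total_weight w k (a s) = total_weight w k (a r)}"
    have "finite ?Y" using assms(3) by simp
    from extreme_imp_unique_max[OF this ext[OF r]] obtain c where
      c: "\<And>z. z \<in> convex hull (insert (total_utility C k (a r)) ?Y) \<Longrightarrow> c \<bullet> z \<le> c \<bullet> total_utility C k (a r)"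
      "\<And>z. z \<in> convex hull (insert (total_utility C k (a r)) ?Y) \<Longrightarrow> c \<bullet> z = c \<bullet> total_utility C k (a r) \<Longrightarrow> z = total_utility C k (a r)"
      by blast
    \<comment> \<open>\<open>cover\<close> extends the optimality of \<open>a r\<close> from the
      survivors to all assignments with the same weight sums. This is essential, as the exchanged
      assignments need not be survivors.\<close>
    have "total_utility C k z \<in> convex hull (insert (total_utility C k (a r)) ?Y)"
      if "total_weight w k z = total_weight w k (a r)" for z
      using cover[of z] by (rule rev_subsetD) (rule hull_mono, use that in auto)
    then have "opt r c" using c by (auto simp: opt_def)
    then show ?thesis unfolding c_def by (rule someI)
  qed
  have finE: "finite E" and cardE: "card E = ((k + 1) * CARD('p)) ^ CARD('p)"
  proof -
    have E: "E = PiE UNIV (\<lambda>_. {..k} \<times> UNIV)" by (auto simp: E_def PiE_def Pi_def extensional_def mem_Times_iff)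
    show "finite E" unfolding E by (intro finite_PiE) auto
    show "card E = ((k + 1) * CARD('p)) ^ CARD('p)"
      unfolding E by (simp add: card_PiE)
  qed
  then have finX: "finite X" by (simp add: X_def)
  have "inj_on (\<lambda>r. (cnt r, {x\<in>X. 0 < c r \<bullet> x})) R"
  proof (rule inj_onI)
    fix r s assume r: "r \<in> R" and s: "s \<in> R"
      and eq: "(cnt r, {x\<in>X. 0 < c r \<bullet> x}) = (cnt s, {x\<in>X. 0 < c s \<bullet> x})"
    have counts: "card {j\<in>{1..k}. w j = \<omega> \<and> a r j = i} = card {j\<in>{1..k}. w j = \<omega> \<and> a s j = i}" for \<omega> i
    proof (cases "\<omega> \<in> \<Omega>")
      case True
      have "cnt r (\<omega>, i) = cnt s (\<omega>, i)" using eq by simp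
      then show ?thesis using True by (simp add: cnt_def)
    next
      case False
      then have "{j\<in>{1..k}. w j = \<omega> \<and> a r j = i} = {}" "{j\<in>{1..k}. w j = \<omega> \<and> a s j = i} = {}"
        using assms(2) by auto
      then show ?thesis by (simp only:)
    qed
    have ut: "total_utility C k (a r) = total_utility C k (a s)"
    proof (rule same_pattern_imp_same_utility[where c = "c r" and c' = "c s" and w = w])
      fix e :: "'p \<Rightarrow> nat \<times> 'p" assume "\<forall>i. fst (e i) \<le> k" "0 < c s \<bullet> exchange_vector C e"
      then show "0 < c r \<bullet> exchange_vector C e" using eq by (auto simp: X_def E_def)
    qed (use c[OF r] c[OF s] counts in \<open>auto simp: opt_def\<close>)
    have wt: "total_weight w k (a r) = total_weight w k (a s)"
    proof -
      have "total_weight w k (a q) = (\<Sum>(\<omega>, i)\<in>\<Omega> \<times> UNIV. of_nat (card {j\<in>{1..k}. w j = \<omega> \<and> a q j = i}) * axis i (\<omega> $ i))" for q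
      proof -
        \<comment> \<open>Grouping the items by weight vector and cluster shows that the counts
          determine the weight sums.\<close>
        have "total_weight w k (a q) = (\<Sum>t\<in>\<Omega> \<times> UNIV. \<Sum>j\<in>{j\<in>{1..k}. (w j, a q j) = t}. axis (a q j) (w j $ a q j))"
          unfolding total_weight_def
          by (rule sum.group[symmetric]) (use assms in auto)
        also have "\<dots> = (\<Sum>(\<omega>, i)\<in>\<Omega> \<times> UNIV. of_nat (card {j\<in>{1..k}. w j = \<omega> \<and> a q j = i}) * axis i (\<omega> $ i))"
          by (intro sum.cong) auto
        finally show ?thesis .
      qed
      then show ?thesis by (simp only: counts)
    qed
    show "r = s"
    proof (rule ccontr)
      \<comment> \<open>The two records would give the same point in the same class, so
        \<open>r\<close> would lie in the hull of the others.\<close>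
      assume "r \<noteq> s"
      then have "total_utility C k (a r) \<in> {total_utility C k (a s) | s. s \<in> R \<and> s \<noteq> r \<and> total_weight w k (a s) = total_weight w k (a r)}"
        using s ut wt \<open>r \<noteq> s\<close> by (intro CollectI exI[of _ s]) simp
      then show False by (rule notE[OF ext[OF r] hull_inc])
    qed
  qed
  then have "card R \<le> card ((\<Omega> \<times> (UNIV :: 'p set) \<rightarrow>\<^sub>E {..k}) \<times> range (\<lambda>c. {x\<in>X. 0 < c \<bullet> x}))"
  proof (rule card_inj_on_le[where f = "\<lambda>r. (cnt r, {x\<in>X. 0 < c r \<bullet> x})"])
    show "(\<lambda>r. (cnt r, {x\<in>X. 0 < c r \<bullet> x})) ` R \<subseteq> (\<Omega> \<times> (UNIV :: 'p set) \<rightarrow>\<^sub>E {..k}) \<times> range (\<lambda>c. {x\<in>X. 0 < c \<bullet> x})"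
    proof -
      have "card {j\<in>{1..k}. w j = \<omega> \<and> a r j = i} \<le> k" for r \<omega> i
      proof -
        have "card {j\<in>{1..k}. w j = \<omega> \<and> a r j = i} \<le> card {1..k}" by (rule card_mono) auto
        then show ?thesis by simp
      qed
      then have "cnt r \<in> \<Omega> \<times> (UNIV :: 'p set) \<rightarrow>\<^sub>E {..k}" for r
        unfolding cnt_def restrict_PiE_iff by (simp add: case_prod_beta)
      then show ?thesis by (intro image_subsetI SigmaI rangeI)
    qed
    have "range (\<lambda>c. {x\<in>X. 0 < c \<bullet> x}) \<subseteq> Pow X" by auto
    then have "finite (range (\<lambda>c. {x\<in>X. 0 < c \<bullet> x}))" using finX finite_subset by auto
    then show "finite ((\<Omega> \<times> (UNIV :: 'p set) \<rightarrow>\<^sub>E {..k}) \<times> range (\<lambda>c. {x\<in>X. 0 < c \<bullet> x}))"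
      using assms(1) by (intro finite_cartesian_product finite_PiE) auto
  qed
  also have "\<dots> = (k + 1) ^ (card \<Omega> * CARD('p)) * card (range (\<lambda>c. {x\<in>X. 0 < c \<bullet> x}))"
    using assms(1) by (simp add: card_cartesian_product card_PiE)
  also have "\<dots> \<le> (k + 1) ^ (card \<Omega> * CARD('p)) * (card X + 1) ^ DIM(real ^ 'p ^ 'd)"
    by (intro mult_left_mono card_halfspace_patterns finX) auto
  also have "\<dots> \<le> (k + 1) ^ (card \<Omega> * CARD('p)) * (((k + 1) * CARD('p)) ^ CARD('p) + 1) ^ (CARD('d) * CARD('p))"
  proof -
    have "card X \<le> card E" unfolding X_def by (rule card_image_le[OF finE])
    then show ?thesis unfolding cardE[symmetric] by (intro mult_left_mono) (auto intro!: power_mono)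
  qed
  finally show ?thesis .
qed

section \<open>Fourier--Motzkin elimination in a test\<close>

text \<open>Provides the value of the eliminated coefficient; either side may lack bounds, in which
  case \<open>Max\<close> or \<open>Min\<close> has no meaning there.\<close>

lemma exists_between_finite:
  fixes L U :: "real set"
  assumes "finite L" "finite U" "\<And>l u. l \<in> L \<Longrightarrow> u \<in> U \<Longrightarrow> l < u"
  shows "\<exists>t. (\<forall>l\<in>L. l < t) \<and> (\<forall>u\<in>U. t < u)"
proof -
  consider "L = {}" | "U = {}" | "L \<noteq> {}" "U \<noteq> {}" by blast
  then show ?thesis
  proof cases
    case 1
    have "\<exists>t. \<forall>u\<in>U. t < u"
    proof (cases "U = {}")
      case False
      then show ?thesis using assms(2) by (intro exI[of _ "Min U - 1"]) (auto dest: Min_le[OF assms(2)])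
    qed simp
    then show ?thesis using 1 by simp
  next
    case 2
    have "\<exists>t. \<forall>l\<in>L. l < t"
    proof (cases "L = {}")
      case False
      then show ?thesis using assms(1)
        by (intro exI[of _ "Max L + 1"]) (metis Max_ge less_add_one order_le_less_trans)
    qed simp
    then show ?thesis using 2 by simp
  next
    case 3
    then have "Max L < Min U" using assms by auto
    then obtain t where "Max L < t" "t < Min U" using dense by blast
    then show ?thesis using 3 assms by auto
  qed
qed

text \<open>Rows are functions on all naturals with only the first \<open>m\<close> entries
  consulted, so an elimination step merely lowers \<open>m\<close> and does not change the type of
  rows.\<close>

definition separated :: "nat \<Rightarrow> (nat \<Rightarrow> real) set \<Rightarrow> bool" where
  "separated m A \<longleftrightarrow> (\<exists>c. \<forall>a\<in>A. 0 < (\<Sum>l<m. a l * c l))"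

text \<open>A Fourier--Motzkin step. A row with positive and a row with negative last entry are
  combined with positive multipliers so that this entry cancels. Cross multiplication avoids
  division, which tests do not offer.\<close>

lemma separated_Suc:
  assumes fin: "finite A"
  shows "separated (Suc m) A \<longleftrightarrow> separated m
    ({a\<in>A. a m = 0} \<union> {\<lambda>l. a m * b l - b m * a l |a b. a \<in> A \<and> b \<in> A \<and> 0 < a m \<and> b m < 0})"
    (is "_ \<longleftrightarrow> separated m ?B")
proof
  assume "separated (Suc m) A"
  then obtain c where c: "\<And>a. a \<in> A \<Longrightarrow> 0 < (\<Sum>l<m. a l * c l) + a m * c m"
    by (auto simp: separated_def)
  have "0 < (\<Sum>l<m. d l * c l)" if "d \<in> ?B" for d
    using that
  proof
    assume "d \<in> {a\<in>A. a m = 0}"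
    then show ?thesis using c[of d] by auto
  next
    assume "d \<in> {\<lambda>l. a m * b l - b m * a l |a b. a \<in> A \<and> b \<in> A \<and> 0 < a m \<and> b m < 0}"
    then obtain a b where d: "d = (\<lambda>l. a m * b l - b m * a l)" and ab: "a \<in> A" "b \<in> A" "0 < a m" "b m < 0" by auto
    have "(\<Sum>l<m. d l * c l) = a m * (\<Sum>l<m. b l * c l) - b m * (\<Sum>l<m. a l * c l)"
      by (simp add: d left_diff_distrib sum_subtractf sum_distrib_left mult.assoc)
    also have "\<dots> = a m * ((\<Sum>l<m. b l * c l) + b m * c m) + (- b m) * ((\<Sum>l<m. a l * c l) + a m * c m)"
      by (simp add: algebra_simps)
    also have "\<dots> > 0"
      using ab c[of a] c[of b] mult_pos_pos[of "a m" "(\<Sum>l<m. b l * c l) + b m * c m"]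
        mult_pos_pos[of "- b m" "(\<Sum>l<m. a l * c l) + a m * c m"] by linarith
    finally show ?thesis .
  qed
  then show "separated m ?B" unfolding separated_def by blast
next
  assume "separated m ?B"
  then obtain c where "\<forall>d\<in>?B. 0 < (\<Sum>l<m. d l * c l)" unfolding separated_def ..
  then have c: "0 < (\<Sum>l<m. d l * c l)" if "d \<in> ?B" for d by (rule bspec[OF _ that])
  let ?S = "\<lambda>a. \<Sum>l<m. a l * c l"
  \<comment> \<open>With \<open>c\<close> fixed on the lower coordinates, rows with positive last
    entry bound the new coefficient from below and those with negative last entry from above; the
    combined rows say that each lower bound is below each upper bound.\<close>
  have "\<exists>t. (\<forall>x\<in>(\<lambda>a. - ?S a / a m) ` {a\<in>A. 0 < a m}. x < t) \<and> (\<forall>x\<in>(\<lambda>b. ?S b / (- b m)) ` {b\<in>A. b m < 0}. t < x)"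
  proof (rule exists_between_finite)
    fix x y assume "x \<in> (\<lambda>a. - ?S a / a m) ` {a\<in>A. 0 < a m}" "y \<in> (\<lambda>b. ?S b / (- b m)) ` {b\<in>A. b m < 0}"
    then obtain a b where ab: "a \<in> A" "b \<in> A" "0 < a m" "b m < 0" and x: "x = - ?S a / a m" and y: "y = ?S b / (- b m)"
      by auto
    have "0 < (\<Sum>l<m. (a m * b l - b m * a l) * c l)" using ab by (intro c) auto
    also have "\<dots> = a m * ?S b - b m * ?S a"
      by (simp add: left_diff_distrib sum_subtractf sum_distrib_left mult.assoc)
    finally have "(- b m) * (- ?S a) < a m * ?S b" by simp
    then show "x < y" using ab unfolding x y by (simp add: field_simps)
  qed (use fin in auto)
  then obtain t where t: "\<And>a. a \<in> A \<Longrightarrow> 0 < a m \<Longrightarrow> - ?S a / a m < t" "\<And>b. b \<in> A \<Longrightarrow> b m < 0 \<Longrightarrow> t < ?S b / (- b m)"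
    by auto
  have "0 < (\<Sum>l<Suc m. a l * (c(m := t)) l)" if a: "a \<in> A" for a
  proof -
    have "0 < ?S a + a m * t"
    proof (cases "a m" "0 :: real" rule: linorder_cases)
      case equal then show ?thesis using c[of a] a by auto
    next
      case greater then show ?thesis using t(1)[OF a] by (simp add: field_simps)
    next
      case less then show ?thesis using t(2)[OF a] by (simp add: field_simps)
    qed
    then show ?thesis by simp
  qed
  then show "separated (Suc m) A" unfolding separated_def by blast
qed

definition conj_test :: "bexp list \<Rightarrow> bexp" where
  "conj_test gs = foldr BAnd gs (ILe (IConst 0) (IConst 0))"

lemma bval_conj_test [simp]: "bval k orc (conj_test gs) s \<longleftrightarrow> (\<forall>g\<in>set gs. bval k orc g s)"
  by (induction gs) (auto simp: conj_test_def)

definition pos_test :: "rexp \<Rightarrow> bexp" where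
  "pos_test e = BNot (RLe e (RLin (LInt (IConst 0))))"

definition neg_test :: "rexp \<Rightarrow> bexp" where
  "neg_test e = BNot (RLe (RLin (LInt (IConst 0))) e)"

lemma bval_pos_test [simp]: "bval k orc (pos_test e) s \<longleftrightarrow> 0 < rval e s"
  and bval_neg_test [simp]: "bval k orc (neg_test e) s \<longleftrightarrow> rval e s < 0"
  by (auto simp: pos_test_def neg_test_def)

text \<open>
  The sign conditions of an elimination step cannot be decided when the program is written, so every
  row carries a guard and counts only if the guard holds at run time.
\<close>

primrec infeasible_test :: "nat \<Rightarrow> (bexp \<times> (nat \<Rightarrow> rexp)) list \<Rightarrow> bexp" where
  "infeasible_test 0 R = BNot (conj_test (map (BNot \<circ> fst) R))"
| "infeasible_test (Suc m) R = infeasible_test m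
    ([(BAnd g (BAnd (BNot (pos_test (a m))) (BNot (neg_test (a m)))), a). (g, a) \<leftarrow> R] @
     [(BAnd (BAnd g (pos_test (a m))) (BAnd h (neg_test (b m))),
       \<lambda>l. RSub (RMul (a m) (b l)) (RMul (b m) (a l))). (g, a) \<leftarrow> R, (h, b) \<leftarrow> R])"

definition active_rows ::
  "nat \<Rightarrow> (real list \<Rightarrow> real list \<Rightarrow> bool) \<Rightarrow> (bexp \<times> (nat \<Rightarrow> rexp)) list \<Rightarrow> state \<Rightarrow> (nat \<Rightarrow> real) set" where
  "active_rows k orc R s = {\<lambda>l. rval (a l) s | g a. (g, a) \<in> set R \<and> bval k orc g s}"

lemma active_rows_image:
  "active_rows k orc R s = (\<lambda>(g, a) l. rval (a l) s) ` {(g, a) \<in> set R. bval k orc g s}"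
  by (force simp: active_rows_def)

lemma bval_infeasible_test:
  "bval k orc (infeasible_test m R) s \<longleftrightarrow> \<not> separated m (active_rows k orc R s)"
proof (induction m arbitrary: R)
  case 0
  \<comment> \<open>Without coordinates every row reads \<open>0 < 0\<close>, so the system is
    infeasible exactly if some guard holds.\<close>
  show ?case by (force simp: separated_def active_rows_def)
next
  case (Suc m)
  let ?A = "active_rows k orc R s"
  define zero where "zero = (\<lambda>a. BAnd (BNot (pos_test (a m))) (BNot (neg_test (a m))))"
  define comb where "comb = (\<lambda>a b l. RSub (RMul (a m) (b l)) (RMul (b m) (a l)))"
  define R' where "R' = [(BAnd g (zero a), a). (g, a) \<leftarrow> R] @
     [(BAnd (BAnd g (pos_test (a m))) (BAnd h (neg_test (b m))), comb a b). (g, a) \<leftarrow> R, (h, b) \<leftarrow> R]"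
  have R': "(G, e) \<in> set R' \<longleftrightarrow> (\<exists>g. (g, e) \<in> set R \<and> G = BAnd g (zero e)) \<or>
      (\<exists>g a h b. (g, a) \<in> set R \<and> (h, b) \<in> set R \<and>
        G = BAnd (BAnd g (pos_test (a m))) (BAnd h (neg_test (b m))) \<and> e = comb a b)" for G e
    unfolding R'_def by force
  have mem: "d \<in> active_rows k orc S s \<longleftrightarrow> (\<exists>g a. d = (\<lambda>l. rval (a l) s) \<and> (g, a) \<in> set S \<and> bval k orc g s)" for d S
    by (simp add: active_rows_def)
  have fin: "finite ?A" unfolding active_rows_image
    by (rule finite_imageI, rule finite_subset[of _ "set R"]) auto
  \<comment> \<open>At a given state the rows whose guards hold are precisely the outcome of the
    elimination step for that state, although all combinations were written down in advance.\<close>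
  have "active_rows k orc R' s = {a\<in>?A. a m = 0} \<union>
      {\<lambda>l. a m * b l - b m * a l |a b. a \<in> ?A \<and> b \<in> ?A \<and> 0 < a m \<and> b m < 0}" (is "_ = ?B1 \<union> ?B2")
  proof (intro subset_antisym subsetI)
    fix d assume "d \<in> active_rows k orc R' s"
    then obtain G e where d: "d = (\<lambda>l. rval (e l) s)" and G: "bval k orc G s" and "(G, e) \<in> set R'"
      unfolding mem by blast
    then consider g where "(g, e) \<in> set R" "G = BAnd g (zero e)"
      | g a h b where "(g, a) \<in> set R" "(h, b) \<in> set R" "G = BAnd (BAnd g (pos_test (a m))) (BAnd h (neg_test (b m)))"
        "e = comb a b"
      unfolding R' by blast
    then show "d \<in> ?B1 \<union> ?B2"
    proof cases
      case 1
      then have "bval k orc g s" "d m = 0" using d G by (auto simp: zero_def)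
      then have "d \<in> ?B1" using 1 d mem by blast
      then show ?thesis ..
    next
      case 2
      then have "(\<lambda>l. rval (a l) s) \<in> ?A" "(\<lambda>l. rval (b l) s) \<in> ?A" "0 < rval (a m) s" "rval (b m) s < 0"
        using G mem by auto
      moreover have "d = (\<lambda>l. rval (a m) s * rval (b l) s - rval (b m) s * rval (a l) s)"
        using 2 d by (simp add: comb_def)
      ultimately have "d \<in> ?B2"
        by (intro CollectI exI[of _ "\<lambda>l. rval (a l) s"] exI[of _ "\<lambda>l. rval (b l) s"]) simp
      then show ?thesis ..
    qed
  next
    fix d assume "d \<in> ?B1 \<union> ?B2"
    then show "d \<in> active_rows k orc R' s"
    proof
      assume "d \<in> ?B1"
      then obtain g a where ga: "(g, a) \<in> set R" "bval k orc g s" "d = (\<lambda>l. rval (a l) s)" "d m = 0"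
        using mem by blast
      then have "(BAnd g (zero a), a) \<in> set R'" "bval k orc (BAnd g (zero a)) s"
        unfolding R' by (auto simp: zero_def)
      then show ?thesis unfolding mem using ga(3) by blast
    next
      assume "d \<in> ?B2"
      then obtain a' b' where d: "d = (\<lambda>l. a' m * b' l - b' m * a' l)" and ab: "a' \<in> ?A" "b' \<in> ?A" "0 < a' m" "b' m < 0"
        by blast
      then obtain g a h b where ga: "(g, a) \<in> set R" "(h, b) \<in> set R" "bval k orc g s" "bval k orc h s"
        "a' = (\<lambda>l. rval (a l) s)" "b' = (\<lambda>l. rval (b l) s)"
        using mem by blast
      then have "(BAnd (BAnd g (pos_test (a m))) (BAnd h (neg_test (b m))), comb a b) \<in> set R'"
        unfolding R' by blast
      moreover have "bval k orc (BAnd (BAnd g (pos_test (a m))) (BAnd h (neg_test (b m)))) s"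
        using ga ab by simp
      moreover have "d = (\<lambda>l. rval (comb a b l) s)" by (simp add: d ga comb_def)
      ultimately show ?thesis unfolding mem by blast
    qed
  qed
  then show ?case
    unfolding infeasible_test.simps Suc.IH separated_Suc[OF fin] R'_def zero_def comb_def by simp
qed

section \<open>Total correctness with time bounds\<close>

text \<open>An upper bound on the time, not its exact value, lets branches and nested loops of
  differing cost be combined.\<close>

definition runs ::
  "nat \<Rightarrow> (real list \<Rightarrow> real list \<Rightarrow> bool) \<Rightarrow> com \<Rightarrow> state \<Rightarrow> nat \<Rightarrow> (state \<Rightarrow> bool) \<Rightarrow> bool" where
  "runs k orc c s T Q \<longleftrightarrow> (\<exists>t s'. exec k orc c s t s' \<and> t \<le> T \<and> Q s')"

lemma runs_mono:
  "runs k orc c s T Q \<Longrightarrow> T \<le> T' \<Longrightarrow> (\<And>s'. Q s' \<Longrightarrow> Q' s') \<Longrightarrow> runs k orc c s T' Q'"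
  unfolding runs_def using order_trans by blast

lemma runs_Skip: "Q s \<Longrightarrow> 1 \<le> T \<Longrightarrow> runs k orc Skip s T Q"
  unfolding runs_def using exec.Skip by blast

lemma runs_Seq:
  assumes "runs k orc c1 s T1 Q1" "\<And>s'. Q1 s' \<Longrightarrow> runs k orc c2 s' T2 Q" "T1 + T2 \<le> T"
  shows "runs k orc (Seq c1 c2) s T Q"
proof -
  obtain t1 s1 where 1: "exec k orc c1 s t1 s1" "t1 \<le> T1" "Q1 s1" using assms(1) by (auto simp: runs_def)
  obtain t2 s2 where 2: "exec k orc c2 s1 t2 s2" "t2 \<le> T2" "Q s2" using assms(2)[OF 1(3)] by (auto simp: runs_def)
  have "exec k orc (Seq c1 c2) s (t1 + t2) s2" using 1 2 by (intro exec.Seq)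
  then show ?thesis unfolding runs_def using 1 2 assms(3) by fastforce
qed

lemma runs_Cond:
  assumes "bval k orc g s \<Longrightarrow> runs k orc c1 s T Q" "\<not> bval k orc g s \<Longrightarrow> runs k orc c2 s T Q" "T + 1 \<le> T'"
  shows "runs k orc (Cond g c1 c2) s T' Q"
proof (cases "bval k orc g s")
  case True
  then obtain t s' where "exec k orc c1 s t s'" "t \<le> T" "Q s'" using assms(1) by (auto simp: runs_def)
  then show ?thesis using assms(3) exec.CondTrue[OF True, of c1 t s' c2] unfolding runs_def by fastforce
next
  case False
  then obtain t s' where "exec k orc c2 s t s'" "t \<le> T" "Q s'" using assms(2) by (auto simp: runs_def)
  then show ?thesis using assms(3) exec.CondFalse[OF False, of c2 t s' c1] unfolding runs_def by fastforce
qed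

text \<open>The invariant is indexed by the number of rounds done, which proves termination and
  yields the time at once: each round pays for the body and one test, and one final test is
  added.\<close>

lemma runs_While:
  assumes step: "\<And>i s. i < M \<Longrightarrow> I i s \<Longrightarrow> bval k orc g s \<and> runs k orc c s T (I (Suc i))"
    and stop: "\<And>s. I M s \<Longrightarrow> \<not> bval k orc g s"
    and "I i s" "i \<le> M"
  shows "runs k orc (While g c) s ((M - i) * (T + 1) + 1) (I M)"
  using assms(3,4)
proof (induction "M - i" arbitrary: i s)
  case 0
  then have "I M s" by simp
  then show ?case using exec.WhileFalse[OF stop] unfolding runs_def by fastforce
next
  case (Suc d)
  then have i: "i < M" by simp
  then obtain t1 s1 where 1: "exec k orc c s t1 s1" "t1 \<le> T" "I (Suc i) s1" and g: "bval k orc g s"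
    using step[OF i Suc.prems(1)] by (auto simp: runs_def)
  have "runs k orc (While g c) s1 ((M - Suc i) * (T + 1) + 1) (I M)"
    using Suc.hyps(2) i 1 by (intro Suc.hyps(1)) auto
  then obtain t2 s2 where 2: "exec k orc (While g c) s1 t2 s2" "t2 \<le> (M - Suc i) * (T + 1) + 1" "I M s2"
    by (auto simp: runs_def)
  have "M - i = Suc (M - Suc i)" using i by simp
  then have "1 + t1 + t2 \<le> (M - i) * (T + 1) + 1" using 1 2 by simp
  then show ?case unfolding runs_def using exec.WhileTrue[OF g 1(1) 2(1)] 2(3) by blast
qed

primrec seqs :: "com list \<Rightarrow> com" where
  "seqs [] = Skip"
| "seqs (c # cs) = Seq c (seqs cs)"

lemma runs_seqs:
  assumes step: "\<And>m s. m < M \<Longrightarrow> I m s \<Longrightarrow> runs k orc (c m) s T (I (Suc m))"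
    and "I 0 s"
  shows "runs k orc (seqs (map c [0..<M])) s (M * T + 1) (I M)"
proof -
  have "runs k orc (seqs (map c [i..<M])) s ((M - i) * T + 1) (I M)" if "I i s" "i \<le> M" for i s
    using that
  proof (induction "M - i" arbitrary: i s)
    case 0
    then show ?case by (auto intro: runs_Skip)
  next
    case (Suc d)
    then have i: "i < M" by simp
    have "M - i = Suc (M - Suc i)" using i by simp
    moreover have "runs k orc (seqs (map c [Suc i..<M])) s' ((M - Suc i) * T + 1) (I M)" if "I (Suc i) s'" for s'
      using that Suc.hyps(2) i by (intro Suc.hyps(1)) auto
    ultimately show ?case
      unfolding upt_conv_Cons[OF i] list.map seqs.simps by (intro runs_Seq[OF step[OF i Suc.prems(1)]]) auto
  qed
  from this[of 0] show ?thesis using assms(2) by simp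
qed

section \<open>Memory layout and program\<close>

lemma radix_unique:
  fixes q q' r r' S :: nat
  assumes "q < S" "q' < S" "q + S * r = q' + S * r'"
  shows "r = r' \<and> q = q'"
proof -
  have "(q + S * r) div S = r" "(q' + S * r') div S = r'" using assms(1,2) by auto
  then have "r = r'" using assms(3) by metis
  then show ?thesis using assms(3) by simp
qed

text \<open>
  A record describes an assignment of the first items to clusters: its integer fields are the \<open>p\<close>
  weight sums, the record it extends, the cluster of its last item, and whether it has been
  discarded; its \<open>D\<close> real fields are the entries of the utility matrix. Variables and
  records occupy negative addresses, the input the nonnegative ones. The variables are
  numbered from 2 to 9 and, for the tuple of points in the redundancy test, from 10 to \<open>10 + D\<close>.
\<close>

locale layout =
  fixes p D :: nat
begin

text \<open>Variable \<open>v\<close> has address \<open>- 1 - int v\<close>. Below the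
  \<open>D + 11\<close> variable cells, each record takes a block of \<open>p + 3\<close> cells,
  read upwards within the block. The address is affine in \<open>r\<close> with a constant factor
  and hence computable without multiplication.\<close>

definition iaddr :: "nat \<Rightarrow> nat \<Rightarrow> int" where
  "iaddr r q = int q - int (p + 3) * (int r + 1) - int (D + 11)"

definition raddr :: "nat \<Rightarrow> nat \<Rightarrow> int" where
  "raddr r m = int m - int D * (int r + 1)"

definition var :: "nat \<Rightarrow> state \<Rightarrow> int" where "var v s = fst s (- 1 - int v)"
definition fld :: "nat \<Rightarrow> nat \<Rightarrow> state \<Rightarrow> int" where "fld r q s = fst s (iaddr r q)"
definition util :: "nat \<Rightarrow> nat \<Rightarrow> state \<Rightarrow> real" where "util r m s = snd s (raddr r m)"
definition inp :: "nat \<Rightarrow> state \<Rightarrow> int" where "inp a s = fst s (int a)"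
definition rinp :: "nat \<Rightarrow> state \<Rightarrow> real" where "rinp a s = snd s (int a)"

definition set_var :: "nat \<Rightarrow> int \<Rightarrow> state \<Rightarrow> state" where "set_var v x s = ((fst s)(- 1 - int v := x), snd s)"
definition set_fld :: "nat \<Rightarrow> nat \<Rightarrow> int \<Rightarrow> state \<Rightarrow> state" where "set_fld r q x s = ((fst s)(iaddr r q := x), snd s)"
definition set_util :: "nat \<Rightarrow> nat \<Rightarrow> real \<Rightarrow> state \<Rightarrow> state" where "set_util r m x s = (fst s, (snd s)(raddr r m := x))"
definition set_inp :: "nat \<Rightarrow> int \<Rightarrow> state \<Rightarrow> state" where "set_inp a x s = ((fst s)(int a := x), snd s)"

lemma iaddr_inj: "q < p + 3 \<Longrightarrow> q' < p + 3 \<Longrightarrow> iaddr r q = iaddr r' q' \<longleftrightarrow> r = r' \<and> q = q'"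
proof
  assume q: "q < p + 3" "q' < p + 3" "iaddr r q = iaddr r' q'"
  then have "int q + int (p + 3) * int r' = int q' + int (p + 3) * int r"
    by (simp add: iaddr_def algebra_simps)
  then have "q + (p + 3) * r' = q' + (p + 3) * r" by (metis of_nat_add of_nat_eq_iff of_nat_mult)
  then show "r = r' \<and> q = q'" using radix_unique[of q "p + 3" q' r' r] q by auto
qed auto

lemma raddr_inj: "m < D \<Longrightarrow> m' < D \<Longrightarrow> raddr r m = raddr r' m' \<longleftrightarrow> r = r' \<and> m = m'"
proof
  assume q: "m < D" "m' < D" "raddr r m = raddr r' m'"
  then have "int m + int D * int r' = int m' + int D * int r"
    by (simp add: raddr_def algebra_simps)
  then have "m + D * r' = m' + D * r" by (metis of_nat_add of_nat_eq_iff of_nat_mult)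
  then show "r = r' \<and> m = m'" using radix_unique[of m D m' r' r] q by auto
qed auto

lemma iaddr_less: "q < p + 3 \<Longrightarrow> iaddr r q < - 1 - int (D + 10)"
proof -
  assume "q < p + 3"
  then have "int q < int (p + 3)" by simp
  also have "\<dots> \<le> int (p + 3) * (int r + 1)" by (simp add: algebra_simps)
  finally show ?thesis by (simp add: iaddr_def)
qed

lemma raddr_neg: "m < D \<Longrightarrow> raddr r m < 0"
proof -
  assume "m < D"
  then have "int m < int D" by simp
  also have "\<dots> \<le> int D * (int r + 1)" by (simp add: algebra_simps)
  finally show ?thesis by (simp add: raddr_def)
qed

lemma iaddr_neq:
  assumes "q < p + 3"
  shows "v < D + 11 \<Longrightarrow> iaddr r q \<noteq> - 1 - int v" "iaddr r q \<noteq> int a"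
  using iaddr_less[OF assms, of r] by auto

lemma raddr_neq: "m < D \<Longrightarrow> raddr r m \<noteq> int a"
  using raddr_neg[of m r] by auto

lemma get_set_var [simp]:
  "var u (set_var v x s) = (if u = v then x else var u s)"
  "v < D + 11 \<Longrightarrow> q < p + 3 \<Longrightarrow> fld r q (set_var v x s) = fld r q s"
  "util r m (set_var v x s) = util r m s"
  "inp a (set_var v x s) = inp a s"
  "rinp a (set_var v x s) = rinp a s"
  using iaddr_neq by (auto simp: var_def fld_def util_def inp_def rinp_def set_var_def)

lemma get_set_fld [simp]:
  "v < D + 11 \<Longrightarrow> q < p + 3 \<Longrightarrow> var v (set_fld r q x s) = var v s"
  "q < p + 3 \<Longrightarrow> q' < p + 3 \<Longrightarrow> fld r q (set_fld r' q' x s) = (if r = r' \<and> q = q' then x else fld r q s)"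
  "util r' m (set_fld r q x s) = util r' m s"
  "q < p + 3 \<Longrightarrow> inp a (set_fld r q x s) = inp a s"
  "rinp a (set_fld r q x s) = rinp a s"
  using iaddr_neq[symmetric] iaddr_neq
  by (auto simp: var_def fld_def util_def inp_def rinp_def set_fld_def iaddr_inj)

lemma get_set_util [simp]:
  "var v (set_util r m x s) = var v s"
  "fld r' q (set_util r m x s) = fld r' q s"
  "m < D \<Longrightarrow> m' < D \<Longrightarrow> util r m (set_util r' m' x s) = (if r = r' \<and> m = m' then x else util r m s)"
  "inp a (set_util r m x s) = inp a s"
  "m < D \<Longrightarrow> rinp a (set_util r m x s) = rinp a s"
  using raddr_neq[symmetric] raddr_neq
  by (auto simp: var_def fld_def util_def inp_def rinp_def set_util_def raddr_inj)

lemma get_set_inp [simp]: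
  "var v (set_inp a x s) = var v s"
  "q < p + 3 \<Longrightarrow> fld r q (set_inp a x s) = fld r q s"
  "util r m (set_inp a x s) = util r m s"
  "inp a' (set_inp a x s) = (if a' = a then x else inp a' s)"
  "rinp a' (set_inp a x s) = rinp a' s"
  using iaddr_neq[symmetric] iaddr_neq
  by (auto simp: var_def fld_def util_def inp_def rinp_def set_inp_def)

text \<open>Integers cannot be multiplied; a constant factor is repeated addition in the program
  text.\<close>

primrec times :: "nat \<Rightarrow> iexp \<Rightarrow> iexp" where
  "times 0 e = IConst 0"
| "times (Suc m) e = IAdd e (times m e)"

lemma ival_times [simp]: "ival (times m e) s = int m * ival e s"
  by (induction m) (auto simp: algebra_simps)

definition Var :: "nat \<Rightarrow> iexp" where "Var v = IMem (IConst (- 1 - int v))"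

definition fld_addr :: "iexp \<Rightarrow> nat \<Rightarrow> iexp" where
  "fld_addr e q = ISub (IConst (int q - int (p + 3) - int (D + 11))) (times (p + 3) e)"

definition util_addr :: "iexp \<Rightarrow> nat \<Rightarrow> iexp" where
  "util_addr e m = ISub (IConst (int m - int D)) (times D e)"

abbreviation Fld :: "iexp \<Rightarrow> nat \<Rightarrow> iexp" where "Fld e q \<equiv> IMem (fld_addr e q)"
abbreviation Util :: "iexp \<Rightarrow> nat \<Rightarrow> lexp" where "Util e m \<equiv> LMem (util_addr e m)"

lemma ival_Var [simp]: "ival (Var v) s = var v s"
  by (simp add: Var_def var_def)

lemma ival_fld_addr: "ival e s = int r \<Longrightarrow> ival (fld_addr e q) s = iaddr r q"
  by (simp add: fld_addr_def iaddr_def algebra_simps)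

lemma ival_util_addr: "ival e s = int r \<Longrightarrow> ival (util_addr e m) s = raddr r m"
  by (simp add: util_addr_def raddr_def algebra_simps)

lemma ival_Fld [simp]: "ival e s = int r \<Longrightarrow> ival (Fld e q) s = fld r q s"
  by (simp add: ival_fld_addr fld_def)

lemma lval_Util [simp]: "ival e s = int r \<Longrightarrow> lval (Util e m) s = util r m s"
  by (simp add: ival_util_addr util_def)

declare ival.simps(2) [simp del] lval.simps(2) [simp del]

definition assign :: "nat \<Rightarrow> iexp \<Rightarrow> com" where
  "assign v e = IStore (IConst (- 1 - int v)) e"

lemma runs_assign:
  "Q (set_var v (ival e s) s) \<Longrightarrow> 1 \<le> T \<Longrightarrow> runs k orc (assign v e) s T Q"
  unfolding runs_def assign_def set_var_def
  using exec.IStore[of k orc "IConst (- 1 - int v)" e s] by auto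

lemma runs_store_fld:
  "Q (set_fld r q (ival x s) s) \<Longrightarrow> ival e s = int r \<Longrightarrow> 1 \<le> T \<Longrightarrow> runs k orc (IStore (fld_addr e q) x) s T Q"
  unfolding runs_def set_fld_def
  using exec.IStore[of k orc "fld_addr e q" x s] by (auto simp: ival_fld_addr)

lemma runs_store_util:
  "Q (set_util r m (lval x s) s) \<Longrightarrow> ival e s = int r \<Longrightarrow> 1 \<le> T \<Longrightarrow> runs k orc (RStore (util_addr e m) x) s T Q"
  unfolding runs_def set_util_def
  using exec.RStore[of k orc "util_addr e m" x s] by (auto simp: ival_util_addr)

lemma runs_store_inp:
  "Q (set_inp a (ival x s) s) \<Longrightarrow> ival e s = int a \<Longrightarrow> 1 \<le> T \<Longrightarrow> runs k orc (IStore e x) s T Q"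
  unfolding runs_def set_inp_def
  using exec.IStore[of k orc e x s] by auto

section \<open>Counting loops and unchanged memory\<close>

definition for_loop :: "nat \<Rightarrow> iexp \<Rightarrow> iexp \<Rightarrow> com \<Rightarrow> com" where
  "for_loop v lo hi c = Seq (assign v lo)
     (While (ILe (IAdd (Var v) (IConst 1)) hi) (Seq c (assign v (IAdd (Var v) (IConst 1)))))"

text \<open>The upper bound is evaluated anew in every test, so the invariant has to fix its value.
  The loop variable is part of the state, so the body must establish the invariant for the state
  after the increment; this explains \<open>set_var\<close>. Each round pays two units for increment
  and test.\<close>

lemma runs_for_loop:
  assumes lo: "ival lo s = int a" "a \<le> b" and I0: "I a (set_var v (int a) s)"
    and hi: "\<And>i s. I i s \<Longrightarrow> ival hi s = int b"
    and step: "\<And>i s. a \<le> i \<Longrightarrow> i < b \<Longrightarrow> I i s \<Longrightarrow> var v s = int i \<Longrightarrow>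
      runs k orc c s T (\<lambda>s'. var v s' = int i \<and> I (Suc i) (set_var v (int (Suc i)) s'))"
  shows "runs k orc (for_loop v lo hi c) s ((b - a) * (T + 2) + 2) (\<lambda>s'. I b s' \<and> var v s' = int b)"
  unfolding for_loop_def
proof (rule runs_Seq)
  show "runs k orc (assign v lo) s 1 (\<lambda>s'. I a s' \<and> var v s' = int a)"
    using lo I0 by (intro runs_assign) auto
  show "runs k orc (While (ILe (IAdd (Var v) (IConst 1)) hi) (Seq c (assign v (IAdd (Var v) (IConst 1))))) s'
      ((b - a) * (T + 1 + 1) + 1) (\<lambda>s'. I b s' \<and> var v s' = int b)"
    if s': "I a s' \<and> var v s' = int a" for s'
  proof (rule runs_While[where I = "\<lambda>i s. a \<le> i \<and> I i s \<and> var v s = int i", THEN runs_mono])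
    fix i s assume i: "i < b" "a \<le> i \<and> I i s \<and> var v s = int i"
    have "runs k orc (Seq c (assign v (IAdd (Var v) (IConst 1)))) s (T + 1)
       (\<lambda>s. a \<le> Suc i \<and> I (Suc i) s \<and> var v s = int (Suc i))"
      by (rule runs_Seq[OF step]) (use i in \<open>auto intro!: runs_assign simp: add.commute\<close>)
    then show "bval k orc (ILe (IAdd (Var v) (IConst 1)) hi) s \<and>
        runs k orc (Seq c (assign v (IAdd (Var v) (IConst 1)))) s (T + 1)
       (\<lambda>s. a \<le> Suc i \<and> I (Suc i) s \<and> var v s = int (Suc i))"
      using hi[of i s] i by simp
  qed (use s' lo hi in auto)
qed simp

text \<open>Input cells are always among the unchanged ones. Backtracking, which overwrites them, is
  therefore treated without frames.\<close>

definition frame :: "nat set \<Rightarrow> (nat \<times> nat) set \<Rightarrow> nat set \<Rightarrow> state \<Rightarrow> state \<Rightarrow> bool" where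
  "frame V F G s s' \<longleftrightarrow>
     (\<forall>v<D + 11. v \<notin> V \<longrightarrow> var v s' = var v s) \<and>
     (\<forall>r. \<forall>q<p + 3. (r, q) \<notin> F \<longrightarrow> fld r q s' = fld r q s) \<and>
     (\<forall>r. \<forall>m<D. r \<notin> G \<longrightarrow> util r m s' = util r m s) \<and>
     (\<forall>a. inp a s' = inp a s) \<and> (\<forall>a. rinp a s' = rinp a s)"

lemma frame_refl [simp]: "frame V F G s s"
  by (simp add: frame_def)

lemma frame_trans:
  "frame V F G s s' \<Longrightarrow> frame V F G s' s'' \<Longrightarrow> frame V F G s s''"
  by (simp add: frame_def)

lemma frame_mono:
  "frame V F G s s' \<Longrightarrow> V \<subseteq> V' \<Longrightarrow> F \<subseteq> F' \<Longrightarrow> G \<subseteq> G' \<Longrightarrow> frame V' F' G' s s'"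
  unfolding frame_def by blast

lemma frame_var: "frame V F G s s' \<Longrightarrow> v \<notin> V \<Longrightarrow> v < D + 11 \<Longrightarrow> var v s' = var v s"
  and frame_fld: "frame V F G s s' \<Longrightarrow> (r, q) \<notin> F \<Longrightarrow> q < p + 3 \<Longrightarrow> fld r q s' = fld r q s"
  and frame_util: "frame V F G s s' \<Longrightarrow> r \<notin> G \<Longrightarrow> m < D \<Longrightarrow> util r m s' = util r m s"
  and frame_inp: "frame V F G s s' \<Longrightarrow> inp a s' = inp a s"
  and frame_rinp: "frame V F G s s' \<Longrightarrow> rinp a s' = rinp a s"
  by (auto simp: frame_def)

lemma frame_set_var: "frame V F G s s' \<Longrightarrow> v \<in> V \<Longrightarrow> v < D + 11 \<Longrightarrow> frame V F G s (set_var v x s')"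
  by (auto simp: frame_def)

lemma frame_set_fld: "frame V F G s s' \<Longrightarrow> (r, q) \<in> F \<Longrightarrow> q < p + 3 \<Longrightarrow> frame V F G s (set_fld r q x s')"
  by (auto simp: frame_def)

lemma frame_set_util: "frame V F G s s' \<Longrightarrow> r \<in> G \<Longrightarrow> m < D \<Longrightarrow> frame V F G s (set_util r m x s')"
  by (auto simp: frame_def)

abbreviation "N \<equiv> (2::nat)"
abbreviation "K \<equiv> (3::nat)"
abbreviation "LO \<equiv> (4::nat)"
abbreviation "HI \<equiv> (5::nat)"
abbreviation "NR \<equiv> (6::nat)"
abbreviation "R \<equiv> (7::nat)"
abbreviation "X \<equiv> (8::nat)"
abbreviation "BEST \<equiv> (9::nat)"
abbreviation Y :: "nat \<Rightarrow> nat" where "Y i \<equiv> 10 + i"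

section \<open>The program text\<close>

text \<open>Cell 0 holds \<open>n\<close> and cells 1 to \<open>p\<close> hold the prescribed sums,
  so the weights of item \<open>K\<close> start at \<open>1 + p * K\<close>; its utilities start at
  \<open>D * K - D\<close> among the reals. Matrices are listed row by row, so the entries of column
  \<open>i\<close> are those with \<open>m mod p = i\<close>.\<close>

definition new_record :: "nat \<Rightarrow> com" where
  "new_record i =
     Seq (seqs (map (\<lambda>q. IStore (fld_addr (Var NR) q)
         (if q = i then IAdd (Fld (Var R) q) (IMem (IAdd (IConst (1 + int q)) (times p (Var K))))
          else Fld (Var R) q)) [0..<p]))
     (Seq (seqs (map (\<lambda>m. RStore (util_addr (Var NR) m)
         (if m mod p = i then LAdd (Util (Var R) m) (LMem (IAdd (IConst (int m - int D)) (times D (Var K))))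
          else Util (Var R) m)) [0..<D]))
     (Seq (IStore (fld_addr (Var NR) p) (Var R))
     (Seq (IStore (fld_addr (Var NR) (p + 1)) (IConst (int i)))
     (Seq (IStore (fld_addr (Var NR) (p + 2)) (IConst 0))
     (assign NR (IAdd (Var NR) (IConst 1)))))))"

definition extends :: "nat \<Rightarrow> nat \<Rightarrow> nat \<Rightarrow> nat \<Rightarrow> state \<Rightarrow> bool" where
  "extends k r i z s \<longleftrightarrow>
     (\<forall>q<p. fld z q s = fld r q s + (if q = i then inp (p * k + 1 + q) s else 0)) \<and>
     (\<forall>m<D. util z m s = util r m s + (if m mod p = i then rinp (D * k - D + m) s else 0)) \<and>
     fld z p s = int r \<and> fld z (p + 1) s = int i \<and> fld z (p + 2) s = 0"

text \<open>\<open>r < z\<close> keeps the parent record intact while the new one is written. The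
  time is \<open>p + 1\<close> and \<open>D + 1\<close> for the unrolled stores, each with a closing
  \<open>Skip\<close>, and 4 for the rest.\<close>

lemma runs_new_record:
  assumes "var NR s = int z" "var R s = int r" "r < z" "var K s = int k" "1 \<le> k" "i < p"
  shows "runs kk orc (new_record i) s (p + D + 6)
    (\<lambda>s'. frame {NR} ({z} \<times> UNIV) {z} s s' \<and> var NR s' = int (Suc z) \<and> extends k r i z s')"
proof -
  let ?fr = "frame {NR} ({z} \<times> UNIV) {z} s"
  define I1 where "I1 = (\<lambda>m s'. ?fr s' \<and> var NR s' = int z \<and>
    (\<forall>q<m. fld z q s' = fld r q s + (if q = i then inp (p * k + 1 + q) s else 0)))"
  define I2 where "I2 = (\<lambda>m s'. I1 p s' \<and>
    (\<forall>l<m. util z l s' = util r l s + (if l mod p = i then rinp (D * k - D + l) s else 0)))"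
  have vars: "var R s' = int r" "var K s' = int k" "q < p + 3 \<Longrightarrow> fld r q s' = fld r q s" "m < D \<Longrightarrow> util r m s' = util r m s"
    "inp a s' = inp a s" "rinp a s' = rinp a s" if "?fr s'" for s' q m a
    using that assms by (auto simp: frame_var frame_fld frame_util frame_inp frame_rinp)
  have iin: "ival (IMem (IAdd (IConst (1 + int q)) (times p (Var K)))) s' = inp (p * k + 1 + q) s'"
    if "var K s' = int k" for s' q
    using that by (simp add: ival.simps(2) inp_def algebra_simps var_def)
  have rin: "lval (LMem (IAdd (IConst (int m - int D)) (times D (Var K)))) s' = rinp (D * k - D + m) s'"
    if "var K s' = int k" for s' m
  proof -
    have "D \<le> D * k" using assms(5) by simp
    then have "int (D * k - D + m) = int m - int D + int D * int k"
      by (simp only: of_nat_add of_nat_diff of_nat_mult)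
    then have "ival (IAdd (IConst (int m - int D)) (times D (Var K))) s' = int (D * k - D + m)"
      using that by (simp only: ival.simps(1,3) ival_times ival_Var)
    then show ?thesis by (simp only: lval.simps(2) rinp_def)
  qed
  have 1: "runs kk orc (seqs (map (\<lambda>q. IStore (fld_addr (Var NR) q)
         (if q = i then IAdd (Fld (Var R) q) (IMem (IAdd (IConst (1 + int q)) (times p (Var K))))
          else Fld (Var R) q)) [0..<p])) s (p * 1 + 1) (I1 p)"
  proof (rule runs_seqs)
    show "I1 0 s" using assms by (simp add: I1_def)
    fix m s' assume m: "m < p" and I: "I1 m s'"
    then have fr: "?fr s'" by (simp add: I1_def)
    show "runs kk orc (IStore (fld_addr (Var NR) m)
         (if m = i then IAdd (Fld (Var R) m) (IMem (IAdd (IConst (1 + int m)) (times p (Var K))))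
          else Fld (Var R) m)) s' 1 (I1 (Suc m))"
    proof (rule runs_store_fld[of _ z])
      have "?fr (set_fld z m x s')" for x using fr m by (intro frame_set_fld) auto
      then show "I1 (Suc m) (set_fld z m (ival (if m = i then IAdd (Fld (Var R) m) (IMem (IAdd (IConst (1 + int m)) (times p (Var K))))
          else Fld (Var R) m) s') s')"
        using I m vars[OF fr] iin[of s' m] by (auto simp: I1_def less_Suc_eq)
    qed (use I in \<open>auto simp: I1_def\<close>)
  qed
  have 2: "runs kk orc (seqs (map (\<lambda>m. RStore (util_addr (Var NR) m)
         (if m mod p = i then LAdd (Util (Var R) m) (LMem (IAdd (IConst (int m - int D)) (times D (Var K))))
          else Util (Var R) m)) [0..<D])) s1 (D * 1 + 1) (I2 D)" if s1: "I1 p s1" for s1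
  proof (rule runs_seqs)
    show "I2 0 s1" using s1 by (simp add: I2_def)
    fix m s' assume m: "m < D" and I: "I2 m s'"
    then have fr: "?fr s'" by (simp add: I1_def I2_def)
    show "runs kk orc (RStore (util_addr (Var NR) m)
         (if m mod p = i then LAdd (Util (Var R) m) (LMem (IAdd (IConst (int m - int D)) (times D (Var K))))
          else Util (Var R) m)) s' 1 (I2 (Suc m))"
    proof (rule runs_store_util[of _ z])
      have "?fr (set_util z m x s')" for x using fr m by (intro frame_set_util) auto
      then show "I2 (Suc m) (set_util z m (lval (if m mod p = i then LAdd (Util (Var R) m) (LMem (IAdd (IConst (int m - int D)) (times D (Var K))))
          else Util (Var R) m) s') s')"
        using I m vars[OF fr] rin[of s' m] by (auto simp: I1_def I2_def less_Suc_eq)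
    qed (use I in \<open>auto simp: I1_def I2_def\<close>)
  qed
  have 3: "runs kk orc (Seq (IStore (fld_addr (Var NR) p) (Var R))
     (Seq (IStore (fld_addr (Var NR) (p + 1)) (IConst (int i)))
     (Seq (IStore (fld_addr (Var NR) (p + 2)) (IConst 0))
     (assign NR (IAdd (Var NR) (IConst 1)))))) s2 4
     (\<lambda>s'. ?fr s' \<and> var NR s' = int (Suc z) \<and> extends k r i z s')" if s2: "I2 D s2" for s2
  proof -
    have fr: "?fr s2" using s2 by (simp add: I1_def I2_def)
    define s3 where "s3 = set_var NR (int (Suc z)) (set_fld z (p + 2) 0 (set_fld z (p + 1) (int i) (set_fld z p (int r) s2)))"
    have z: "var NR s2 = int z" using s2 by (simp add: I1_def I2_def)
    have fr3: "?fr s3" unfolding s3_def using fr by (intro frame_set_var frame_set_fld) auto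
    then have "?fr s3 \<and> var NR s3 = int (Suc z) \<and> extends k r i z s3"
      using s2 assms(3) vars[OF fr3] by (auto simp: extends_def I1_def I2_def) (auto simp: s3_def)
    then show ?thesis
      using z vars[OF fr] unfolding s3_def
      by (intro runs_Seq[where ?T1.0 = 1 and ?T2.0 = 3 and ?Q1.0 = "\<lambda>s. s = set_fld z p (int r) s2"]
          runs_Seq[where ?T1.0 = 1 and ?T2.0 = 2 and ?Q1.0 = "\<lambda>s. s = set_fld z (p + 1) (int i) (set_fld z p (int r) s2)"]
          runs_Seq[where ?T1.0 = 1 and ?T2.0 = 1 and ?Q1.0 = "\<lambda>s. s = set_fld z (p + 2) 0 (set_fld z (p + 1) (int i) (set_fld z p (int r) s2))"]
          runs_store_fld[of _ z] runs_assign) (auto simp: add.commute)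
  qed
  show ?thesis
    unfolding new_record_def
    by (rule runs_Seq[OF 1 runs_Seq[OF 2 3]]) auto
qed

definition int_eq :: "iexp \<Rightarrow> iexp \<Rightarrow> bexp" where
  "int_eq a b = BAnd (ILe a b) (ILe b a)"

lemma bval_int_eq [simp]: "bval k orc (int_eq a b) s \<longleftrightarrow> ival a s = ival b s"
  by (auto simp: int_eq_def)

definition extend :: com where
  "extend = for_loop R (Var LO) (Var HI)
     (Cond (int_eq (Fld (Var R) (p + 2)) (IConst 0)) (seqs (map new_record [0..<p])) Skip)"

text \<open>The tuple variables range over all records of a stage. Ineligible ones, \<open>X\<close>
  itself included, are silenced here, so no list of eligible records has to be built.\<close>

definition guard :: "nat \<Rightarrow> bexp" where
  "guard i = conj_test (int_eq (Fld (Var (Y i)) (p + 2)) (IConst 0) # BNot (int_eq (Var (Y i)) (Var X)) #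
     map (\<lambda>q. int_eq (Fld (Var (Y i)) q) (Fld (Var X) q)) [0..<p])"

definition row :: "nat \<Rightarrow> nat \<Rightarrow> rexp" where
  "row i l = RSub (RLin (Util (Var (Y i)) l)) (RLin (Util (Var X) l))"

definition redundant :: bexp where
  "redundant = infeasible_test D (map (\<lambda>i. (guard i, row i)) [0..<Suc D])"

text \<open>The loops are nested when the program is written; their depth \<open>D + 1\<close> is
  constant, so the search stays polynomial. Marking \<open>X\<close> as discarded halfway does not
  affect the remaining tests, because a record is never compared with itself.\<close>

primrec search :: "nat \<Rightarrow> com" where
  "search 0 = Cond redundant (IStore (fld_addr (Var X) (p + 2)) (IConst 1)) Skip"
| "search (Suc j) = for_loop (Y j) (Var LO) (Var HI) (search j)"

definition prune :: com where
  "prune = for_loop X (Var LO) (Var HI) (search (Suc D))"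

definition stage :: com where
  "stage = Seq (assign K (IAdd (Var K) (IConst 1))) (Seq (assign NR (Var HI)) (Seq extend
     (Seq (assign LO (Var HI)) (Seq (assign HI (Var NR)) prune))))"

text \<open>Negative cells are initially 0. Thus \<open>LO\<close> and \<open>K\<close> start at 0,
  and record 0 is already the live record of the empty assignment, with zero sums and zero utility;
  only \<open>HI\<close> has to be set to 1.\<close>

definition dp :: com where
  "dp = Seq (assign N (IMem (IConst 0))) (Seq (assign HI (IConst 1))
     (While (ILe (IAdd (Var K) (IConst 1)) (Var N)) stage))"

definition candidate :: bexp where
  "candidate = conj_test (int_eq (Fld (Var R) (p + 2)) (IConst 0) #
     map (\<lambda>q. int_eq (Fld (Var R) q) (IMem (IConst (1 + int q)))) [0..<p])"

definition select :: com where
  "select = Seq (assign BEST (IConst (- 1))) (for_loop R (Var LO) (Var HI)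
     (Cond candidate
       (Cond (BAnd (ILe (IConst 0) (Var BEST)) (BNot (OracleLe (util_addr (Var BEST) 0) (util_addr (Var R) 0))))
         Skip (assign BEST (Var R)))
       Skip))"

text \<open>The answer for item \<open>K\<close> goes to cell \<open>K\<close>, over the input. Only
  records and variables are read from now on, and they have negative addresses.\<close>

definition backtrack :: com where
  "backtrack = While (ILe (IConst 1) (Var K))
     (Seq (IStore (Var K) (Fld (Var BEST) (p + 1)))
     (Seq (assign BEST (Fld (Var BEST) p))
     (assign K (ISub (Var K) (IConst 1)))))"

definition partition_program :: com where
  "partition_program = Seq dp (Seq select
     (Cond (ILe (IConst 0) (Var BEST)) (Seq backtrack (IStore (IConst 0) (IConst 1))) (IStore (IConst 0) (IConst 0))))"

primrec search_time :: "nat \<Rightarrow> nat \<Rightarrow> nat" where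
  "search_time 0 h = 2"
| "search_time (Suc j) h = h * (search_time j h + 2) + 2"

text \<open>\<open>h\<close> caps the number of records of a stage. The 4 pays for the assignments
  to \<open>K\<close>, \<open>NR\<close>, \<open>LO\<close> and \<open>HI\<close>, the two brackets
  for extending and pruning.\<close>

definition stage_time :: "nat \<Rightarrow> nat" where
  "stage_time h = 4 + (h * (p * (p + D + 6) + 2 + 2) + 2) + (h * (search_time (Suc D) h + 2) + 2)"

definition total_time :: "nat \<Rightarrow> nat \<Rightarrow> nat" where
  "total_time n h = n * (stage_time h + 1) + 3 + (h * 5 + 3) + (n * 4 + 3)"

section \<open>Correctness of the extension step\<close>

text \<open>The order in which records are created is forgotten: hulls depend only on which pairs of
  parent and cluster occur, and \<open>card P\<close> limits the number of records.\<close>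

definition extended_by :: "nat \<Rightarrow> nat \<Rightarrow> (nat \<times> nat) set \<Rightarrow> state \<Rightarrow> state \<Rightarrow> bool" where
  "extended_by k hi P s s' \<longleftrightarrow> (\<exists>z\<ge>hi. var NR s' = int z \<and> frame {R, NR} ({hi..} \<times> UNIV) {hi..} s s' \<and>
     (\<forall>z'\<in>{hi..<z}. \<exists>(r, i)\<in>P. extends k r i z' s') \<and> (\<forall>(r, i)\<in>P. \<exists>z'\<in>{hi..<z}. extends k r i z' s') \<and>
     z - hi \<le> card P)"

lemma extends_frame:
  assumes "extends k r i z s" "r < z" "z < z0" "frame V ({z0..} \<times> UNIV) {z0..} s s'"
  shows "extends k r i z s'"
  using assms(1-3) frame_fld[OF assms(4)] frame_util[OF assms(4)] frame_inp[OF assms(4)] frame_rinp[OF assms(4)]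
  by (simp add: extends_def)

lemma runs_new_record_extended:
  assumes E: "extended_by k hi P s s'" and P: "finite P" "(r, i) \<notin> P" "P \<subseteq> {..<hi} \<times> UNIV"
    and r: "r < hi" "i < p" and R: "var R s' = int r" and k: "var K s = int k" "1 \<le> k"
  shows "runs kk orc (new_record i) s' (p + D + 6)
    (\<lambda>s''. extended_by k hi (insert (r, i) P) s s'' \<and> var R s'' = int r)"
proof -
  obtain z where z: "z \<ge> hi" "var NR s' = int z" and fr: "frame {R, NR} ({hi..} \<times> UNIV) {hi..} s s'"
    and 1: "\<And>z'. z' \<in> {hi..<z} \<Longrightarrow> \<exists>(r, i)\<in>P. extends k r i z' s'"
    and 2: "\<And>r i. (r, i) \<in> P \<Longrightarrow> \<exists>z'\<in>{hi..<z}. extends k r i z' s'" and 3: "z - hi \<le> card P"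
    using E unfolding extended_by_def by blast
  have K: "var K s' = int k" using frame_var[OF fr, of K] k by simp
  show ?thesis
  proof (rule runs_mono[OF runs_new_record[OF z(2) R _ K k(2) r(2)]])
    show "r < z" using r z by simp
    fix s'' assume s'': "frame {NR} ({z} \<times> UNIV) {z} s' s'' \<and> var NR s'' = int (Suc z) \<and> extends k r i z s''"
    then have fr': "frame {NR} ({z} \<times> UNIV) {z} s' s''" and ext: "extends k r i z s''" by auto
    have fr'': "frame {R, NR} ({hi..} \<times> UNIV) {hi..} s s''"
      by (rule frame_trans[OF fr frame_mono[OF fr']]) (use z in auto)
    have frz: "frame {NR} ({z..} \<times> UNIV) {z..} s' s''" by (rule frame_mono[OF fr']) auto
    have keep: "extends k r' i' z' s''" if "extends k r' i' z' s'" "(r', i') \<in> P" "z' \<in> {hi..<z}" for r' i' z'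
      using P(3) that by (intro extends_frame[OF that(1) _ _ frz]) auto
    have "var R s'' = int r" using frame_var[OF fr', of R] R by simp
    moreover have "extended_by k hi (insert (r, i) P) s s''"
      unfolding extended_by_def
    proof (intro exI[of _ "Suc z"] conjI ballI)
      fix z' assume z': "z' \<in> {hi..<Suc z}"
      show "\<exists>(r, i)\<in>insert (r, i) P. extends k r i z' s''"
      proof (cases "z' = z")
        case True then show ?thesis using ext by auto
      next
        case False
        then have "z' \<in> {hi..<z}" using z' by auto
        then obtain r' i' where "(r', i') \<in> P" "extends k r' i' z' s'" using 1 by blast
        then show ?thesis using keep[of r' i' z'] \<open>z' \<in> {hi..<z}\<close> by (intro bexI[of _ "(r', i')"]) auto
      qed
    next
      fix ri assume ri: "ri \<in> insert (r, i) P"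
      show "case ri of (r, i) \<Rightarrow> \<exists>z'\<in>{hi..<Suc z}. extends k r i z' s''"
      proof (cases "ri = (r, i)")
        case True then show ?thesis using ext z by auto
      next
        case False
        then have "(fst ri, snd ri) \<in> P" using ri by auto
        then obtain z' where "z' \<in> {hi..<z}" "extends k (fst ri) (snd ri) z' s'" using 2 by blast
        then show ?thesis using keep[of "fst ri" "snd ri" z'] \<open>(fst ri, snd ri) \<in> P\<close>
          by (auto simp: case_prod_beta intro!: bexI[of _ z'])
      qed
    next
      show "Suc z - hi \<le> card (insert (r, i) P)" using P 3 z by simp
    qed (use s'' z fr'' in auto)
    ultimately show "extended_by k hi (insert (r, i) P) s s'' \<and> var R s'' = int r" by blast
  qed simp
qed

text \<open>New records are created from \<open>hi\<close> upwards and counted by \<open>NR\<close>,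
  while the loop ends at \<open>HI\<close>. Hence it never meets them, and every flag it reads is
  that of the initial state.\<close>

lemma runs_extend:
  assumes "var LO s = int lo" "var HI s = int hi" "lo \<le> hi" "var NR s = int hi" "var K s = int k" "1 \<le> k"
  shows "runs kk orc extend s ((hi - lo) * (p * (p + D + 6) + 2 + 2) + 2)
    (extended_by k hi ({r \<in> {lo..<hi}. fld r (p + 2) s = 0} \<times> {..<p}) s)"
proof -
  define P where "P = (\<lambda>r. {r' \<in> {lo..<r}. fld r' (p + 2) s = 0} \<times> {..<p})"
  have finP: "finite (P r)" for r unfolding P_def by auto
  have fr: "frame {R, NR} ({hi..} \<times> UNIV) {hi..} s s'" if "extended_by k hi P' s s'" for P' s'
    using that unfolding extended_by_def by blast
  have var: "extended_by k hi P' s (set_var R x s')" if "extended_by k hi P' s s'" for P' s' x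
  proof -
    from that obtain z where z: "z \<ge> hi" "var NR s' = int z" and fr: "frame {R, NR} ({hi..} \<times> UNIV) {hi..} s s'"
      and 1: "\<forall>z'\<in>{hi..<z}. \<exists>(r, i)\<in>P'. extends k r i z' s'"
      and 2: "\<forall>(r, i)\<in>P'. \<exists>z'\<in>{hi..<z}. extends k r i z' s'" and 3: "z - hi \<le> card P'"
      unfolding extended_by_def by blast
    have e: "extends k r i z' (set_var R x s') \<longleftrightarrow> extends k r i z' s'" for r i z'
      by (simp add: extends_def)
    have "frame {R, NR} ({hi..} \<times> UNIV) {hi..} s (set_var R x s')" using fr by (rule frame_set_var) auto
    then show ?thesis unfolding extended_by_def e using z 1 2 3 by (intro exI[of _ z]) simp
  qed
  show ?thesis
    unfolding extend_def
  proof (rule runs_for_loop[where I = "\<lambda>r s'. extended_by k hi (P r) s s'", THEN runs_mono])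
    show "extended_by k hi (P lo) s (set_var R (int lo) s)"
      by (rule var) (use assms in \<open>auto simp: extended_by_def P_def\<close>)
    show "ival (Var HI) s' = int hi" if "extended_by k hi (P i) s s'" for i s'
      using frame_var[OF fr[OF that], of HI] assms by simp
    fix r s' assume r: "lo \<le> r" "r < hi" and E: "extended_by k hi (P r) s s'" and R: "var R s' = int r"
    have al: "fld r (p + 2) s' = fld r (p + 2) s" using frame_fld[OF fr[OF E], of r "p + 2"] r by simp
    have PSuc: "P (Suc r) = (if fld r (p + 2) s = 0 then P r \<union> {r} \<times> {..<p} else P r)"
      using r by (auto simp: P_def less_Suc_eq)
    show "runs kk orc (Cond (int_eq (Fld (Var R) (p + 2)) (IConst 0)) (seqs (map new_record [0..<p])) Skip) s'
       (p * (p + D + 6) + 2) (\<lambda>s''. var R s'' = int r \<and> extended_by k hi (P (Suc r)) s (set_var R (int (Suc r)) s''))"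
    proof (rule runs_Cond)
      assume "bval kk orc (int_eq (Fld (Var R) (p + 2)) (IConst 0)) s'"
      then have 0: "fld r (p + 2) s = 0" using R al by simp
      show "runs kk orc (seqs (map new_record [0..<p])) s' (p * (p + D + 6) + 1)
        (\<lambda>s''. var R s'' = int r \<and> extended_by k hi (P (Suc r)) s (set_var R (int (Suc r)) s''))"
      proof (rule runs_seqs[where I = "\<lambda>i s''. extended_by k hi (P r \<union> {r} \<times> {..<i}) s s'' \<and> var R s'' = int r", THEN runs_mono])
        show "extended_by k hi (P r \<union> {r} \<times> {..<0}) s s' \<and> var R s' = int r" using E R by simp
        fix i s'' assume i: "i < p" and E': "extended_by k hi (P r \<union> {r} \<times> {..<i}) s s'' \<and> var R s'' = int r"
        have ins: "P r \<union> {r} \<times> {..<Suc i} = insert (r, i) (P r \<union> {r} \<times> {..<i})" by auto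
        show "runs kk orc (new_record i) s'' (p + D + 6)
          (\<lambda>s''. extended_by k hi (P r \<union> {r} \<times> {..<Suc i}) s s'' \<and> var R s'' = int r)"
          unfolding ins
          by (rule runs_new_record_extended) (use E' i r assms finP in \<open>auto simp: P_def\<close>)
      qed (use 0 PSuc var in auto)
    next
      assume "\<not> bval kk orc (int_eq (Fld (Var R) (p + 2)) (IConst 0)) s'"
      then show "runs kk orc Skip s' (p * (p + D + 6) + 1)
        (\<lambda>s''. var R s'' = int r \<and> extended_by k hi (P (Suc r)) s (set_var R (int (Suc r)) s''))"
        using R al PSuc var[OF E] by (intro runs_Skip) auto
    qed simp
  qed (use assms in \<open>auto simp: P_def\<close>)
qed

end

section \<open>Matrices and their coordinates\<close>

definition index_of :: "'a::finite \<Rightarrow> nat" where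
  "index_of i = inv_into {..<CARD('a)} ((!) index_list) i"

lemma length_index_list: "length (index_list :: 'a::finite list) = CARD('a)"
  using distinct_card[OF distinct_index_list[where 'a = 'a]] by (simp add: set_index_list)

lemma bij_index_list: "bij_betw ((!) (index_list :: 'a::finite list)) {..<CARD('a)} UNIV"
  by (rule bij_betw_nth) (auto simp: distinct_index_list length_index_list set_index_list)

lemma index_of_less [simp]: "index_of (i :: 'a::finite) < CARD('a)"
  unfolding index_of_def using inv_into_into[of i "(!) index_list" "{..<CARD('a)}"] bij_index_list[where 'a = 'a]
  by (auto simp: bij_betw_def)

lemma index_list_index_of [simp]: "index_list ! index_of i = i"
  unfolding index_of_def by (rule f_inv_into_f) (use bij_index_list in \<open>auto simp: bij_betw_def\<close>)

lemma index_of_index_list: "m < CARD('a) \<Longrightarrow> index_of (index_list ! m :: 'a::finite) = m"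
  unfolding index_of_def by (rule inv_into_f_f) (use bij_index_list[where 'a = 'a] in \<open>auto simp: bij_betw_def\<close>)

lemma index_of_eq_iff [simp]: "index_of i = index_of j \<longleftrightarrow> i = j"
  by (metis index_list_index_of)

lemma nth_concat_blocks:
  assumes "\<And>x. x \<in> set xs \<Longrightarrow> length (g x) = L"
  shows "length (concat (map g xs)) = L * length xs"
    and "a < length xs \<Longrightarrow> c < L \<Longrightarrow> concat (map g xs) ! (L * a + c) = g (xs ! a) ! c"
proof -
  show len: "length (concat (map g xs)) = L * length xs"
    using assms by (induction xs) auto
  show "a < length xs \<Longrightarrow> c < L \<Longrightarrow> concat (map g xs) ! (L * a + c) = g (xs ! a) ! c"
    using assms
  proof (induction xs arbitrary: a)
    case (Cons x xs)
    then show ?case by (cases a) (auto simp: nth_append algebra_simps)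
  qed simp
qed

lemma length_vec_list [simp]: "length (vec_list (v :: 'b ^ 'a::finite)) = CARD('a)"
  by (simp add: vec_list_def length_index_list)

lemma nth_vec_list: "m < CARD('a) \<Longrightarrow> vec_list (v :: 'b ^ 'a::finite) ! m = v $ (index_list ! m)"
  by (simp add: vec_list_def length_index_list)

lemma length_matrix_list [simp]: "length (matrix_list (M :: real ^ 'p::finite ^ 'd::finite)) = CARD('d) * CARD('p)"
  unfolding matrix_list_def by (subst nth_concat_blocks(1)[where L = "CARD('p)"]) auto

text \<open>The position of an entry in \<open>matrix_list\<close>; its residue modulo
  \<open>CARD('p)\<close> is the number of the column.\<close>

definition coord :: "'d::finite \<Rightarrow> 'p::finite \<Rightarrow> nat" where
  "coord a c = CARD('p) * index_of a + index_of c"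

lemma coord_mod: "coord a (c :: 'p::finite) mod CARD('p) = index_of c"
  by (simp add: coord_def)

lemma bij_coord: "bij_betw (\<lambda>(a, c). coord a c) (UNIV :: ('d::finite \<times> 'p::finite) set) {..<CARD('d) * CARD('p)}"
proof -
  have inj: "inj (\<lambda>(a :: 'd, c :: 'p). coord a c)"
  proof (rule injI, clarify)
    fix a a' :: 'd and c c' :: 'p assume "coord a c = coord a' c'"
    then have "index_of c + CARD('p) * index_of a = index_of c' + CARD('p) * index_of a'"
      by (simp add: coord_def)
    then show "a = a' \<and> c = c'" using radix_unique[of "index_of c" "CARD('p)" "index_of c'" "index_of a" "index_of a'"] by simp
  qed
  have "(\<lambda>(a :: 'd, c :: 'p). coord a c) ` UNIV \<subseteq> {..<CARD('d) * CARD('p)}"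
  proof clarify
    fix a :: 'd and c :: 'p
    have "coord a c < CARD('p) * index_of a + CARD('p)" by (simp add: coord_def)
    also have "\<dots> = CARD('p) * Suc (index_of a)" by simp
    also have "\<dots> \<le> CARD('p) * CARD('d)" by (intro mult_le_mono2 Suc_leI index_of_less)
    finally show "coord a c < CARD('d) * CARD('p)" by (simp add: mult.commute)
  qed
  moreover have "card ((\<lambda>(a :: 'd, c :: 'p). coord a c) ` UNIV) = CARD('d) * CARD('p)"
    using inj by (simp add: card_image)
  ultimately have "(\<lambda>(a :: 'd, c :: 'p). coord a c) ` UNIV = {..<CARD('d) * CARD('p)}"
    by (intro card_subset_eq) auto
  then show ?thesis using inj by (simp add: bij_betw_def)
qed

lemma coord_less [simp]: "coord (a :: 'd::finite) (c :: 'p::finite) < CARD('d) * CARD('p)"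
  using bij_betwE[OF bij_coord[where 'd = 'd and 'p = 'p]] by (auto dest!: bspec[of _ _ "(a, c)"])

lemma coord_cases:
  assumes "m < CARD('d::finite) * CARD('p::finite)"
  obtains a :: "'d::finite" and c :: "'p::finite" where "m = coord a c"
proof -
  have "m \<in> (\<lambda>(a :: 'd, c :: 'p). coord a c) ` UNIV"
    using assms bij_coord[where 'd = 'd and 'p = 'p] by (simp add: bij_betw_def)
  then show ?thesis using that by auto
qed

lemma nth_matrix_list: "matrix_list M ! coord a c = M $ a $ c" for M :: "real ^ 'p::finite ^ 'd::finite"
  unfolding matrix_list_def coord_def
  by (subst nth_concat_blocks(2)) (auto simp: nth_vec_list)

lemma sum_coord:
  "(\<Sum>m<CARD('d::finite) * CARD('p::finite). g m) = (\<Sum>a\<in>UNIV. \<Sum>c\<in>UNIV. g (coord (a :: 'd::finite) (c :: 'p::finite)))"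
proof -
  have "(\<Sum>m<CARD('d) * CARD('p). g m) = (\<Sum>t\<in>UNIV. g ((\<lambda>(a :: 'd, c :: 'p). coord a c) t))"
    by (rule sum.reindex_bij_betw[OF bij_coord, symmetric])
  then show ?thesis by (simp add: sum.cartesian_product case_prod_beta)
qed

text \<open>Caratheodory's theorem in the form that nested loops can use: tuples of fixed length in
  which entries may repeat, a smaller set being padded with one of its elements.\<close>

lemma convex_hull_eq_tuples:
  fixes u :: "'r \<Rightarrow> 'a::euclidean_space"
  shows "x \<in> convex hull (u ` B) \<longleftrightarrow>
    (\<exists>zs. (\<forall>i\<le>DIM('a). zs i \<in> B) \<and> x \<in> convex hull (u ` (zs ` {..DIM('a)})))"
proof
  assume "x \<in> convex hull (u ` B)"
  then obtain S where S: "finite S" "S \<subseteq> u ` B" "card S \<le> DIM('a) + 1" "x \<in> convex hull S"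
    unfolding caratheodory[of "u ` B"] by blast
  then have "S \<noteq> {}" by auto
  \<comment> \<open>Different records may have equal utilities; \<open>T\<close> picks one record
    for each point, so the bound on points carries over to records.\<close>
  obtain T where T: "T \<subseteq> B" "S = u ` T" "card T = card S" "finite T"
    using S(1,2) by (metis (no_types, lifting) card_image finite_image_iff subset_image_inj)
  then have "T \<noteq> {}" using \<open>S \<noteq> {}\<close> by auto
  then obtain t where t: "t \<in> T" by auto
  obtain h where h: "bij_betw h {0..<card T} T" using ex_bij_betw_nat_finite[OF T(4)] by blast
  define zs where "zs = (\<lambda>i. if i < card T then h i else t)"
  have "zs ` {..DIM('a)} = T"
  proof
    show "zs ` {..DIM('a)} \<subseteq> T" using h t by (auto simp: zs_def bij_betw_def)
    show "T \<subseteq> zs ` {..DIM('a)}"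
    proof
      fix r assume "r \<in> T"
      then have "r \<in> h ` {0..<card T}" using h by (simp add: bij_betw_def)
      then obtain i where "i < card T" "r = h i" by auto
      then show "r \<in> zs ` {..DIM('a)}" using T(3) S(3) by (intro image_eqI[of _ _ i]) (auto simp: zs_def)
    qed
  qed
  then show "\<exists>zs. (\<forall>i\<le>DIM('a). zs i \<in> B) \<and> x \<in> convex hull (u ` (zs ` {..DIM('a)}))"
    using T S by (intro exI[of _ zs]) auto
next
  assume "\<exists>zs. (\<forall>i\<le>DIM('a). zs i \<in> B) \<and> x \<in> convex hull (u ` (zs ` {..DIM('a)}))"
  then obtain zs where "\<forall>i\<le>DIM('a). zs i \<in> B" "x \<in> convex hull (u ` (zs ` {..DIM('a)}))" by blast
  then show "x \<in> convex hull (u ` B)" using hull_mono[of "u ` (zs ` {..DIM('a)})" "u ` B" convex] by blast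
qed

lemma total_utility_Suc:
  "total_utility C (Suc k) a = total_utility C k a + placed C (Suc k) (a (Suc k))"
  by (simp add: total_utility_def)

lemma total_weight_Suc:
  "total_weight w (Suc k) a = total_weight w k a + axis (a (Suc k)) (w (Suc k) $ a (Suc k))"
  by (simp add: total_weight_def)

lemma total_cong:
  assumes "\<And>j. j \<in> {1..k} \<Longrightarrow> a j = a' j"
  shows "total_utility C k a = total_utility C k a'" "total_weight w k a = total_weight w k a'"
  unfolding total_utility_def total_weight_def by (rule sum.cong; use assms in simp)+

lemma load_nth: "m < length xs \<Longrightarrow> load xs (int m) = xs ! m"
  by (simp add: load_def)

section \<open>The program on partition problems\<close>

locale partition_machine = layout p D for p D :: nat +
  fixes n :: nat and C :: "nat \<Rightarrow> real ^ 'p::finite ^ 'd::finite" and w :: "nat \<Rightarrow> int ^ 'p"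
    and b :: "int ^ 'p" and f :: "real ^ 'p ^ 'd \<Rightarrow> real"
  assumes p: "p = CARD('p)" and D: "D = CARD('d) * CARD('p)"
begin

definition utility :: "state \<Rightarrow> nat \<Rightarrow> real ^ 'p ^ 'd" where
  "utility s r = (\<chi> a c. util r (coord a c) s)"

definition weight :: "state \<Rightarrow> nat \<Rightarrow> int ^ 'p" where
  "weight s r = (\<chi> i. fld r (index_of i) s)"

definition alive :: "state \<Rightarrow> nat \<Rightarrow> bool" where
  "alive s r \<longleftrightarrow> fld r (p + 2) s = 0"

lemma not_tuple_var [simp]: "v < 10 \<Longrightarrow> v \<notin> Y ` S"
  by auto

lemma sum_D: "(\<Sum>l<D. g l) = (\<Sum>a\<in>UNIV. \<Sum>c\<in>UNIV. g (coord (a :: 'd) (c :: 'p)))"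
  unfolding D by (rule sum_coord)

lemma weight_eq_iff: "weight s r = weight s' r' \<longleftrightarrow> (\<forall>q<p. fld r q s = fld r' q s')"
proof -
  have "{..<p} = range (index_of :: 'p \<Rightarrow> nat)"
    by (auto simp: p) (metis index_of_index_list rangeI)
  then have "(\<forall>q\<in>{..<p}. fld r q s = fld r' q s') \<longleftrightarrow> (\<forall>i::'p. fld r (index_of i) s = fld r' (index_of i) s')"
    by simp
  then show ?thesis by (simp add: weight_def vec_eq_iff Ball_def)
qed

lemma utility_frame:
  assumes "frame V F G s s'" "r \<notin> G"
  shows "utility s' r = utility s r"
  unfolding utility_def using frame_util[OF assms] by (simp add: D)

lemma weight_frame:
  assumes "frame V F G s s'" "\<And>q. q < p \<Longrightarrow> (r, q) \<notin> F"
  shows "weight s' r = weight s r"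
  unfolding weight_eq_iff using frame_fld[OF assms(1)] assms(2) by auto

lemma alive_frame:
  assumes "frame V F G s s'" "(r, p + 2) \<notin> F"
  shows "alive s' r = alive s r"
  unfolding alive_def using frame_fld[OF assms] by auto

section \<open>Redundant records and the search for them\<close>

definition redundant_at :: "state \<Rightarrow> nat \<Rightarrow> nat set \<Rightarrow> bool" where
  "redundant_at s x Z \<longleftrightarrow>
     utility s x \<in> convex hull (utility s ` {y \<in> Z. y \<noteq> x \<and> alive s y \<and> weight s y = weight s x})"

lemma redundant_at_frame:
  assumes "frame V {(x, p + 2)} {} s s'"
  shows "redundant_at s' x Z \<longleftrightarrow> redundant_at s x Z"
proof -
  have u: "utility s' r = utility s r" for r using utility_frame[OF assms] by simp
  have wt: "weight s' r = weight s r" for r using weight_frame[OF assms] by simp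
  have "{y \<in> Z. y \<noteq> x \<and> alive s' y \<and> weight s' y = weight s' x} = {y \<in> Z. y \<noteq> x \<and> alive s y \<and> weight s y = weight s x}"
    using alive_frame[OF assms] wt by auto
  then show ?thesis unfolding redundant_at_def by (simp add: u)
qed

lemma separated_iff_not_in_hull:
  assumes "finite Z"
  shows "separated D ((\<lambda>y l. util y l s - util x l s) ` Z) \<longleftrightarrow> utility s x \<notin> convex hull (utility s ` Z)"
proof -
  have inner: "M \<bullet> (utility s y - utility s x) = (\<Sum>l<D. (util y l s - util x l s) * c l)"
    if "\<And>a e. M $ a $ e = c (coord a e)" for M y and c :: "nat \<Rightarrow> real"
    using that unfolding sum_D by (simp add: inner_vec_def utility_def mult.commute)
  have "separated D ((\<lambda>y l. util y l s - util x l s) ` Z) \<longleftrightarrow>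
      (\<exists>M. \<forall>y\<in>Z. 0 < M \<bullet> (utility s y - utility s x))"
  proof
    assume "separated D ((\<lambda>y l. util y l s - util x l s) ` Z)"
    then obtain c where c: "\<And>y. y \<in> Z \<Longrightarrow> 0 < (\<Sum>l<D. (util y l s - util x l s) * c l)"
      unfolding separated_def by auto
    show "\<exists>M. \<forall>y\<in>Z. 0 < M \<bullet> (utility s y - utility s x)"
      using c inner[of "\<chi> a e. c (coord a e)" c] by (intro exI[of _ "\<chi> a e. c (coord a e)"]) simp
  next
    assume "\<exists>M. \<forall>y\<in>Z. 0 < M \<bullet> (utility s y - utility s x)"
    then obtain M where "\<forall>y\<in>Z. 0 < M \<bullet> (utility s y - utility s x)" ..
    then show "separated D ((\<lambda>y l. util y l s - util x l s) ` Z)"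
      unfolding separated_def using inner[of M "\<lambda>l. matrix_list M ! l"]
      by (intro exI[of _ "\<lambda>l. matrix_list M ! l"]) (simp add: nth_matrix_list)
  qed
  then show ?thesis using not_in_hull_iff_separable[of "utility s ` Z" "utility s x"] assms by auto
qed

lemma bval_redundant:
  assumes x: "var X s = int x" and ys: "\<And>i. i \<le> D \<Longrightarrow> var (Y i) s = int (ys i)"
  shows "bval kk orc redundant s \<longleftrightarrow> redundant_at s x (ys ` {..D})"
proof -
  let ?Z = "{y \<in> ys ` {..D}. y \<noteq> x \<and> alive s y \<and> weight s y = weight s x}"
  have g: "bval kk orc (guard i) s \<longleftrightarrow> alive s (ys i) \<and> ys i \<noteq> x \<and> weight s (ys i) = weight s x" if "i \<le> D" for i
    using x ys[OF that] unfolding guard_def weight_eq_iff by (auto simp: alive_def)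
  have r: "rval (row i l) s = util (ys i) l s - util x l s" if "i \<le> D" for i l
    using x ys[OF that] by (simp add: row_def)
  have "active_rows kk orc (map (\<lambda>i. (guard i, row i)) [0..<Suc D]) s = (\<lambda>y l. util y l s - util x l s) ` ?Z"
  proof -
    have "active_rows kk orc (map (\<lambda>i. (guard i, row i)) [0..<Suc D]) s =
        (\<lambda>i l. rval (row i l) s) ` {i. i \<le> D \<and> bval kk orc (guard i) s}"
    proof -
      have "set (map (\<lambda>i. (guard i, row i)) [0..<Suc D]) = (\<lambda>i. (guard i, row i)) ` {..D}"
        by (simp only: set_map set_upt atLeast0LessThan lessThan_Suc_atMost)
      then show ?thesis unfolding active_rows_def by auto
    qed
    also have "\<dots> = (\<lambda>i l. util (ys i) l s - util x l s) ` {i. i \<le> D \<and> bval kk orc (guard i) s}"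
      using r by (intro image_cong) auto
    also have "\<dots> = (\<lambda>y l. util y l s - util x l s) ` ys ` {i. i \<le> D \<and> bval kk orc (guard i) s}"
      by (simp add: image_image)
    also have "ys ` {i. i \<le> D \<and> bval kk orc (guard i) s} = ?Z"
      using g by auto
    finally show ?thesis .
  qed
  moreover have "separated D ((\<lambda>y l. util y l s - util x l s) ` ?Z) \<longleftrightarrow> utility s x \<notin> convex hull (utility s ` ?Z)"
    by (rule separated_iff_not_in_hull) simp
  ultimately show ?thesis
    unfolding redundant_def bval_infeasible_test redundant_at_def by (simp only: not_not)
qed

text \<open>The entries from \<open>j\<close> on have been fixed by the surrounding loops, hence the
  general \<open>ys\<close>. The flag only ever changes to 1, so it accumulates the disjunction over
  all tuples tried.\<close>

lemma runs_search:
  assumes "j \<le> Suc D" "lo \<le> hi" "var LO s = int lo" "var HI s = int hi" "var X s = int x"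
    "\<And>i. j \<le> i \<Longrightarrow> i \<le> D \<Longrightarrow> var (Y i) s = int (ys i)"
  shows "runs kk orc (search j) s (search_time j (hi - lo))
    (\<lambda>s'. frame (Y ` {..<j}) {(x, p + 2)} {} s s' \<and>
      fld x (p + 2) s' = (if \<exists>zs. (\<forall>i<j. zs i \<in> {lo..<hi}) \<and> (\<forall>i\<ge>j. zs i = ys i) \<and> redundant_at s x (zs ` {..D})
        then 1 else fld x (p + 2) s))"
  using assms
proof (induction j arbitrary: s ys)
  case 0
  have "(\<exists>zs. (\<forall>i<0::nat. zs i \<in> {lo..<hi}) \<and> (\<forall>i\<ge>0. zs i = ys i) \<and> redundant_at s x (zs ` {..D})) \<longleftrightarrow> redundant_at s x (ys ` {..D})"
  proof -
    have "(\<forall>i\<ge>0. zs i = ys i) \<longleftrightarrow> zs = ys" for zs :: "nat \<Rightarrow> nat" by auto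
    then show ?thesis by auto
  qed
  moreover have "bval kk orc redundant s \<longleftrightarrow> redundant_at s x (ys ` {..D})"
    using 0 by (intro bval_redundant) auto
  moreover have "frame {} {(x, p + 2)} {} s (set_fld x (p + 2) 1 s)"
    by (rule frame_set_fld) auto
  ultimately show ?case
    unfolding search.simps search_time.simps using 0
    by (intro runs_Cond[where T = 1] runs_store_fld[of _ x] runs_Skip) auto
next
  case (Suc j)
  let ?F = "frame (Y ` {..<Suc j}) {(x, p + 2)} {}"
  \<comment> \<open>Success among the tuples whose entry \<open>j\<close> has already been tried,
    that is, lies below the loop counter.\<close>
  define found where "found = (\<lambda>y. \<exists>zs. (\<forall>i<Suc j. zs i \<in> {lo..<hi}) \<and> (\<forall>i\<ge>Suc j. zs i = ys i) \<and> zs j < y \<and> redundant_at s x (zs ` {..D}))"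
  define I where "I = (\<lambda>y s'. ?F s s' \<and> fld x (p + 2) s' = (if found y then 1 else fld x (p + 2) s))"
  have set_I: "I y (set_var (Y j) v s')" if "I y s'" for y v s'
    using that frame_set_var[of "Y ` {..<Suc j}" _ _ s s' "Y j" v] Suc.prems(1) by (simp add: I_def)
  show ?case unfolding search.simps search_time.simps
  proof (rule runs_for_loop[where I = I, THEN runs_mono])
    show "I lo (set_var (Y j) (int lo) s)"
      by (rule set_I) (auto simp: I_def found_def)
    show "ival (Var HI) s' = int hi" if "I y s'" for y s'
      using that frame_var[of "Y ` {..<Suc j}" "{(x, p + 2)}" "{}" s s' HI] Suc.prems by (auto simp: I_def)
    fix y s' assume y: "lo \<le> y" "y < hi" and I: "I y s'" and Yj: "var (Y j) s' = int y"
    have fr: "?F s s'" using I by (simp add: I_def)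
    have "runs kk orc (search j) s' (search_time j (hi - lo))
      (\<lambda>s''. frame (Y ` {..<j}) {(x, p + 2)} {} s' s'' \<and>
        fld x (p + 2) s'' = (if \<exists>zs. (\<forall>i<j. zs i \<in> {lo..<hi}) \<and> (\<forall>i\<ge>j. zs i = (ys(j := y)) i) \<and> redundant_at s' x (zs ` {..D})
        then 1 else fld x (p + 2) s'))"
    proof (rule Suc.IH)
      show "var (Y i) s' = int ((ys(j := y)) i)" if "j \<le> i" "i \<le> D" for i
      proof (cases "i = j")
        case False
        then have "Y i \<notin> Y ` {..<Suc j}" using that unfolding image_iff by force
        then have "var (Y i) s' = var (Y i) s" using frame_var[OF fr] that by simp
        then show ?thesis using Suc.prems(6)[of i] that False by simp
      qed (use Yj in simp)
    qed (use frame_var[OF fr] Suc.prems in auto)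
    then show "runs kk orc (search j) s' (search_time j (hi - lo))
      (\<lambda>s''. var (Y j) s'' = int y \<and> I (Suc y) (set_var (Y j) (int (Suc y)) s''))"
    proof (rule runs_mono)
      fix s''
      assume s'': "frame (Y ` {..<j}) {(x, p + 2)} {} s' s'' \<and>
        fld x (p + 2) s'' = (if \<exists>zs. (\<forall>i<j. zs i \<in> {lo..<hi}) \<and> (\<forall>i\<ge>j. zs i = (ys(j := y)) i) \<and> redundant_at s' x (zs ` {..D})
        then 1 else fld x (p + 2) s')"
      then have fr': "frame (Y ` {..<j}) {(x, p + 2)} {} s' s''" by blast
      have "Y j \<notin> Y ` {..<j}" unfolding image_iff by simp
      then have "var (Y j) s'' = int y" using frame_var[OF fr', of "Y j"] Yj Suc.prems(1) by simp
      moreover have "?F s s''" by (rule frame_trans[OF fr frame_mono[OF fr']]) auto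
      moreover have "found (Suc y) \<longleftrightarrow> found y \<or>
        (\<exists>zs. (\<forall>i<j. zs i \<in> {lo..<hi}) \<and> (\<forall>i\<ge>j. zs i = (ys(j := y)) i) \<and> redundant_at s' x (zs ` {..D}))"
      proof -
        have all_ge: "(\<forall>i\<ge>j. Q i) \<longleftrightarrow> Q j \<and> (\<forall>i\<ge>Suc j. Q i)" for Q
          by (metis Suc_leD Suc_leI le_neq_implies_less le_refl)
        have ge: "(\<forall>i\<ge>j. zs i = (ys(j := y)) i) \<longleftrightarrow> zs j = y \<and> (\<forall>i\<ge>Suc j. zs i = ys i)" for zs
          unfolding all_ge[of "\<lambda>i. zs i = (ys(j := y)) i"] by auto
        have "found (Suc y) \<longleftrightarrow> found y \<or> (\<exists>zs. (\<forall>i<Suc j. zs i \<in> {lo..<hi}) \<and> (\<forall>i\<ge>Suc j. zs i = ys i) \<and> zs j = y \<and> redundant_at s x (zs ` {..D}))"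
          unfolding found_def less_Suc_eq by blast
        also have "(\<exists>zs. (\<forall>i<Suc j. zs i \<in> {lo..<hi}) \<and> (\<forall>i\<ge>Suc j. zs i = ys i) \<and> zs j = y \<and> redundant_at s x (zs ` {..D})) \<longleftrightarrow>
          (\<exists>zs. (\<forall>i<j. zs i \<in> {lo..<hi}) \<and> (\<forall>i\<ge>j. zs i = (ys(j := y)) i) \<and> redundant_at s' x (zs ` {..D}))"
          unfolding ge redundant_at_frame[OF fr] All_less_Suc by (intro arg_cong[where f = Ex] ext) (use y in auto)
        finally show ?thesis .
      qed
      ultimately show "var (Y j) s'' = int y \<and> I (Suc y) (set_var (Y j) (int (Suc y)) s'')"
        using I s'' by (intro conjI set_I) (auto simp: I_def)
    qed simp
  next
    fix s' assume s': "I hi s' \<and> var (Y j) s' = int hi"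
    have "found hi \<longleftrightarrow> (\<exists>zs. (\<forall>i<Suc j. zs i \<in> {lo..<hi}) \<and> (\<forall>i\<ge>Suc j. zs i = ys i) \<and> redundant_at s x (zs ` {..D}))"
      unfolding found_def by (metis atLeastLessThan_iff lessI)
    then show "frame (Y ` {..<Suc j}) {(x, p + 2)} {} s s' \<and>
      fld x (p + 2) s' = (if \<exists>zs. (\<forall>i<Suc j. zs i \<in> {lo..<hi}) \<and> (\<forall>i\<ge>Suc j. zs i = ys i) \<and> redundant_at s x (zs ` {..D})
        then 1 else fld x (p + 2) s)"
      using s' by (simp add: I_def)
  qed (use Suc.prems in auto)
qed

text \<open>Caratheodory's theorem reduces the whole stage to tuples of length \<open>D + 1\<close>;
  conversely, the hull of a tuple is contained in that of the stage.\<close>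

lemma runs_full_search:
  assumes "lo \<le> hi" "var LO s = int lo" "var HI s = int hi" "var X s = int x"
  shows "runs kk orc (search (Suc D)) s (search_time (Suc D) (hi - lo))
    (\<lambda>s'. frame (Y ` {..D}) {(x, p + 2)} {} s s' \<and>
      fld x (p + 2) s' = (if redundant_at s x {lo..<hi} then 1 else fld x (p + 2) s))"
proof (rule runs_mono[OF runs_search[OF order_refl assms, where ys = "\<lambda>_. 0"]])
  let ?B = "{y \<in> {lo..<hi}. y \<noteq> x \<and> alive s y \<and> weight s y = weight s x}"
  have dim: "DIM(real ^ 'p ^ 'd) = D" by (simp add: D)
  have "redundant_at s x {lo..<hi} \<longleftrightarrow> (\<exists>zs. (\<forall>i<Suc D. zs i \<in> {lo..<hi}) \<and> (\<forall>i\<ge>Suc D. zs i = 0) \<and> redundant_at s x (zs ` {..D}))"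
  proof
    assume "redundant_at s x {lo..<hi}"
    then obtain zs where zs: "\<forall>i\<le>D. zs i \<in> ?B" "utility s x \<in> convex hull (utility s ` (zs ` {..D}))"
      using convex_hull_eq_tuples[of "utility s x" "utility s" ?B] unfolding redundant_at_def dim by blast
    \<comment> \<open>The search was instantiated with \<open>ys\<close> constantly 0, so the tuple
      is continued by 0 beyond index \<open>D\<close>.\<close>
    define zs' where "zs' = (\<lambda>i. if i \<le> D then zs i else 0)"
    have "zs' ` {..D} = zs ` {..D}" by (auto simp: zs'_def)
    moreover have "{y \<in> zs ` {..D}. y \<noteq> x \<and> alive s y \<and> weight s y = weight s x} = zs ` {..D}"
      using zs(1) by auto
    ultimately have "redundant_at s x (zs' ` {..D})" using zs(2) by (simp add: redundant_at_def)
    then show "\<exists>zs. (\<forall>i<Suc D. zs i \<in> {lo..<hi}) \<and> (\<forall>i\<ge>Suc D. zs i = 0) \<and> redundant_at s x (zs ` {..D})"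
      using zs(1) by (intro exI[of _ zs']) (auto simp: zs'_def)
  next
    assume "\<exists>zs. (\<forall>i<Suc D. zs i \<in> {lo..<hi}) \<and> (\<forall>i\<ge>Suc D. zs i = 0) \<and> redundant_at s x (zs ` {..D})"
    then obtain zs where zs: "\<forall>i<Suc D. zs i \<in> {lo..<hi}" "redundant_at s x (zs ` {..D})" by blast
    have "{y \<in> zs ` {..D}. y \<noteq> x \<and> alive s y \<and> weight s y = weight s x} \<subseteq> ?B" using zs(1) by auto
    then show "redundant_at s x {lo..<hi}"
      using zs(2) unfolding redundant_at_def using hull_mono[OF image_mono, of _ _ convex "utility s"] by blast
  qed
  moreover fix s' assume "frame (Y ` {..<Suc D}) {(x, p + 2)} {} s s' \<and>
      fld x (p + 2) s' = (if \<exists>zs. (\<forall>i<Suc D. zs i \<in> {lo..<hi}) \<and> (\<forall>i\<ge>Suc D. zs i = 0) \<and> redundant_at s x (zs ` {..D})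
        then 1 else fld x (p + 2) s)"
  ultimately show "frame (Y ` {..D}) {(x, p + 2)} {} s s' \<and>
      fld x (p + 2) s' = (if redundant_at s x {lo..<hi} then 1 else fld x (p + 2) s)"
    by (simp add: lessThan_Suc_atMost)
qed simp_all

section \<open>Pruning preserves the convex hulls\<close>

definition points :: "state \<Rightarrow> nat set \<Rightarrow> int ^ 'p \<Rightarrow> (real ^ 'p ^ 'd) set" where
  "points s Z v = utility s ` {r \<in> Z. alive s r \<and> weight s r = v}"

definition irredundant :: "state \<Rightarrow> nat set \<Rightarrow> nat \<Rightarrow> bool" where
  "irredundant s Z x \<longleftrightarrow> (\<forall>r\<in>Z. r < x \<longrightarrow> alive s r \<longrightarrow> \<not> redundant_at s r Z)"

text \<open>Records are judged one after the other against those still alive. Judged simultaneously,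
  two records with the same point and the same sums would both disappear; in sequence, the last copy
  can remain.\<close>

lemma runs_prune:
  assumes "lo \<le> hi" "var LO s = int lo" "var HI s = int hi" and al: "\<And>r. r \<in> {lo..<hi} \<Longrightarrow> alive s r"
  shows "runs kk orc prune s ((hi - lo) * (search_time (Suc D) (hi - lo) + 2) + 2)
    (\<lambda>s'. frame ({X} \<union> Y ` {..D}) ({lo..<hi} \<times> {p + 2}) {} s s' \<and> irredundant s' {lo..<hi} hi \<and>
      (\<forall>v. convex hull (points s' {lo..<hi} v) = convex hull (points s {lo..<hi} v)))"
proof -
  let ?F = "frame ({X} \<union> Y ` {..D}) ({lo..<hi} \<times> {p + 2}) {}"
  define I where "I = (\<lambda>x s'. ?F s s' \<and> irredundant s' {lo..<hi} x \<and> (\<forall>r\<in>{x..<hi}. alive s' r) \<and>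
      (\<forall>v. convex hull (points s' {lo..<hi} v) = convex hull (points s {lo..<hi} v)))"
  have set_I: "I x (set_var X v s')" if "I x s'" for x v s'
  proof -
    have u: "utility (set_var X v s') = utility s'" by (simp add: utility_def fun_eq_iff)
    have "weight (set_var X v s') r = weight s' r" for r unfolding weight_eq_iff by simp
    then have w: "weight (set_var X v s') = weight s'" by auto
    have a: "alive (set_var X v s') = alive s'" by (simp add: alive_def fun_eq_iff)
    show ?thesis using that frame_set_var[of "{X} \<union> Y ` {..D}" _ _ s s' X v]
      unfolding I_def irredundant_def points_def redundant_at_def u w a by simp
  qed
  show ?thesis unfolding prune_def
  proof (rule runs_for_loop[where I = I, THEN runs_mono])
    show "I lo (set_var X (int lo) s)"
      by (rule set_I) (auto simp: I_def irredundant_def al)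
    show "ival (Var HI) s' = int hi" if "I y s'" for y s'
      using that frame_var[of "{X} \<union> Y ` {..D}" "{lo..<hi} \<times> {p + 2}" "{}" s s' HI] assms by (auto simp: I_def)
    fix x s' assume x: "lo \<le> x" "x < hi" and I: "I x s'" and X: "var X s' = int x"
    have fr: "?F s s'" using I by (simp add: I_def)
    have "runs kk orc (search (Suc D)) s' (search_time (Suc D) (hi - lo))
      (\<lambda>s''. frame (Y ` {..D}) {(x, p + 2)} {} s' s'' \<and>
        fld x (p + 2) s'' = (if redundant_at s' x {lo..<hi} then 1 else fld x (p + 2) s'))"
      by (rule runs_full_search) (use frame_var[OF fr] X assms in auto)
    then show "runs kk orc (search (Suc D)) s' (search_time (Suc D) (hi - lo))
      (\<lambda>s''. var X s'' = int x \<and> I (Suc x) (set_var X (int (Suc x)) s''))"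
    proof (rule runs_mono)
      fix s'' assume s'': "frame (Y ` {..D}) {(x, p + 2)} {} s' s'' \<and>
        fld x (p + 2) s'' = (if redundant_at s' x {lo..<hi} then 1 else fld x (p + 2) s')"
      then have fr': "frame (Y ` {..D}) {(x, p + 2)} {} s' s''" by blast
      have u: "utility s'' = utility s'" using utility_frame[OF fr'] by auto
      have wt: "weight s'' = weight s'" using weight_frame[OF fr'] by auto
      have a: "alive s'' r = alive s' r" if "r \<noteq> x" for r using alive_frame[OF fr'] that by simp
      have ax: "alive s'' x \<longleftrightarrow> \<not> redundant_at s' x {lo..<hi}"
        using s'' I x by (auto simp: alive_def I_def)
      have ax': "alive s' x" using I x by (auto simp: I_def)
      have X'': "var X s'' = int x" using frame_var[OF fr', of X] X by auto
      have fr'': "?F s s''" by (rule frame_trans[OF fr frame_mono[OF fr']]) (use x in auto)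
      have a': "alive s'' r \<longleftrightarrow> alive s' r \<and> (r = x \<longrightarrow> \<not> redundant_at s' x {lo..<hi})" for r
        using a ax ax' by (cases "r = x") auto
      have le: "alive s' r" if "alive s'' r" for r using a ax' that by (cases "r = x") auto
      have sub: "points s'' {lo..<hi} v \<subseteq> points s' {lo..<hi} v" for v
        unfolding points_def u wt by (intro image_mono Collect_mono) (use le in blast)
      have hull: "convex hull (points s'' {lo..<hi} v) = convex hull (points s' {lo..<hi} v)" for v
      proof (cases "redundant_at s' x {lo..<hi} \<and> weight s' x = v")
        case False
        then have "points s'' {lo..<hi} v = points s' {lo..<hi} v"
          unfolding points_def u wt a' by (intro image_cong Collect_cong) auto
        then show ?thesis by simp
      next
        \<comment> \<open>The discarded point lies in the hull of what remains of its class, so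
          removing it does not shrink that hull.\<close>
        case True
        have eq: "points s'' {lo..<hi} v = utility s' ` {y \<in> {lo..<hi}. y \<noteq> x \<and> alive s' y \<and> weight s' y = weight s' x}"
          unfolding points_def u wt a' using True by (intro image_cong Collect_cong) auto
        have "points s' {lo..<hi} v \<subseteq> insert (utility s' x) (points s'' {lo..<hi} v)"
          unfolding eq unfolding points_def using True by auto
        moreover have "utility s' x \<in> convex hull (points s'' {lo..<hi} v)"
          unfolding eq using True[unfolded redundant_at_def] by blast
        ultimately have "points s' {lo..<hi} v \<subseteq> convex hull (points s'' {lo..<hi} v)"
          using hull_subset[of "points s'' {lo..<hi} v" convex] by auto
        then have "convex hull (points s' {lo..<hi} v) \<subseteq> convex hull (points s'' {lo..<hi} v)"
          by (rule hull_minimal) (rule convex_convex_hull)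
        with hull_mono[OF sub[of v], of convex] show ?thesis by (rule subset_antisym)
      qed
      \<comment> \<open>Discarding only removes comparators, so irredundance persists and one pass
        is enough.\<close>
      have red: "\<not> redundant_at s'' r {lo..<hi}" if "\<not> redundant_at s' r {lo..<hi}" for r
      proof -
        have "utility s' ` {y \<in> {lo..<hi}. y \<noteq> r \<and> alive s'' y \<and> weight s' y = weight s' r}
          \<subseteq> utility s' ` {y \<in> {lo..<hi}. y \<noteq> r \<and> alive s' y \<and> weight s' y = weight s' r}"
          by (intro image_mono Collect_mono) (use le in blast)
        from hull_mono[OF this, of convex] show ?thesis using that unfolding redundant_at_def u wt by blast
      qed
      have "irredundant s'' {lo..<hi} (Suc x)"
        unfolding irredundant_def
      proof (intro ballI impI)
        fix r assume r: "r \<in> {lo..<hi}" "r < Suc x" "alive s'' r"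
        show "\<not> redundant_at s'' r {lo..<hi}"
        proof (cases "r = x")
          case True then show ?thesis using r ax red by auto
        next
          case False then show ?thesis using r a red I by (auto simp: I_def irredundant_def)
        qed
      qed
      then have "I (Suc x) s''"
        using I a fr'' hull by (simp add: I_def)
      then show "var X s'' = int x \<and> I (Suc x) (set_var X (int (Suc x)) s'')"
        using X'' set_I by blast
    qed simp
  qed (use assms in \<open>auto simp: I_def\<close>)
qed

definition input_ok :: "state \<Rightarrow> bool" where
  "input_ok s \<longleftrightarrow> (\<forall>a. inp a s = load (int_input n w b) (int a)) \<and> (\<forall>a. rinp a s = load (real_input n C) (int a))"

lemma input_ok_frame: "frame V F G s s' \<Longrightarrow> input_ok s \<Longrightarrow> input_ok s'"
  by (simp add: input_ok_def frame_inp frame_rinp)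

lemma inp_n: "input_ok s \<Longrightarrow> inp 0 s = int n"
  by (simp add: input_ok_def load_def int_input_def)

lemma inp_b:
  assumes "input_ok s"
  shows "inp (1 + index_of i) s = b $ i"
proof -
  have "index_of i < length (vec_list b @ concat (map (\<lambda>j. vec_list (w j)) [1..<Suc n]))"
    by (simp add: trans_less_add1 del: upt_Suc)
  then have "load (int_input n w b) (int (1 + index_of i)) = (vec_list b @ concat (map (\<lambda>j. vec_list (w j)) [1..<Suc n])) ! index_of i"
    unfolding int_input_def by (subst load_nth) auto
  also have "\<dots> = b $ i" by (simp add: nth_append nth_vec_list del: upt_Suc)
  finally show ?thesis using assms unfolding input_ok_def by metis
qed

lemma inp_w:
  assumes "input_ok s" "1 \<le> j" "j \<le> n"
  shows "inp (p * j + 1 + index_of i) s = w j $ i"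
proof -
  let ?L = "concat (map (\<lambda>j. vec_list (w j)) [1..<Suc n])"
  have len: "length ?L = p * n" and nth: "?L ! (p * (j - 1) + index_of i) = w j $ i"
    using assms by (subst nth_concat_blocks[where L = p]; simp add: p nth_vec_list del: upt_Suc)+
  have pj: "p * j = p + p * (j - 1)" using assms(2) by (cases j) auto
  have "p * (j - 1) + index_of i < p * j" using index_of_less[of i] unfolding pj by (simp add: p)
  also have "\<dots> \<le> p * n" using assms by simp
  finally have lt: "p * (j - 1) + index_of i < p * n" .
  have "inp (p * j + 1 + index_of i) s = load (int_input n w b) (int (p * j + 1 + index_of i))"
    using assms(1) unfolding input_ok_def by blast
  also have "\<dots> = (vec_list b @ ?L) ! (p * j + index_of i)"
  proof -
    have "p * j + index_of i < length (vec_list b @ ?L)"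
      unfolding length_append len length_vec_list p[symmetric] pj using lt by simp
    then show ?thesis unfolding int_input_def by (subst load_nth) (simp_all del: upt_Suc)
  qed
  also have "\<dots> = ?L ! (p * (j - 1) + index_of i)"
    by (simp add: nth_append p[symmetric] pj del: upt_Suc)
  finally show ?thesis using nth by simp
qed

lemma rinp_C:
  assumes "input_ok s" "1 \<le> j" "j \<le> n"
  shows "rinp (D * j - D + coord e c) s = C j $ e $ c"
proof -
  let ?L = "real_input n C"
  have len: "length ?L = D * n" and nth: "?L ! (D * (j - 1) + coord e c) = C j $ e $ c"
    using assms unfolding real_input_def
    by (subst nth_concat_blocks[where L = D]; simp add: D nth_matrix_list del: upt_Suc)+
  have Dj: "D * j - D = D * (j - 1)" by (simp add: right_diff_distrib')
  have "D * (j - 1) + coord e c < D * (j - 1) + D" by (simp add: D)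
  also have "\<dots> = D * j" using assms(2) by (cases j) auto
  also have "\<dots> \<le> D * n" using assms by simp
  finally have "D * (j - 1) + coord e c < D * n" .
  then have "load ?L (int (D * (j - 1) + coord e c)) = ?L ! (D * (j - 1) + coord e c)"
    unfolding load_def nat_int of_nat_less_iff len by simp
  then show ?thesis using assms(1) nth unfolding input_ok_def Dj by simp
qed

lemma extends_properties:
  assumes ext: "extends k r i z s" and "input_ok s" "1 \<le> k" "k \<le> n" "i < p"
  defines "c \<equiv> index_list ! i"
  shows "utility s z = utility s r + placed C k c"
    and "weight s z = weight s r + axis c (w k $ c)"
    and "alive s z"
    and "fld z p s = int r" "fld z (p + 1) s = int (index_of c)"
proof -
  have idx: "index_of c = i" unfolding c_def by (rule index_of_index_list) (use assms p in simp)
  have iff: "index_of c' = i \<longleftrightarrow> c' = c" for c' unfolding idx[symmetric] by simp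
  have "util z (coord e c') s = util r (coord e c') s + (if c' = c then C k $ e $ c' else 0)" for e c'
  proof -
    have "coord e c' < D" by (simp add: D)
    then have "util z (coord e c') s = util r (coord e c') s + (if coord e c' mod p = i then rinp (D * k - D + coord e c') s else 0)"
      using ext unfolding extends_def by blast
    then show ?thesis using iff[of c'] rinp_C[OF assms(2-4), of e c'] by (auto simp: p coord_mod)
  qed
  then show "utility s z = utility s r + placed C k c"
    by (simp add: vec_eq_iff utility_def placed_def)
  have "fld z (index_of c') s = fld r (index_of c') s + (if c' = c then w k $ c' else 0)" for c'
  proof -
    have "index_of c' < p" by (simp add: p)
    then have "fld z (index_of c') s = fld r (index_of c') s + (if index_of c' = i then inp (p * k + 1 + index_of c') s else 0)"
      using ext unfolding extends_def by blast
    then show ?thesis using iff[of c'] inp_w[OF assms(2-4), of c'] by (auto simp del: One_nat_def add_Suc_right)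
  qed
  then show "weight s z = weight s r + axis c (w k $ c)"
    by (auto simp: vec_eq_iff weight_def axis_def)
  show "alive s z" "fld z p s = int r" "fld z (p + 1) s = int (index_of c)"
    using ext idx by (auto simp: extends_def alive_def)
qed

section \<open>Records as encodings of assignments\<close>

text \<open>Parents have smaller numbers, so the ancestry of a record is untouched by writes to
  later records.\<close>

primrec represents :: "nat \<Rightarrow> state \<Rightarrow> nat \<Rightarrow> (nat \<Rightarrow> 'p) \<Rightarrow> bool" where
  "represents 0 s r a \<longleftrightarrow> True"
| "represents (Suc k) s r a \<longleftrightarrow> (\<exists>r'<r. fld r p s = int r' \<and> fld r (p + 1) s = int (index_of (a (Suc k))) \<and> represents k s r' a)"

lemma represents_cong:
  "(\<And>j. j \<in> {1..k} \<Longrightarrow> a j = a' j) \<Longrightarrow> represents k s r a \<longleftrightarrow> represents k s r a'"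
  by (induction k arbitrary: r) auto

lemma represents_fields:
  assumes "\<And>r'. r' \<le> r \<Longrightarrow> fld r' p s' = fld r' p s" "\<And>r'. r' \<le> r \<Longrightarrow> fld r' (p + 1) s' = fld r' (p + 1) s"
  shows "represents k s r a \<Longrightarrow> represents k s' r a"
  using assms
proof (induction k arbitrary: r)
  case (Suc k)
  then obtain r' where r': "r' < r" "fld r p s = int r'" "fld r (p + 1) s = int (index_of (a (Suc k)))" "represents k s r' a"
    by auto
  have "represents k s' r' a" by (rule Suc.IH) (use r' Suc.prems in auto)
  then show ?case using r' Suc.prems by auto
qed simp

text \<open>The second part also ensures that every attained vector of weight sums is attained by a
  live record, since the hull of the empty set is empty.\<close>

definition complete :: "state \<Rightarrow> nat \<Rightarrow> nat set \<Rightarrow> bool" where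
  "complete s k Z \<longleftrightarrow>
     (\<forall>r\<in>Z. alive s r \<longrightarrow> (\<exists>a. represents k s r a \<and> utility s r = total_utility C k a \<and> weight s r = total_weight w k a)) \<and>
     (\<forall>a. total_utility C k a \<in> convex hull (points s Z (total_weight w k a)))"

lemma complete_extended:
  assumes comp: "complete s k {lo..<hi}" and ext: "extended_by (Suc k) hi ({r \<in> {lo..<hi}. alive s r} \<times> {..<p}) s s'"
    and inp: "input_ok s" and k: "Suc k \<le> n"
  obtains z where "hi \<le> z" "var NR s' = int z" "frame {R, NR} ({hi..} \<times> UNIV) {hi..} s s'"
    "z - hi \<le> card {r \<in> {lo..<hi}. alive s r} * p" "\<forall>r\<in>{hi..<z}. alive s' r" "complete s' (Suc k) {hi..<z}"
proof -
  let ?A = "{r \<in> {lo..<hi}. alive s r}"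
  obtain z where z: "hi \<le> z" "var NR s' = int z" and fr: "frame {R, NR} ({hi..} \<times> UNIV) {hi..} s s'"
    and new: "\<forall>z'\<in>{hi..<z}. \<exists>(r, i)\<in>?A \<times> {..<p}. extends (Suc k) r i z' s'"
    and all: "\<forall>(r, i)\<in>?A \<times> {..<p}. \<exists>z'\<in>{hi..<z}. extends (Suc k) r i z' s'"
    and card: "z - hi \<le> card (?A \<times> {..<p})"
    using ext unfolding extended_by_def by blast
  have old: "utility s' r = utility s r" "weight s' r = weight s r" if "r < hi" for r
    using that by (auto intro!: utility_frame[OF fr] weight_frame[OF fr])
  have rep: "represents k s' r a" if "represents k s r a" "r < hi" for r a
    by (rule represents_fields[OF _ _ that(1)]) (use that(2) frame_fld[OF fr] in auto)
  note props = extends_properties[OF _ input_ok_frame[OF fr inp] _ k]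
  have 1: "alive s' z' \<and> (\<exists>a. represents (Suc k) s' z' a \<and> utility s' z' = total_utility C (Suc k) a \<and> weight s' z' = total_weight w (Suc k) a)"
    if z': "z' \<in> {hi..<z}" for z'
  proof -
    obtain r i where r: "r \<in> ?A" and i: "i < p" and e: "extends (Suc k) r i z' s'"
      using new z' by fastforce
    obtain a where a: "represents k s r a" "utility s r = total_utility C k a" "weight s r = total_weight w k a"
      using comp r unfolding complete_def by blast
    define a' where "a' = a(Suc k := index_list ! i)"
    have same: "a j = a' j" if "j \<in> {1..k}" for j using that by (simp add: a'_def)
    note t = total_cong[of k a a', OF same]
    have rep': "represents k s' r a'" using rep[OF a(1)] r represents_cong[of k a a', OF same] by auto
    have a'k: "index_list ! i = a' (Suc k)" by (simp add: a'_def)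
    have "represents (Suc k) s' z' a'"
      using rep' props(4,5)[OF e _ i] r z' unfolding a'k by auto
    moreover have "utility s' z' = total_utility C (Suc k) a'"
      using props(1)[OF e _ i] old(1)[of r] r a(2) t(1)[of C] unfolding a'k total_utility_Suc by simp
    moreover have "weight s' z' = total_weight w (Suc k) a'"
      using props(2)[OF e _ i] old(2)[of r] r a(3) t(2)[of w] unfolding a'k total_weight_Suc by simp
    ultimately show ?thesis using props(3)[OF e _ i] by auto
  qed
  have 2: "total_utility C (Suc k) a \<in> convex hull (points s' {hi..<z} (total_weight w (Suc k) a))" for a
  proof -
    let ?c = "a (Suc k)"
    let ?v = "placed C (Suc k) ?c"
    have "total_utility C k a \<in> convex hull (points s {lo..<hi} (total_weight w k a))"
      using comp unfolding complete_def by blast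
    \<comment> \<open>Adding the next item to a fixed cluster is a translation, which commutes with
      taking hulls; the translated generators are points of the new records.\<close>
    then have "?v + total_utility C k a \<in> convex hull ((\<lambda>x. ?v + x) ` points s {lo..<hi} (total_weight w k a))"
      unfolding convex_hull_translation by blast
    moreover have "(\<lambda>x. ?v + x) ` points s {lo..<hi} (total_weight w k a) \<subseteq> points s' {hi..<z} (total_weight w (Suc k) a)"
    proof
      fix x assume "x \<in> (\<lambda>x. ?v + x) ` points s {lo..<hi} (total_weight w k a)"
      then obtain r where r: "r \<in> ?A" "weight s r = total_weight w k a" "x = ?v + utility s r"
        unfolding points_def by auto
      have i: "index_of ?c < p" by (simp add: p)
      then obtain z' where z': "z' \<in> {hi..<z}" and e: "extends (Suc k) r (index_of ?c) z' s'"
        using all r(1) by fastforce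
      have "x = utility s' z'" using props(1)[OF e _ i] old(1)[of r] r by simp
      moreover have "weight s' z' = total_weight w (Suc k) a"
        using props(2)[OF e _ i] old(2)[of r] r by (simp add: total_weight_Suc)
      ultimately show "x \<in> points s' {hi..<z} (total_weight w (Suc k) a)"
        unfolding points_def using z' 1[OF z'] by blast
    qed
    ultimately show ?thesis
      using hull_mono[of _ _ convex] unfolding total_utility_Suc by (subst add.commute) blast
  qed
  show ?thesis
    by (rule that[OF z fr]) (use card 1 2 in \<open>auto simp: complete_def card_cartesian_product\<close>)
qed

lemma complete_frame:
  assumes fr: "frame V (Z \<times> {p + 2}) {} s s'" and comp: "complete s k Z"
    and al: "\<And>r. r \<in> Z \<Longrightarrow> alive s' r \<Longrightarrow> alive s r"
    and hull: "\<And>v. convex hull (points s' Z v) = convex hull (points s Z v)"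
  shows "complete s' k Z"
proof -
  have "utility s' r = utility s r" "weight s' r = weight s r" for r
    by (auto intro!: utility_frame[OF fr] weight_frame[OF fr])
  moreover have "represents k s' r a" if "represents k s r a" for r a
    by (rule represents_fields[OF _ _ that]) (use frame_fld[OF fr] in auto)
  ultimately show ?thesis using comp al hull unfolding complete_def by metis
qed

lemma points_frame: "frame V {} {} s s' \<Longrightarrow> points s' Z v = points s Z v"
  unfolding points_def using utility_frame[of V "{}" "{}" s s'] weight_frame[of V "{}" "{}" s s'] alive_frame[of V "{}" "{}" s s']
  by (intro image_cong Collect_cong) auto

lemma complete_frame_vars:
  assumes fr: "frame V {} {} s s'" and comp: "complete s k Z"
  shows "complete s' k Z"
proof (rule complete_frame[OF _ comp])
  show "frame V (Z \<times> {p + 2}) {} s s'" by (rule frame_mono[OF fr]) auto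
qed (use alive_frame[OF fr] points_frame[OF fr] in auto)

lemma search_time_mono: "h \<le> h' \<Longrightarrow> search_time j h \<le> search_time j h'"
proof (induction j)
  case (Suc j)
  then show ?case unfolding search_time.simps by (intro add_mono mult_le_mono order_refl) simp
qed simp

text \<open>The two assumptions on \<open>h\<close> cap the records before and after extension: each
  live record has \<open>p\<close> successors, discarded ones have none.\<close>

lemma runs_stage:
  assumes vars: "var LO s = int lo" "var HI s = int hi" "lo \<le> hi" "var K s = int k" "var N s = int n"
    and k: "k < n" and inp: "input_ok s" and comp: "complete s k {lo..<hi}"
    and h: "hi - lo \<le> h" "card {r \<in> {lo..<hi}. alive s r} * p \<le> h"
  shows "runs kk orc stage s (stage_time h)
    (\<lambda>s'. \<exists>lo hi. lo \<le> hi \<and> hi - lo \<le> h \<and> var LO s' = int lo \<and> var HI s' = int hi \<and>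
      var K s' = int (Suc k) \<and> var N s' = int n \<and> input_ok s' \<and>
      complete s' (Suc k) {lo..<hi} \<and> irredundant s' {lo..<hi} hi)"
proof -
  define s1 where "s1 = set_var NR (int hi) (set_var K (int (Suc k)) s)"
  have fr1: "frame {K, NR} {} {} s s1" unfolding s1_def by (intro frame_set_var) auto
  have K1: "var K s1 = int (Suc k)" "var NR s1 = int hi" by (simp_all add: s1_def)
  have v1: "var LO s1 = int lo" "var HI s1 = int hi" "var N s1 = int n"
    using vars frame_var[OF fr1] by auto
  have comp1: "complete s1 k {lo..<hi}"
    by (rule complete_frame_vars[OF fr1 comp])
  have al1: "{r \<in> {lo..<hi}. alive s1 r} = {r \<in> {lo..<hi}. alive s r}" using alive_frame[OF fr1] by auto
  have inp1: "input_ok s1" by (rule input_ok_frame[OF fr1 inp])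
  let ?Q2 = "\<lambda>s2. extended_by (Suc k) hi ({r \<in> {lo..<hi}. alive s1 r} \<times> {..<p}) s1 s2"
  have r2: "runs kk orc extend s1 ((hi - lo) * (p * (p + D + 6) + 2 + 2) + 2) ?Q2"
    using runs_extend[OF v1(1,2) vars(3) K1(2,1)] unfolding alive_def by simp
  define Q3 where "Q3 = (\<lambda>s3. \<exists>z. hi \<le> z \<and> z - hi \<le> h \<and> var LO s3 = int hi \<and> var HI s3 = int z \<and>
      var K s3 = int (Suc k) \<and> var N s3 = int n \<and> input_ok s3 \<and> (\<forall>r\<in>{hi..<z}. alive s3 r) \<and> complete s3 (Suc k) {hi..<z})"
  have r3: "runs kk orc (assign LO (Var HI)) s2 1 (\<lambda>s3. s3 = set_var LO (int hi) s2) \<and> Q3 (set_var HI (var NR s2) (set_var LO (int hi) s2))"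
    if E: "?Q2 s2" for s2
  proof -
    obtain z where z: "hi \<le> z" "var NR s2 = int z"
      and fr2: "frame {R, NR} ({hi..} \<times> UNIV) {hi..} s1 s2"
      and card: "z - hi \<le> card {r \<in> {lo..<hi}. alive s1 r} * p" and al: "\<forall>r\<in>{hi..<z}. alive s2 r"
      and comp2: "complete s2 (Suc k) {hi..<z}"
      by (rule complete_extended[OF comp1 E inp1 Suc_leI[OF k]])
    define s3 where "s3 = set_var HI (int z) (set_var LO (int hi) s2)"
    have fr3: "frame {LO, HI} {} {} s2 s3" unfolding s3_def by (intro frame_set_var) auto
    have HI: "var HI s2 = int hi" using frame_var[OF fr2, of HI] v1 by simp
    have "complete s3 (Suc k) {hi..<z}"
      by (rule complete_frame_vars[OF fr3 comp2])
    then have "Q3 s3"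
      unfolding Q3_def
    proof (intro exI[of _ z] conjI ballI)
      show "z - hi \<le> h" using card h(2) al1 by simp
      show "input_ok s3" by (rule input_ok_frame[OF fr3 input_ok_frame[OF fr2 inp1]])
      show "var K s3 = int (Suc k)" "var N s3 = int n"
        using frame_var[OF fr3] frame_var[OF fr2] K1(1) v1(3) by simp_all
      show "alive s3 r" if "r \<in> {hi..<z}" for r using al that alive_frame[OF fr3] by simp
    qed (use z in \<open>simp_all add: s3_def\<close>)
    moreover have "runs kk orc (assign LO (Var HI)) s2 1 (\<lambda>s3. s3 = set_var LO (int hi) s2)"
      by (rule runs_assign) (simp_all add: HI)
    ultimately show ?thesis using z(2) unfolding s3_def by simp
  qed
  have r5: "runs kk orc prune s3 (h * (search_time (Suc D) h + 2) + 2)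
    (\<lambda>s'. \<exists>lo hi. lo \<le> hi \<and> hi - lo \<le> h \<and> var LO s' = int lo \<and> var HI s' = int hi \<and>
      var K s' = int (Suc k) \<and> var N s' = int n \<and> input_ok s' \<and>
      complete s' (Suc k) {lo..<hi} \<and> irredundant s' {lo..<hi} hi)" if Q: "Q3 s3" for s3
  proof -
    obtain z where z: "hi \<le> z" "z - hi \<le> h" and v3: "var LO s3 = int hi" "var HI s3 = int z" "var K s3 = int (Suc k)" "var N s3 = int n"
      and inp3: "input_ok s3" and al3: "\<And>r. r \<in> {hi..<z} \<Longrightarrow> alive s3 r" and comp3: "complete s3 (Suc k) {hi..<z}"
      using Q unfolding Q3_def by blast
    show ?thesis
    proof (rule runs_mono[OF runs_prune[OF z(1) v3(1,2) al3]])
      show "(z - hi) * (search_time (Suc D) (z - hi) + 2) + 2 \<le> h * (search_time (Suc D) h + 2) + 2"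
        by (intro add_mono mult_le_mono z(2) search_time_mono order_refl)
      fix s' assume s': "frame ({X} \<union> Y ` {..D}) ({hi..<z} \<times> {p + 2}) {} s3 s' \<and> irredundant s' {hi..<z} z \<and>
        (\<forall>v. convex hull (points s' {hi..<z} v) = convex hull (points s3 {hi..<z} v))"
      then have fr: "frame ({X} \<union> Y ` {..D}) ({hi..<z} \<times> {p + 2}) {} s3 s'" by blast
      have "complete s' (Suc k) {hi..<z}"
        by (rule complete_frame[OF fr comp3]) (use al3 s' in auto)
      then show "\<exists>lo hi. lo \<le> hi \<and> hi - lo \<le> h \<and> var LO s' = int lo \<and> var HI s' = int hi \<and>
          var K s' = int (Suc k) \<and> var N s' = int n \<and> input_ok s' \<and>
          complete s' (Suc k) {lo..<hi} \<and> irredundant s' {lo..<hi} hi"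
        using z s' v3 input_ok_frame[OF fr inp3] frame_var[OF fr]
        by (intro exI[of _ hi] exI[of _ z]) (simp del: of_nat_Suc)
    qed auto
  qed
  show ?thesis
    unfolding stage_def
  proof (rule runs_Seq[where ?T1.0 = 1 and ?Q1.0 = "\<lambda>s'. s' = set_var K (int (Suc k)) s"])
    show "runs kk orc (assign K (IAdd (Var K) (IConst 1))) s 1 (\<lambda>s'. s' = set_var K (int (Suc k)) s)"
      by (rule runs_assign) (simp_all add: vars add.commute)
    show "runs kk orc (Seq (assign NR (Var HI)) (Seq extend (Seq (assign LO (Var HI)) (Seq (assign HI (Var NR)) prune)))) s'
      (1 + ((h * (p * (p + D + 6) + 2 + 2) + 2) + (1 + (1 + (h * (search_time (Suc D) h + 2) + 2)))))
      (\<lambda>s'. \<exists>lo hi. lo \<le> hi \<and> hi - lo \<le> h \<and> var LO s' = int lo \<and> var HI s' = int hi \<and>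
      var K s' = int (Suc k) \<and> var N s' = int n \<and> input_ok s' \<and>
      complete s' (Suc k) {lo..<hi} \<and> irredundant s' {lo..<hi} hi)" if "s' = set_var K (int (Suc k)) s" for s'
    proof (rule runs_Seq[where ?T1.0 = 1 and ?Q1.0 = "\<lambda>s'. s' = s1"
          and ?T2.0 = "(h * (p * (p + D + 6) + 2 + 2) + 2) + (1 + (1 + (h * (search_time (Suc D) h + 2) + 2)))"], goal_cases)
      case 1
      show ?case by (rule runs_assign) (simp_all add: that vars s1_def)
    next
      case (2 s1')
      show ?case unfolding 2
      proof (rule runs_Seq[OF r2, where ?T2.0 = "1 + (1 + (h * (search_time (Suc D) h + 2) + 2))"], goal_cases)
        case (1 s2)
        show ?case
        proof (rule runs_Seq[OF conjunct1[OF r3[OF 1]], where ?T2.0 = "1 + (h * (search_time (Suc D) h + 2) + 2)"], goal_cases)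
          case (1 s3)
          have "runs kk orc (assign HI (Var NR)) s3 1 Q3"
            by (rule runs_assign) (use 1 conjunct2[OF r3[OF \<open>?Q2 s2\<close>]] in simp_all)
          then show ?case by (rule runs_Seq[OF _ r5]) simp_all
        qed simp
      next
        case 2
        show ?case by (intro add_mono mult_le_mono h(1) order_refl)
      qed
    qed simp
  qed (simp add: stage_time_def)
qed

section \<open>The loop over the items and the number of records\<close>

definition dp_inv :: "nat \<Rightarrow> nat \<Rightarrow> state \<Rightarrow> bool" where
  "dp_inv h k s \<longleftrightarrow> (\<exists>lo hi. lo \<le> hi \<and> hi - lo \<le> h \<and> var LO s = int lo \<and> var HI s = int hi \<and>
     var K s = int k \<and> var N s = int n \<and> input_ok s \<and> complete s k {lo..<hi} \<and> irredundant s {lo..<hi} hi)"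

text \<open>The count of extreme assignments of \<open>k\<close> items, with \<open>c\<close> for
  the cardinality of \<open>\<Omega>\<close>. All exponents are constants, so this is polynomial in
  \<open>k\<close>.\<close>

definition record_bound :: "nat \<Rightarrow> nat \<Rightarrow> nat" where
  "record_bound c k = (k + 1) ^ (c * p) * (((k + 1) * p) ^ p + 1) ^ D"

lemma record_bound_mono: "k \<le> k' \<Longrightarrow> record_bound c k \<le> record_bound c k'"
  unfolding record_bound_def by (intro mult_le_mono power_mono add_mono order_refl) auto

lemma card_alive_le:
  assumes "finite \<Omega>" "\<And>j. j \<in> {1..k} \<Longrightarrow> w j \<in> \<Omega>"
    and comp: "complete s k {lo..<hi}" and irr: "irredundant s {lo..<hi} hi"
  shows "card {r \<in> {lo..<hi}. alive s r} \<le> record_bound (card \<Omega>) k"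
proof -
  let ?A = "{r \<in> {lo..<hi}. alive s r}"
  have "\<forall>r\<in>?A. \<exists>a. utility s r = total_utility C k a \<and> weight s r = total_weight w k a"
    using comp unfolding complete_def by blast
  then obtain a where a: "\<And>r. r \<in> ?A \<Longrightarrow> utility s r = total_utility C k (a r) \<and> weight s r = total_weight w k (a r)"
    by metis
  have bound: "record_bound (card \<Omega>) k = (k + 1) ^ (card \<Omega> * CARD('p)) *
      (((k + 1) * CARD('p)) ^ CARD('p) + 1) ^ (CARD('d) * CARD('p))"
    unfolding record_bound_def by (simp only: p D)
  show ?thesis unfolding bound
  proof (rule card_extreme_assignments_le[where a = a and w = w and C = C])
    fix z
    have "points s {lo..<hi} (total_weight w k z) = {total_utility C k (a r) |r. r \<in> ?A \<and> total_weight w k (a r) = total_weight w k z}"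
      unfolding points_def using a by force
    then show "total_utility C k z \<in> convex hull {total_utility C k (a r) |r. r \<in> ?A \<and> total_weight w k (a r) = total_weight w k z}"
      using comp unfolding complete_def by metis
  next
    fix r assume r: "r \<in> ?A"
    then have "\<not> redundant_at s r {lo..<hi}" using irr unfolding irredundant_def by auto
    moreover have "utility s ` {y \<in> {lo..<hi}. y \<noteq> r \<and> alive s y \<and> weight s y = weight s r} =
      {total_utility C k (a y) |y. y \<in> ?A \<and> y \<noteq> r \<and> total_weight w k (a y) = total_weight w k (a r)}"
      using a r by force
    ultimately show "total_utility C k (a r) \<notin>
      convex hull {total_utility C k (a y) |y. y \<in> ?A \<and> y \<noteq> r \<and> total_weight w k (a y) = total_weight w k (a r)}"
      using a[OF r] unfolding redundant_at_def by metis
  qed (use assms in auto)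
qed

lemma input_state_simps:
  "v < D + 11 \<Longrightarrow> var v (input_state n C w b) = 0"
  "q < p + 3 \<Longrightarrow> fld r q (input_state n C w b) = 0"
  "m < D \<Longrightarrow> util r m (input_state n C w b) = 0"
  "input_ok (input_state n C w b)"
  using iaddr_less[of q r] raddr_neg[of m r]
  by (auto simp: input_state_def load_def var_def fld_def util_def input_ok_def inp_def rinp_def)

lemma coord_less_D: "coord (e :: 'd) (c :: 'p) < D"
  by (simp add: D)

lemma index_of_less_fields: "index_of (i :: 'p) < p + 3"
  by (simp add: p trans_less_add1)

lemma runs_dp:
  assumes \<Omega>: "finite \<Omega>" "\<And>j. j \<in> {1..n} \<Longrightarrow> w j \<in> \<Omega>"
    and h: "record_bound (card \<Omega>) n * p \<le> h" "1 \<le> h"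
  shows "runs kk orc dp (input_state n C w b) (n * (stage_time h + 1) + 3) (dp_inv h n)"
proof -
  define s0 where "s0 = input_state n C w b"
  define s1 where "s1 = set_var HI 1 (set_var N (int n) s0)"
  have fr: "frame {N, HI} {} {} s0 s1" unfolding s1_def by (intro frame_set_var) auto
  have ok: "input_ok s1" by (rule input_ok_frame[OF fr]) (simp add: s0_def input_state_simps)
  have u: "utility s1 0 = 0"
    unfolding utility_frame[OF fr, of 0, simplified]
    by (simp add: s0_def utility_def vec_eq_iff input_state_simps coord_less_D)
  have wt: "weight s1 0 = 0"
    unfolding weight_frame[OF fr, of 0, simplified]
    by (simp add: s0_def weight_def vec_eq_iff input_state_simps index_of_less_fields)
  have "alive s1 0" using alive_frame[OF fr, of 0] by (simp add: s0_def alive_def input_state_simps)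
  then have "points s1 {0..<1} 0 = {0}" using u wt by (auto simp: points_def)
  then have "complete s1 0 {0..<1}"
    using u wt unfolding complete_def by (simp add: total_utility_def total_weight_def)
  moreover have "irredundant s1 {0..<1} 1"
  \<comment> \<open>The initial record has no comparators, and nothing lies in the hull of the empty
    set.\<close>
  proof -
    have empty: "{y \<in> {0..<1::nat}. y \<noteq> 0 \<and> Q y} = {}" for Q by auto
    have "\<not> redundant_at s1 0 {0..<1}" unfolding redundant_at_def empty by simp
    then show ?thesis by (simp add: irredundant_def)
  qed
  moreover have "var LO s1 = int 0" "var HI s1 = int 1" "var K s1 = int 0" "var N s1 = int n"
    by (simp_all add: s1_def s0_def input_state_simps)
  ultimately have start: "dp_inv h 0 s1"
    unfolding dp_inv_def using ok h(2) by (intro exI[of _ 0] exI[of _ 1]) simp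
  have loop: "runs kk orc (While (ILe (IAdd (Var K) (IConst 1)) (Var N)) stage) s1 ((n - 0) * (stage_time h + 1) + 1) (dp_inv h n)"
  proof (rule runs_While[where I = "dp_inv h"])
    fix k s assume k: "k < n" and "dp_inv h k s"
    then obtain lo hi where lohi: "lo \<le> hi" "hi - lo \<le> h" "var LO s = int lo" "var HI s = int hi" "var K s = int k" "var N s = int n"
      and s: "input_ok s" "complete s k {lo..<hi}" "irredundant s {lo..<hi} hi"
      unfolding dp_inv_def by blast
    have "card {r \<in> {lo..<hi}. alive s r} \<le> record_bound (card \<Omega>) k"
      by (rule card_alive_le[OF \<Omega>(1) _ s(2,3)]) (use \<Omega>(2) k in auto)
    also have "\<dots> \<le> record_bound (card \<Omega>) n" using k by (intro record_bound_mono) simp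
    finally have "card {r \<in> {lo..<hi}. alive s r} * p \<le> record_bound (card \<Omega>) n * p" by (rule mult_le_mono1)
    also note h(1)
    finally have "runs kk orc stage s (stage_time h) (dp_inv h (Suc k))"
      unfolding dp_inv_def by (intro runs_stage[OF lohi(3,4,1,5,6) k s(1,2) lohi(2)])
    then show "bval kk orc (ILe (IAdd (Var K) (IConst 1)) (Var N)) s \<and> runs kk orc stage s (stage_time h) (dp_inv h (Suc k))"
      using k lohi by simp
  qed (use start in \<open>auto simp: dp_inv_def\<close>)
  have n: "ival (IMem (IConst 0)) s0 = int n"
    using inp_n[of s0] by (simp add: s0_def input_state_simps ival.simps(2) inp_def)
  show ?thesis
    unfolding dp_def s0_def[symmetric]
  proof (rule runs_Seq[where ?T1.0 = 1 and ?Q1.0 = "\<lambda>s. s = set_var N (int n) s0" and ?T2.0 = "1 + (n * (stage_time h + 1) + 1)"], goal_cases)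
    case 1
    show ?case by (rule runs_assign) (simp_all add: n)
  next
    case (2 s)
    have "runs kk orc (assign HI (IConst 1)) s 1 (\<lambda>s. s = s1)"
      by (rule runs_assign) (simp_all add: 2 s1_def)
    then show ?case by (rule runs_Seq) (use loop in auto)
  qed simp
qed

section \<open>Selection with the oracle and backtracking\<close>

lemma block_utility: "block D (snd s) (raddr r 0) = matrix_list (utility s r)"
proof (rule nth_equalityI)
  show "length (block D (snd s) (raddr r 0)) = length (matrix_list (utility s r))"
    by (simp add: block_def D)
  fix m assume "m < length (block D (snd s) (raddr r 0))"
  then have m: "m < D" by (simp add: block_def)
  then obtain e :: 'd and c :: 'p where c: "m = coord e c" unfolding D by (rule coord_cases)
  have "block D (snd s) (raddr r 0) ! m = util r m s"
    using m by (simp add: block_def util_def raddr_def algebra_simps)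
  also have "\<dots> = matrix_list (utility s r) ! m" unfolding c nth_matrix_list by (simp add: utility_def)
  finally show "block D (snd s) (raddr r 0) ! m = matrix_list (utility s r) ! m" .
qed

lemma bval_OracleLe:
  assumes "ival e s = int r" "ival e' s = int r'"
  shows "bval D (comparison_oracle f) (OracleLe (util_addr e 0) (util_addr e' 0)) s \<longleftrightarrow> f (utility s r) \<le> f (utility s r')"
  using assms by (simp add: ival_util_addr block_utility comparison_oracle_def inv_f_f[OF inj_matrix_list])

lemma bval_candidate:
  assumes "input_ok s" "var R s = int r"
  shows "bval kk orc candidate s \<longleftrightarrow> alive s r \<and> weight s r = b"
proof -
  have range: "{..<p} = range (index_of :: 'p \<Rightarrow> nat)"
    by (auto simp: p) (metis index_of_index_list rangeI)
  have "ival (IMem (IConst (1 + int q))) s = inp (1 + q) s" for q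
    by (simp add: ival.simps(2) inp_def)
  then have "bval kk orc candidate s \<longleftrightarrow> alive s r \<and> (\<forall>q\<in>{..<p}. fld r q s = inp (1 + q) s)"
    using assms(2) by (auto simp: candidate_def alive_def)
  also have "\<dots> \<longleftrightarrow> alive s r \<and> weight s r = b"
    unfolding range weight_def vec_eq_iff using inp_b[OF assms(1)] by simp
  finally show ?thesis .
qed

text \<open>Everything refers to the state before the selection, which leaves the records alone. The
  value -1 means that no candidate has been met, and no record has that number.\<close>

definition best_among :: "state \<Rightarrow> nat \<Rightarrow> nat \<Rightarrow> int \<Rightarrow> bool" where
  "best_among s lo hi x \<longleftrightarrow>
     (if \<forall>r\<in>{lo..<hi}. \<not> (alive s r \<and> weight s r = b) then x = - 1
      else \<exists>\<beta>\<in>{lo..<hi}. x = int \<beta> \<and> alive s \<beta> \<and> weight s \<beta> = b \<and>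
        (\<forall>r\<in>{lo..<hi}. alive s r \<and> weight s r = b \<longrightarrow> f (utility s r) \<le> f (utility s \<beta>)))"

lemma best_among_Suc:
  assumes "best_among s lo r x" "lo \<le> r"
  shows "best_among s lo (Suc r)
    (if alive s r \<and> weight s r = b \<and> \<not> (0 \<le> x \<and> \<not> f (utility s (nat x)) \<le> f (utility s r)) then int r else x)"
proof -
  have range: "{lo..<Suc r} = insert r {lo..<r}" using assms(2) by auto
  show ?thesis
  proof (cases "\<forall>r\<in>{lo..<r}. \<not> (alive s r \<and> weight s r = b)")
    case True
    then have "x = - 1" using assms(1) by (simp add: best_among_def)
    then show ?thesis using True unfolding best_among_def range by auto
  next
    case False
    then obtain \<beta> where \<beta>: "\<beta> \<in> {lo..<r}" "x = int \<beta>" "alive s \<beta> \<and> weight s \<beta> = b"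
      and max: "\<forall>r\<in>{lo..<r}. alive s r \<and> weight s r = b \<longrightarrow> f (utility s r) \<le> f (utility s \<beta>)"
      using assms(1) unfolding best_among_def if_not_P[OF False] by blast
    have nempty: "\<not> (\<forall>r\<in>{lo..<Suc r}. \<not> (alive s r \<and> weight s r = b))" using False unfolding range by auto
    let ?x = "if alive s r \<and> weight s r = b \<and> \<not> (0 \<le> x \<and> \<not> f (utility s (nat x)) \<le> f (utility s r)) then int r else x"
    show ?thesis
    proof (cases "alive s r \<and> weight s r = b \<and> f (utility s \<beta>) \<le> f (utility s r)")
      case True
      then have "f (utility s r') \<le> f (utility s r)" if "r' \<in> {lo..<r}" "alive s r' \<and> weight s r' = b" for r'
        using max that order_trans by blast
      then have "\<exists>\<beta>\<in>{lo..<Suc r}. int r = int \<beta> \<and> alive s \<beta> \<and> weight s \<beta> = b \<and>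
        (\<forall>r\<in>{lo..<Suc r}. alive s r \<and> weight s r = b \<longrightarrow> f (utility s r) \<le> f (utility s \<beta>))"
        unfolding range using True by (intro bexI[of _ r]) auto
      moreover have "?x = int r" using True \<beta>(2) by simp
      ultimately show ?thesis unfolding best_among_def if_not_P[OF nempty] by (simp only:)
    next
      case F: False
      have "\<exists>\<beta>\<in>{lo..<Suc r}. x = int \<beta> \<and> alive s \<beta> \<and> weight s \<beta> = b \<and>
        (\<forall>r\<in>{lo..<Suc r}. alive s r \<and> weight s r = b \<longrightarrow> f (utility s r) \<le> f (utility s \<beta>))"
        unfolding range using F \<beta> max by (intro bexI[of _ \<beta>]) auto
      moreover have "?x = x" using F \<beta>(2) by auto
      ultimately show ?thesis unfolding best_among_def if_not_P[OF nempty] by (simp only:)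
    qed
  qed
qed

lemma runs_select:
  assumes vars: "var LO s = int lo" "var HI s = int hi" "lo \<le> hi" and ok: "input_ok s"
  shows "runs D (comparison_oracle f) select s ((hi - lo) * 5 + 3)
    (\<lambda>s'. frame {R, BEST} {} {} s s' \<and> best_among s lo hi (var BEST s'))"
proof -
  let ?orc = "comparison_oracle f"
  let ?F = "frame {R, BEST} {} {}"
  define I where "I = (\<lambda>r s'. ?F s s' \<and> best_among s lo r (var BEST s'))"
  define s1 where "s1 = set_var BEST (- 1) s"
  have fr1: "?F s s1" unfolding s1_def by (intro frame_set_var) auto
  have set_I: "I r (set_var R v s')" if "I r s'" for r v s'
    using that frame_set_var[of "{R, BEST}" _ _ s s' R v] by (simp add: I_def)
  have loop: "runs D ?orc (for_loop R (Var LO) (Var HI)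
     (Cond candidate
       (Cond (BAnd (ILe (IConst 0) (Var BEST)) (BNot (OracleLe (util_addr (Var BEST) 0) (util_addr (Var R) 0))))
         Skip (assign BEST (Var R)))
       Skip)) s1 ((hi - lo) * (3 + 2) + 2) (\<lambda>s'. I hi s' \<and> var R s' = int hi)"
  proof (rule runs_for_loop)
    show "I lo (set_var R (int lo) s1)"
      by (rule set_I) (use fr1 in \<open>simp add: I_def best_among_def s1_def\<close>)
    show "ival (Var HI) s' = int hi" if "I r s'" for r s'
      using that frame_var[of "{R, BEST}" "{}" "{}" s s' HI] vars by (auto simp: I_def)
    fix r s' assume r: "lo \<le> r" "r < hi" and I: "I r s'" and R: "var R s' = int r"
    have fr: "?F s s'" using I by (simp add: I_def)
    have u: "utility s' r = utility s r" "weight s' r = weight s r" "alive s' r = alive s r" for r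
      using utility_frame[OF fr] weight_frame[OF fr] alive_frame[OF fr] by auto
    let ?x = "var BEST s'"
    have best: "best_among s lo r ?x" using I by (simp add: I_def)
    have x: "0 \<le> ?x \<Longrightarrow> ?x = int (nat ?x)" by simp
    note cand = bval_candidate[OF input_ok_frame[OF fr ok] R, unfolded u]
    have test: "bval D ?orc (BAnd (ILe (IConst 0) (Var BEST)) (BNot (OracleLe (util_addr (Var BEST) 0) (util_addr (Var R) 0)))) s' \<longleftrightarrow>
        0 \<le> ?x \<and> \<not> f (utility s (nat ?x)) \<le> f (utility s r)"
    proof (cases "0 \<le> ?x")
      case True
      then show ?thesis using bval_OracleLe[of "Var BEST" s' "nat ?x" "Var R" r] R by (simp add: u)
    qed simp
    have Suc: "I (Suc r) s''" if "?F s s''" "var BEST s'' = (if alive s r \<and> weight s r = b \<and>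
        \<not> (0 \<le> ?x \<and> \<not> f (utility s (nat ?x)) \<le> f (utility s r)) then int r else ?x)" for s''
      unfolding I_def that(2) using that(1) best_among_Suc[OF best r(1)] by blast
    have skip: "runs D ?orc Skip s' 1 (\<lambda>s''. var R s'' = int r \<and> I (Suc r) (set_var R (int (Suc r)) s''))"
      if "\<not> (alive s r \<and> weight s r = b \<and> \<not> (0 \<le> ?x \<and> \<not> f (utility s (nat ?x)) \<le> f (utility s r)))"
      by (rule runs_Skip) (use R set_I[OF Suc[OF fr]] that in auto)
    have upd: "runs D ?orc (assign BEST (Var R)) s' 1 (\<lambda>s''. var R s'' = int r \<and> I (Suc r) (set_var R (int (Suc r)) s''))"
      if "alive s r \<and> weight s r = b \<and> \<not> (0 \<le> ?x \<and> \<not> f (utility s (nat ?x)) \<le> f (utility s r))"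
    proof (rule runs_assign)
      have "?F s (set_var BEST (int r) s')" using fr by (rule frame_set_var) auto
      then show "var R (set_var BEST (ival (Var R) s') s') = int r \<and> I (Suc r) (set_var R (int (Suc r)) (set_var BEST (ival (Var R) s') s'))"
        using R that by (intro conjI set_I Suc) auto
    qed simp
    show "runs D ?orc (Cond candidate
       (Cond (BAnd (ILe (IConst 0) (Var BEST)) (BNot (OracleLe (util_addr (Var BEST) 0) (util_addr (Var R) 0))))
         Skip (assign BEST (Var R)))
       Skip) s' 3 (\<lambda>s''. var R s'' = int r \<and> I (Suc r) (set_var R (int (Suc r)) s''))"
    proof (rule runs_Cond[where T = 2], goal_cases)
      case 1
      then show ?case using cand test skip upd by (intro runs_Cond[where T = 1]) auto
    next
      case 2
      then show ?case using cand skip by (intro runs_mono[OF skip]) auto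
    qed simp
  qed (use vars frame_var[OF fr1] in auto)
  have "runs D ?orc (assign BEST (IConst (- 1))) s 1 (\<lambda>s. s = s1)"
    by (rule runs_assign) (simp_all add: s1_def)
  then show ?thesis unfolding select_def
    by (rule runs_Seq[where ?T2.0 = "(hi - lo) * (3 + 2) + 2"])
      (use loop in \<open>auto simp: I_def elim!: runs_mono\<close>)
qed

lemma runs_backtrack:
  assumes "var K s = int n" "var BEST s = int \<beta>" "represents n s \<beta> a"
  shows "runs kk orc backtrack s (n * 4 + 1) (\<lambda>s'. \<forall>j\<in>{1..n}. inp j s' = int (index_of (a j)))"
proof -
  define I where "I = (\<lambda>i s'. var K s' = int (n - i) \<and> (\<exists>r. var BEST s' = int r \<and> represents (n - i) s' r a) \<and>
    (\<forall>j\<in>{Suc (n - i)..n}. inp j s' = int (index_of (a j))))"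
  have "runs kk orc backtrack s ((n - 0) * (3 + 1) + 1) (I n)"
    unfolding backtrack_def
  proof (rule runs_While)
    fix i s assume i: "i < n" and I: "I i s"
    define k where "k = n - Suc i"
    have k: "n - i = Suc k" using i by (simp add: k_def)
    obtain r r' where r: "var BEST s = int r" "fld r p s = int r'" "fld r (p + 1) s = int (index_of (a (Suc k)))" "represents k s r' a"
      using I by (auto simp: I_def k)
    have K: "var K s = int (Suc k)" using I by (simp add: I_def k)
    define s1 where "s1 = set_inp (Suc k) (int (index_of (a (Suc k)))) s"
    define s2 where "s2 = set_var BEST (int r') s1"
    define s3 where "s3 = set_var K (int k) s2"
    have "represents k s3 r' a"
      by (rule represents_fields[OF _ _ r(4)]) (simp_all add: s3_def s2_def s1_def)
    then have "I (Suc i) s3"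
      using I k unfolding I_def k_def[symmetric] by (auto simp: s3_def s2_def s1_def)
    moreover have "runs kk orc (IStore (Var K) (Fld (Var BEST) (p + 1))) s 1 (\<lambda>s. s = s1)"
      by (rule runs_store_inp[of _ "Suc k"]) (use K r in \<open>simp_all add: s1_def\<close>)
    moreover have "runs kk orc (assign BEST (Fld (Var BEST) p)) s1 1 (\<lambda>s. s = s2)"
      by (rule runs_assign) (use r in \<open>simp_all add: s2_def s1_def\<close>)
    moreover have "runs kk orc (assign K (ISub (Var K) (IConst 1))) s2 1 (\<lambda>s. s = s3)"
      by (rule runs_assign) (use K in \<open>simp_all add: s3_def s2_def s1_def\<close>)
    ultimately have "runs kk orc (Seq (IStore (Var K) (Fld (Var BEST) (p + 1)))
       (Seq (assign BEST (Fld (Var BEST) p)) (assign K (ISub (Var K) (IConst 1))))) s 3 (I (Suc i))"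
      by (intro runs_Seq[where ?T1.0 = 1 and ?T2.0 = 2 and ?Q1.0 = "\<lambda>s. s = s1"]
          runs_Seq[where ?T1.0 = 1 and ?T2.0 = 1 and ?Q1.0 = "\<lambda>s. s = s2"]) (auto elim: runs_mono)
    then show "bval kk orc (ILe (IConst 1) (Var K)) s \<and> runs kk orc (Seq (IStore (Var K) (Fld (Var BEST) (p + 1)))
       (Seq (assign BEST (Fld (Var BEST) p)) (assign K (ISub (Var K) (IConst 1))))) s 3 (I (Suc i))"
      using K by simp
  qed (use assms in \<open>auto simp: I_def\<close>)
  then show ?thesis by (rule runs_mono) (auto simp: I_def)
qed

section \<open>Partitions as assignments\<close>

definition clusters :: "(nat \<Rightarrow> 'p) \<Rightarrow> 'p \<Rightarrow> nat set" where
  "clusters a i = {j \<in> {1..n}. a j = i}"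

lemma partitions_eq: "partitions n = range clusters"
proof (intro subset_antisym subsetI)
  fix \<pi> :: "'p \<Rightarrow> nat set" assume "\<pi> \<in> partitions n"
  then have dis: "\<And>i i'. i \<noteq> i' \<Longrightarrow> \<pi> i \<inter> \<pi> i' = {}" and un: "(\<Union>i. \<pi> i) = {1..n}"
    by (auto simp: partitions_def disjoint_family_on_def)
  have "\<forall>j\<in>{1..n}. \<exists>i. j \<in> \<pi> i" using un by blast
  then obtain a where a: "\<And>j. j \<in> {1..n} \<Longrightarrow> j \<in> \<pi> (a j)" by metis
  have "\<pi> i = clusters a i" for i
    using a dis un unfolding clusters_def by blast
  then show "\<pi> \<in> range clusters" by auto
next
  fix \<pi> :: "'p \<Rightarrow> nat set" assume "\<pi> \<in> range clusters"
  then show "\<pi> \<in> partitions n" by (auto simp: partitions_def disjoint_family_on_def clusters_def)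
qed

lemma utility_matrix_clusters: "utility_matrix C (clusters a) = total_utility C n a"
proof -
  have "(\<Sum>j\<in>clusters a c. C j $ e $ c) = (\<Sum>j\<in>{1..n}. if c = a j then C j $ e $ c else 0)" for e c
    unfolding clusters_def by (subst sum.inter_filter) (auto intro!: sum.cong)
  then show ?thesis
    by (simp add: vec_eq_iff utility_matrix_def total_utility_def placed_def transpose_def column_def)
qed

lemma clusters_feasible: "clusters a \<in> feasible n w b \<longleftrightarrow> total_weight w n a = b"
proof -
  have "(\<Sum>j\<in>clusters a i. w j $ i) = (\<Sum>j\<in>{1..n}. axis (a j) (w j $ a j) $ i)" for i
    unfolding clusters_def by (subst sum.inter_filter) (auto intro!: sum.cong simp: axis_def)
  then show ?thesis
    by (simp add: feasible_def partitions_eq total_weight_def vec_eq_iff)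
qed

lemma convex_max_on_hull:
  assumes "convex_on UNIV f" "\<And>y. y \<in> S \<Longrightarrow> f y \<le> B" "x \<in> convex hull S"
  shows "f x \<le> B"
  using convex_on_convex_hull_bound[of S f B] convex_on_subset[OF assms(1)] assms(2,3) by auto

lemma runs_partition_program:
  assumes \<Omega>: "finite \<Omega>" "\<And>j. j \<in> {1..n} \<Longrightarrow> w j \<in> \<Omega>"
    and h: "record_bound (card \<Omega>) n * p \<le> h" "1 \<le> h" and f: "convex_on UNIV f"
  shows "runs D (comparison_oracle f) partition_program (input_state n C w b) (total_time n h) (correct_output n C w b f)"
proof -
  let ?orc = "comparison_oracle f"
  have last: "runs D ?orc (Cond (ILe (IConst 0) (Var BEST)) (Seq backtrack (IStore (IConst 0) (IConst 1))) (IStore (IConst 0) (IConst 0))) s'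
      (n * 4 + 3) (correct_output n C w b f)"
    if comp: "complete s n {lo..<hi}" and fr: "frame {R, BEST} {} {} s s'" and K: "var K s = int n"
      and best: "best_among s lo hi (var BEST s')" for s s' lo hi
  proof (cases "\<forall>r\<in>{lo..<hi}. \<not> (alive s r \<and> weight s r = b)")
    case True
    have "points s {lo..<hi} b = {}" using True by (auto simp: points_def)
    \<comment> \<open>An assignment with sums \<open>b\<close> would have its utility in the hull of
      the empty set.\<close>
    then have "total_weight w n a \<noteq> b" for a using comp unfolding complete_def by (metis convex_hull_empty empty_iff)
    then have "feasible n w b = {}"
      using clusters_feasible partitions_eq by (auto simp: feasible_def)
    moreover have "var BEST s' = - 1" using best True by (simp add: best_among_def)
    ultimately show ?thesis
      by (intro runs_Cond[where T = "n * 4 + 2"] runs_store_inp[of _ 0]) (auto simp: correct_output_def set_inp_def)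
  next
    case False
    then obtain \<beta> where \<beta>: "\<beta> \<in> {lo..<hi}" "var BEST s' = int \<beta>" "alive s \<beta>" "weight s \<beta> = b"
      and max: "\<And>r. r \<in> {lo..<hi} \<Longrightarrow> alive s r \<Longrightarrow> weight s r = b \<Longrightarrow> f (utility s r) \<le> f (utility s \<beta>)"
      using best unfolding best_among_def if_not_P[OF False] by blast
    obtain a where a: "represents n s \<beta> a" "utility s \<beta> = total_utility C n a" "total_weight w n a = b"
      using comp \<beta> unfolding complete_def by metis
    have feas: "clusters a \<in> feasible n w b" using a(3) clusters_feasible by simp
    have opt: "optimal n C w b f (clusters a)"
      unfolding optimal_def is_arg_max_def
    proof (intro conjI feas notI)
      assume "\<exists>\<pi>. \<pi> \<in> feasible n w b \<and> f (utility_matrix C (clusters a)) < f (utility_matrix C \<pi>)"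
      then obtain \<pi> where \<pi>: "\<pi> \<in> feasible n w b" "f (utility_matrix C (clusters a)) < f (utility_matrix C \<pi>)" by blast
      then obtain a' where a': "\<pi> = clusters a'" using partitions_eq by (auto simp: feasible_def)
      then have "total_weight w n a' = b" using \<pi> clusters_feasible by simp
      then have "total_utility C n a' \<in> convex hull (points s {lo..<hi} b)"
        using comp unfolding complete_def by metis
      \<comment> \<open>Convexity of \<open>f\<close> enters here: a bound at the surviving records
        is a bound on their hull, which contains the utility of every feasible assignment.\<close>
      then have "f (total_utility C n a') \<le> f (utility s \<beta>)"
        by (rule convex_max_on_hull[OF f, rotated]) (auto simp: points_def max)
      then show False using \<pi>(2) a(2) by (simp add: a' utility_matrix_clusters)
    qed
    have "represents n s' \<beta> a"
      by (rule represents_fields[OF _ _ a(1)]) (use frame_fld[OF fr] in auto)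
    moreover have "var K s' = int n" using frame_var[OF fr, of K] K by simp
    ultimately have bt: "runs D ?orc backtrack s' (n * 4 + 1) (\<lambda>s'. \<forall>j\<in>{1..n}. inp j s' = int (index_of (a j)))"
      using \<beta>(2) by (intro runs_backtrack)
    have out: "correct_output n C w b f (set_inp 0 1 s'')" if s'': "\<forall>j\<in>{1..n}. inp j s'' = int (index_of (a j))" for s''
    proof -
      have "output_partition n (set_inp 0 1 s'') i = clusters a i" for i
      proof -
        have "(\<exists>m<CARD('p). fst (set_inp 0 1 s'') (int j) = int m \<and> index_list ! m = i) \<longleftrightarrow> a j = i" if j: "j \<in> {1..n}" for j
        proof -
          have "fst (set_inp 0 1 s'') (int j) = int (index_of (a j))"
            using s'' j by (auto simp: set_inp_def inp_def)
          then show ?thesis using index_of_index_list[where 'a = 'p] by auto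
        qed
        then show ?thesis unfolding output_partition_def clusters_def by blast
      qed
      then have "output_partition n (set_inp 0 1 s'') = clusters a" by auto
      then show ?thesis using opt feas by (auto simp: correct_output_def set_inp_def)
    qed
    have "runs D ?orc (Seq backtrack (IStore (IConst 0) (IConst 1))) s' (n * 4 + 2) (correct_output n C w b f)"
      by (rule runs_Seq[OF bt, where ?T2.0 = 1]) (auto intro!: runs_store_inp[of _ 0] out)
    then show ?thesis
      by (intro runs_Cond[where T = "n * 4 + 2"]) (auto simp: \<beta>(2))
  qed
  have rest: "runs D ?orc (Seq select (Cond (ILe (IConst 0) (Var BEST)) (Seq backtrack (IStore (IConst 0) (IConst 1))) (IStore (IConst 0) (IConst 0)))) s
      ((h * 5 + 3) + (n * 4 + 3)) (correct_output n C w b f)" if inv: "dp_inv h n s" for s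
  proof -
    obtain lo hi where lohi: "lo \<le> hi" "hi - lo \<le> h" "var LO s = int lo" "var HI s = int hi" "var K s = int n"
      and s: "input_ok s" "complete s n {lo..<hi}"
      using inv unfolding dp_inv_def by blast
    show ?thesis
      by (rule runs_Seq[OF runs_select[OF lohi(3,4,1) s(1)] last[OF s(2) _ lohi(5)]]) (use lohi(2) in auto)
  qed
  show ?thesis
    unfolding partition_program_def
    by (rule runs_Seq[OF runs_dp[OF \<Omega> h] rest]) (simp_all add: total_time_def)
qed

end

section \<open>Polynomial running time\<close>

definition polynomially_bounded :: "(nat \<Rightarrow> nat) \<Rightarrow> bool" where
  "polynomially_bounded g \<longleftrightarrow> (\<exists>q. \<forall>n. g n \<le> poly q n)"

lemma polynomially_bounded_const: "polynomially_bounded (\<lambda>n. c)"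
  unfolding polynomially_bounded_def by (rule exI[of _ "[:c:]"]) simp

lemma polynomially_bounded_id: "polynomially_bounded (\<lambda>n. n)"
  unfolding polynomially_bounded_def by (rule exI[of _ "[:0, 1:]"]) simp

lemma polynomially_bounded_add:
  assumes "polynomially_bounded g" "polynomially_bounded g'"
  shows "polynomially_bounded (\<lambda>n. g n + g' n)"
proof -
  obtain q q' where "\<And>n. g n \<le> poly q n" "\<And>n. g' n \<le> poly q' n"
    using assms by (auto simp: polynomially_bounded_def)
  then show ?thesis unfolding polynomially_bounded_def by (intro exI[of _ "q + q'"]) (simp add: add_mono)
qed

lemma polynomially_bounded_mult:
  assumes "polynomially_bounded g" "polynomially_bounded g'"
  shows "polynomially_bounded (\<lambda>n. g n * g' n)"
proof -
  obtain q q' where "\<And>n. g n \<le> poly q n" "\<And>n. g' n \<le> poly q' n"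
    using assms by (auto simp: polynomially_bounded_def)
  then show ?thesis unfolding polynomially_bounded_def by (intro exI[of _ "q * q'"]) (simp add: mult_le_mono)
qed

lemma polynomially_bounded_power:
  "polynomially_bounded g \<Longrightarrow> polynomially_bounded (\<lambda>n. g n ^ m)"
  by (induction m) (auto intro: polynomially_bounded_const polynomially_bounded_mult)

lemmas polynomially_bounded_intros =
  polynomially_bounded_add polynomially_bounded_mult polynomially_bounded_power
  polynomially_bounded_id polynomially_bounded_const

text \<open>The depth \<open>j\<close> is a constant, so induction on it merely raises the
  degree.\<close>

lemma polynomially_bounded_search_time:
  "polynomially_bounded g \<Longrightarrow> polynomially_bounded (\<lambda>n. layout.search_time j (g n))"
  by (induction j) (simp_all only: layout.search_time.simps polynomially_bounded_intros)

lemma poly_nat_mono: "x \<le> y \<Longrightarrow> poly q x \<le> poly q y" for q :: "nat poly"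
  by (induction q) (auto intro!: mult_le_mono)

theorem theorem1:
  fixes \<Omega> :: "(int ^ 'p::finite) set"
  assumes "finite \<Omega>"
  shows "\<exists>(prog :: com) (q :: nat poly).
    \<forall>n (C :: nat \<Rightarrow> real ^ 'p ^ 'd::finite) (w :: nat \<Rightarrow> int ^ 'p) (b :: int ^ 'p)
     (f :: real ^ 'p ^ 'd \<Rightarrow> real).
      (\<forall>j\<in>{1..n}. w j \<in> \<Omega>) \<longrightarrow> convex_on UNIV f \<longrightarrow>
      (\<exists>t s. exec (CARD('d) * CARD('p)) (comparison_oracle f) prog (input_state n C w b) t s \<and>
             t \<le> poly q (input_size n C w b) \<and>
             correct_output n C w b f s)"
proof -
  let ?p = "CARD('p)" and ?D = "CARD('d) * CARD('p)"
  \<comment> \<open>The factor \<open>?p\<close> counts the successors of a survivor; the summand 1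
    covers the single initial record.\<close>
  define h where "h = (\<lambda>n. partition_machine.record_bound ?p ?D (card \<Omega>) n * ?p + 1)"
  have "polynomially_bounded h"
    unfolding h_def partition_machine.record_bound_def[OF partition_machine.intro[OF refl refl]]
    by (intro polynomially_bounded_intros)
  then have "polynomially_bounded (\<lambda>n. layout.total_time ?p ?D n (h n))"
    unfolding layout.total_time_def layout.stage_time_def
    by (intro polynomially_bounded_intros polynomially_bounded_search_time)
  then obtain q where q: "\<And>n. layout.total_time ?p ?D n (h n) \<le> poly q n"
    by (auto simp: polynomially_bounded_def)
  show ?thesis
  proof (intro exI[of _ "layout.partition_program ?p ?D"] exI[of _ q] allI impI)
    fix n and C :: "nat \<Rightarrow> real ^ 'p ^ 'd" and w :: "nat \<Rightarrow> int ^ 'p" and b :: "int ^ 'p"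
      and f :: "real ^ 'p ^ 'd \<Rightarrow> real"
    assume w: "\<forall>j\<in>{1..n}. w j \<in> \<Omega>" and f: "convex_on UNIV f"
    interpret partition_machine ?p ?D n C w b f
      by unfold_locales simp_all
    have "runs ?D (comparison_oracle f) partition_program (input_state n C w b) (total_time n (h n)) (correct_output n C w b f)"
      by (rule runs_partition_program[OF assms _ _ _ f]) (use w in \<open>auto simp: h_def\<close>)
    then obtain t s where t: "exec ?D (comparison_oracle f) partition_program (input_state n C w b) t s"
      "t \<le> total_time n (h n)" "correct_output n C w b f s"
      unfolding runs_def by blast
    \<comment> \<open>\<open>q\<close> bounds the time in terms of \<open>n\<close>. The weights
      alone make the input at least \<open>n\<close> numbers long, and a polynomial with natural
      coefficients is monotone.\<close>
    have "n \<le> CARD('p) * n" by simp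
    also have "\<dots> = length (concat (map (\<lambda>j. vec_list (w j)) [1..<Suc n]))"
      by (subst nth_concat_blocks(1)[where L = "CARD('p)"]) (simp_all del: upt_Suc)
    also have "\<dots> \<le> input_size n C w b" by (simp add: input_size_def int_input_def del: upt_Suc)
    finally have "poly q n \<le> poly q (input_size n C w b)" by (rule poly_nat_mono)
    then show "\<exists>t s. exec ?D (comparison_oracle f) partition_program (input_state n C w b) t s \<and>
        t \<le> poly q (input_size n C w b) \<and> correct_output n C w b f s"
      using t q[of n] by (intro exI[of _ t] exI[of _ s]) linarith
  qed
qed

end
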